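(* The Google Scholar Merge Problem is NP-complete.
   Context: The Google Scholar Merge Problem is the following decision problem. Input: - a positive integer page size $p$; - a sequence of nonnegative integer citation counts $c(v_1),\ldots,c(v_n)$ for $n$ original paper versions $v_1,\ldots,v_n$, with the integers encoded in binary; - a partition of $\{1,\ldots,n\}$ into subsets. Two original versions lie in the same subset exactly when they are versions of the same paper and are to be merged. State. At any time there is a current collection of versions. Each current version is a nonempty set of original versions and has citation count equal to the sum of the counts of its members. Initially the current versions are the singletons $\{v_1\},\ldots,\{v_n\}$. Ordering and pages. The current versions are listed in non-increasing order of citation count. Ties are broken by a fixed, polynomial-time computable rule, for example by the smallest index of an original version contained in the version. If a version sits at position $k$ of this list ($k=1,2,\ldots$), it lies on page $\lceil k/p\rceil$. Merge operation. Two distinct current versions may be merged only if both of the following hold: - they lie on the same page in the current list; - all of their original versions belong to the same subset of the partition. Merging replaces the two versions by their union. The union's citation count is the sum of their counts, and the list is re-sorted. Question: does there exist a finite sequence of allowed merges after which, for every subset of the partition, all original versions of that subset are contained in a single current version? *)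

theory Defs
  imports Main
begin

text \<open>Tape symbols are natural numbers; 0 is the blank. Input bits are encoded as
  False = 1, True = 2, and 3 is a separator symbol (used for verifier inputs).
  States are natural numbers: 0 is the start state, 1 accepting-halt, 2 rejecting-halt.
  A machine is a transition function delta : state => symbol => (state, symbol, move),
  with move in {-1,0,1}; it is required to be finite (finitely many states Q and
  symbols G, closed under delta).\<close>

type_synonym tm = "nat \<Rightarrow> nat \<Rightarrow> nat \<times> nat \<times> int"
type_synonym config = "nat \<times> (int \<Rightarrow> nat) \<times> int"

definition sym :: "bool \<Rightarrow> nat" where
  "sym b = (if b then 2 else 1)"

definition tm_wf :: "nat \<Rightarrow> nat \<Rightarrow> tm \<Rightarrow> bool" where
  "tm_wf Q G \<delta> \<longleftrightarrow> 3 \<le> Q \<and> 4 \<le> G \<and>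
     (\<forall>q<Q. \<forall>s<G. fst (\<delta> q s) < Q \<and> fst (snd (\<delta> q s)) < G \<and> snd (snd (\<delta> q s)) \<in> {-1, 0, 1})"

definition tm_step :: "tm \<Rightarrow> config \<Rightarrow> config" where
  "tm_step \<delta> c = (case c of (q, tp, h) \<Rightarrow>
     if q = 1 \<or> q = 2 then (q, tp, h)
     else (case \<delta> q (tp h) of (q', s, m) \<Rightarrow> (q', tp(h := s), h + m)))"

definition tm_init :: "nat list \<Rightarrow> config" where
  "tm_init ws = (0, (\<lambda>i. if 0 \<le> i \<and> i < int (length ws) then ws ! nat i else 0), 0)"

definition tm_run :: "tm \<Rightarrow> nat \<Rightarrow> nat list \<Rightarrow> config" where
  "tm_run \<delta> t ws = (tm_step \<delta> ^^ t) (tm_init ws)"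

definition tm_accepts :: "tm \<Rightarrow> nat list \<Rightarrow> bool" where
  "tm_accepts \<delta> ws \<longleftrightarrow> (\<exists>t. fst (tm_run \<delta> t ws) = 1)"

definition poly_time_tm :: "tm \<Rightarrow> bool" where
  "poly_time_tm \<delta> \<longleftrightarrow> (\<exists>c k. \<forall>ws. set ws \<subseteq> {1, 2, 3} \<longrightarrow>
     fst (tm_run \<delta> (c * (length ws + 1) ^ k) ws) \<in> {1, 2})"

type_synonym language = "bool list set"

definition in_NP :: "language \<Rightarrow> bool" where
  "in_NP L \<longleftrightarrow> (\<exists>Q G \<delta> c k. tm_wf Q G \<delta> \<and> poly_time_tm \<delta> \<and>
     (\<forall>x. x \<in> L \<longleftrightarrow> (\<exists>y. length y \<le> c * (length x + 1) ^ k \<and>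
          tm_accepts \<delta> (map sym x @ [3] @ map sym y))))"

definition poly_computable :: "(bool list \<Rightarrow> bool list) \<Rightarrow> bool" where
  "poly_computable f \<longleftrightarrow> (\<exists>Q G \<delta> c k. tm_wf Q G \<delta> \<and>
     (\<forall>x. \<exists>t \<le> c * (length x + 1) ^ k.
        (case tm_run \<delta> t (map sym x) of (q, tp, h) \<Rightarrow>
           q = 1 \<and> (\<forall>i < length (f x). tp (int i) = sym (f x ! i)) \<and>
           tp (int (length (f x))) = 0)))"

definition poly_reduces :: "language \<Rightarrow> language \<Rightarrow> bool" where
  "poly_reduces L1 L2 \<longleftrightarrow> (\<exists>f. poly_computable f \<and> (\<forall>x. x \<in> L1 \<longleftrightarrow> f x \<in> L2))"

definition NP_hard :: "language \<Rightarrow> bool" where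
  "NP_hard L \<longleftrightarrow> (\<forall>L'. in_NP L' \<longrightarrow> poly_reduces L' L)"

definition NP_complete :: "language \<Rightarrow> bool" where
  "NP_complete L \<longleftrightarrow> in_NP L \<and> NP_hard L"

text \<open>An instance: page size p, citation counts cs (version i has count cs!i,
  indices 0..n-1), and a labelling ls of the versions; versions i and j lie in the
  same subset of the partition iff ls!i = ls!j. Current versions are sets of indices.\<close>

definition gs_count :: "nat list \<Rightarrow> nat set \<Rightarrow> nat" where
  "gs_count cs V = (\<Sum>i\<in>V. cs ! i)"

definition gs_before :: "nat list \<Rightarrow> nat set \<Rightarrow> nat set \<Rightarrow> bool" where
  "gs_before cs V W \<longleftrightarrow> gs_count cs W < gs_count cs V \<or>
     (gs_count cs V = gs_count cs W \<and> Min V < Min W)"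

text \<open>0-based position in the list; the page (0-based) is rank div p, which equals
  ceil(k/p) - 1 for the 1-based position k = rank + 1.\<close>
definition gs_rank :: "nat list \<Rightarrow> nat set set \<Rightarrow> nat set \<Rightarrow> nat" where
  "gs_rank cs S V = card {W \<in> S. gs_before cs W V}"

definition gs_merge_step :: "nat \<Rightarrow> nat list \<Rightarrow> nat list \<Rightarrow> nat set set \<Rightarrow> nat set set \<Rightarrow> bool" where
  "gs_merge_step p cs ls S S' \<longleftrightarrow> (\<exists>V W. V \<in> S \<and> W \<in> S \<and> V \<noteq> W \<and>
     gs_rank cs S V div p = gs_rank cs S W div p \<and>
     (\<forall>i\<in>V \<union> W. \<forall>j\<in>V \<union> W. ls ! i = ls ! j) \<and>
     S' = insert (V \<union> W) (S - {V, W}))"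

definition gs_init :: "nat \<Rightarrow> nat set set" where
  "gs_init n = (\<lambda>i. {i}) ` {..<n}"

definition gs_yes :: "nat \<Rightarrow> nat list \<Rightarrow> nat list \<Rightarrow> bool" where
  "gs_yes p cs ls \<longleftrightarrow> (\<exists>S. (gs_merge_step p cs ls)\<^sup>*\<^sup>* (gs_init (length cs)) S \<and>
     (\<forall>i < length cs. \<forall>j < length cs. ls ! i = ls ! j \<longrightarrow> (\<exists>V\<in>S. i \<in> V \<and> j \<in> V)))"

text \<open>Binary encoding of instances (self-delimiting, LSB first: each bit b becomes
  [True, b], a number is terminated by [False, False]).\<close>
fun bits :: "nat \<Rightarrow> bool list" where
  "bits n = (if n = 0 then [] else odd n # bits (n div 2))"

definition enc_nat :: "nat \<Rightarrow> bool list" where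
  "enc_nat n = concat (map (\<lambda>b. [True, b]) (bits n)) @ [False, False]"

definition enc_inst :: "nat \<Rightarrow> nat list \<Rightarrow> nat list \<Rightarrow> bool list" where
  "enc_inst p cs ls = enc_nat p @ enc_nat (length cs) @ concat (map enc_nat cs) @ concat (map enc_nat ls)"

definition GSMP :: language where
  "GSMP = {enc_inst p cs ls | p cs ls. 0 < p \<and> length ls = length cs \<and> gs_yes p cs ls}"

end

theory Submission
  imports Defs "HOL-Library.Countable" "HOL-Library.Nat_Bijection"
begin

text \<open>
  Turing machines are programmed through a term language of truncated loops over small numbers,
  compiled to programs over counters. A counter is a pebble on the tape, so that each instruction
  is a sweep over the tape and back.

  \<^emph>\<open>Membership.\<close> A certificate lists pairs of representatives to be merged. The citation count of a
  version is an exponentially large number, but its binary digits are computable from column sums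
  with small carries.

  \<^emph>\<open>Hardness.\<close> The computation tableau is a tiling problem on a line in which constraints relate
  cells at distance 1 and at the row length. A tile is a number written with one digit per cell and
  constraint: equal colours \<open>f = g\<close> become digits \<open>f\<close> and \<open>C - g\<close> with sum \<open>C\<close>, so tilings are
  subset sums with target \<open>T\<close>. The numbers are the counts of versions of one paper, which also has a
  version of count \<open>T\<close>. Versions of unrelated papers with counts \<open>T + 1\<close> and \<open>T\<close> fill the pages so
  that versions above \<open>T + 1\<close>, equal to \<open>T\<close> and below \<open>T\<close> are on the first, second and third page:
  the version of count \<open>T\<close> can only be merged with a subset of sum \<open>T\<close>.
\<close>

section \<open>Counter programs and their simulation by a Turing machine\<close>

text \<open>Counters hold values in unary, so a term is useful only if its intermediate values stay
  polynomial; an unbounded loop could square repeatedly, hence the truncation. Exponentially large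
  numbers are therefore handled only through their bits: the verifier adds column by column, and the
  reduction writes its counts in a base 2 ^ \<open>\<beta>\<close> whose exponent depends on the
  machine alone, so that each bit of a count is a bit of one bounded digit. The base is chosen so
  large that no subset of the items produces a carry; an equation between sums then is a system of
  equations between digits. Laying the rows of the tableau one after the other turns horizontal and
  vertical neighbours into two fixed distances, but also makes the end of a row adjacent to the
  start of the next. Rows are so wide that the head never reaches their ends. The pages separate
  sums below \<open>T\<close>, equal to \<open>T\<close> and above \<open>T + 1\<close>. The sum
  \<open>T + 1\<close> must be excluded otherwise: all items and \<open>T\<close> are multiples of
  the base.\<close>

datatype test = Lt nat nat | Ne nat nat

datatype com = Inc nat | Clr nat | Wr nat nat | Fail
  | Sq com com | Cond test com com | Wh test com

instance test :: countable by countable_datatype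
instance com :: countable by countable_datatype

definition wsym :: "nat list \<Rightarrow> nat \<Rightarrow> nat" where
  "wsym w i = (if i < length w then w ! i else 0)"

type_synonym store = "(nat \<Rightarrow> nat) \<times> (nat \<Rightarrow> nat)"

fun tval :: "nat list \<Rightarrow> (nat \<Rightarrow> nat) \<Rightarrow> test \<Rightarrow> bool" where
  "tval w s (Lt a b) = (s a < s b)"
| "tval w s (Ne r v) = (wsym w (s r) \<noteq> v)"

text \<open>The stack of commands still to be run is the entire control state, so that it can later
  be kept in the finite control of a Turing machine.\<close>

fun nxt :: "com \<Rightarrow> bool \<Rightarrow> com list \<Rightarrow> com list" where
  "nxt (Sq c d) b k = c # d # k"
| "nxt (Cond t c d) b k = (if b then c else d) # k"
| "nxt (Wh t c) b k = (if b then c # Wh t c # k else k)"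
| "nxt _ b k = k"

fun ctst :: "nat list \<Rightarrow> (nat \<Rightarrow> nat) \<Rightarrow> com \<Rightarrow> bool" where
  "ctst w s (Cond t c d) = tval w s t"
| "ctst w s (Wh t c) = tval w s t"
| "ctst w s _ = False"

fun eff :: "com \<Rightarrow> store \<Rightarrow> store" where
  "eff (Inc r) (s, z) = (s(r := Suc (s r)), z)"
| "eff (Clr r) (s, z) = (s(r := 0), z)"
| "eff (Wr v r) (s, z) = (s, z(s r := v))"
| "eff _ (s, z) = (s, z)"

text \<open>\<open>[]\<close> and \<open>Fail # k\<close> are fixed points: success and failure are
  stuck configurations, to be turned into accepting and rejecting halts.\<close>

fun cstep :: "nat list \<Rightarrow> com list \<times> store \<Rightarrow> com list \<times> store" where
  "cstep w ([], \<sigma>) = ([], \<sigma>)"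
| "cstep w (Fail # k, \<sigma>) = (Fail # k, \<sigma>)"
| "cstep w (c # k, \<sigma>) = (nxt c (ctst w (fst \<sigma>) c) k, eff c \<sigma>)"

fun tcnt :: "test \<Rightarrow> nat set" where
  "tcnt (Lt a b) = {a, b}"
| "tcnt (Ne r v) = {r}"

fun cok :: "nat \<Rightarrow> com \<Rightarrow> bool" where
  "cok K (Inc r) = (r < K)"
| "cok K (Clr r) = (r < K)"
| "cok K (Wr v r) = (v < 3 \<and> r < K)"
| "cok K Fail = True"
| "cok K (Sq c d) = (cok K c \<and> cok K d)"
| "cok K (Cond t c d) = (tcnt t \<subseteq> {..<K} \<and> cok K c \<and> cok K d)"
| "cok K (Wh t c) = (tcnt t \<subseteq> {..<K} \<and> cok K c)"

section \<open>Finiteness of the set of control stacks\<close>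

fun reach :: "com \<Rightarrow> com list set" where
  "reach (Sq c d) = insert [Sq c d] ((\<lambda>x. x @ [d]) ` reach c \<union> reach d)"
| "reach (Cond t c d) = insert [Cond t c d] (reach c \<union> reach d)"
| "reach (Wh t c) = insert [Wh t c] ((\<lambda>x. x @ [Wh t c]) ` reach c)"
| "reach c = {[c]}"

lemma reach_finite [simp]: "finite (reach c)"
  by (induction c) auto

lemma reach_self [simp]: "[c] \<in> reach c"
  by (cases c) auto

lemma reach_nonempty: "x \<in> reach c \<Longrightarrow> x \<noteq> []"
  by (induction c arbitrary: x) auto

lemma nxt_append: "nxt c b (k @ l) = nxt c b k @ l"
  by (cases c) auto

text \<open>A stack of the running part of a composite command has the pending command at its
  bottom. \<open>nxt\<close> touches only the top, so the step is that of the part by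
  \<open>nxt_append\<close>; when the part is finished, exactly the pending command is left.\<close>

lemma reach_closed: "c # k \<in> reach c0 \<Longrightarrow> nxt c b k \<in> insert [] (reach c0)"
proof (induction c0 arbitrary: c k b)
  case (Sq c1 c2)
  consider "c # k = [Sq c1 c2]" | x where "x \<in> reach c1" "c # k = x @ [c2]" | "c # k \<in> reach c2"
    using Sq.prems by auto
  then show ?case
  proof cases
    case 1
    then show ?thesis by (force intro!: image_eqI[of _ _ "[c1]"])
  next
    case 2
    then obtain k' where "x = c # k'" "k = k' @ [c2]"
      using reach_nonempty[OF 2(1)] by (cases x) auto
    then show ?thesis using Sq.IH(1)[of c k' b] 2(1) by (auto simp: nxt_append)
  next
    case 3
    then show ?thesis using Sq.IH(2)[of c k b] by auto
  qed
next
  case (Cond t c1 c2)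
  have "c # k = [Cond t c1 c2] \<or> c # k \<in> reach c1 \<or> c # k \<in> reach c2"
    using Cond.prems by auto
  then show ?case
  proof (elim disjE)
    assume "c # k \<in> reach c1"
    then show ?thesis using Cond.IH(1) by fastforce
  next
    assume "c # k \<in> reach c2"
    then show ?thesis using Cond.IH(2) by fastforce
  qed auto
next
  case (Wh t c1)
  consider "c # k = [Wh t c1]" | x where "x \<in> reach c1" "c # k = x @ [Wh t c1]"
    using Wh.prems by auto
  then show ?case
  proof cases
    case 1
    then show ?thesis by (force intro!: image_eqI[of _ _ "[c1]"])
  next
    case 2
    then obtain k' where "x = c # k'" "k = k' @ [Wh t c1]"
      using reach_nonempty[OF 2(1)] by (cases x) auto
    then show ?thesis using Wh.IH(1)[of c k' b] 2(1) by (auto simp: nxt_append)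
  qed
qed auto

lemma reach_cok: "cok K c \<Longrightarrow> (\<Union>x\<in>reach c. set x) \<subseteq> Collect (cok K)"
  by (induction c) (simp_all add: image_iff Un_subset_iff SUP_le_iff)

text \<open>A tape cell holds an input symbol, an output symbol and the set of counters whose value
  is the position of the cell; the pebble \<open>K\<close> is never moved and marks cell 0.\<close>

type_synonym cell = "nat \<times> nat \<times> nat set"

datatype ctl = Start | Acc | Rej | Scan "com list" | Put nat "com list" | Back nat "com list"

instance ctl :: countable by countable_datatype

text \<open>Evaluated at the leftmost cell with a pebble of a tested counter: if \<open>a\<close> is
  there and \<open>b\<close> is not, then \<open>b\<close> lies strictly further right.\<close>

fun ttest :: "test \<Rightarrow> nat \<Rightarrow> nat set \<Rightarrow> bool" where
  "ttest (Lt a b) x P = (a \<in> P \<and> b \<notin> P)"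
| "ttest (Ne r v) x P = (x \<noteq> v)"

fun cttest :: "com \<Rightarrow> nat \<Rightarrow> nat set \<Rightarrow> bool" where
  "cttest (Cond t c d) x P = ttest t x P"
| "cttest (Wh t c) x P = ttest t x P"
| "cttest _ x P = False"

text \<open>Commands that concern no counter aim at \<open>K\<close>, the pebble on cell 0, and are
  thus performed where the sweep starts.\<close>

fun tgt :: "nat \<Rightarrow> com \<Rightarrow> nat set" where
  "tgt K (Inc r) = {r}"
| "tgt K (Clr r) = {r}"
| "tgt K (Wr v r) = {r}"
| "tgt K (Cond t c d) = tcnt t"
| "tgt K (Wh t c) = tcnt t"
| "tgt K _ = {K}"

text \<open>\<open>Inc\<close> lifts its pebble and drops it one cell to the right;
  \<open>Clr\<close> lifts it and lets the return sweep drop it on cell 0. The other return sweeps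
  carry \<open>K\<close>, whose insertion at cell 0 changes nothing.\<close>

fun act :: "nat \<Rightarrow> com \<Rightarrow> com list \<Rightarrow> cell \<Rightarrow> ctl \<times> cell \<times> int" where
  "act K (Inc r) k (x, z, P) = (Put r k, (x, z, P - {r}), 1)"
| "act K (Clr r) k (x, z, P) = (Back r k, (x, z, P - {r}), 0)"
| "act K (Wr v r) k (x, z, P) = (Back K k, (x, v, P), 0)"
| "act K Fail k (x, z, P) = (Rej, (x, z, P), 0)"
| "act K c k (x, z, P) = (Back K (nxt c (cttest c x P) k), (x, z, P), 0)"

fun raw :: "nat \<Rightarrow> cell" where "raw x = (x, 0, {})"

text \<open>With an empty stack the head walks over the output and replaces every cell by its bare
  output symbol, up to the first 0: \<open>poly_computable\<close> wants plain symbols from cell 0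
  on, followed by a blank.\<close>

fun trans :: "nat \<Rightarrow> com \<Rightarrow> ctl \<Rightarrow> cell \<Rightarrow> ctl \<times> cell \<times> int" where
  "trans K c0 Start (x, z, P) = (Scan [c0], (x, z, {..K}), 0)"
| "trans K c0 (Scan []) (x, z, P) = (if z = 0 then (Acc, raw 0, 0) else (Scan [], raw z, 1))"
| "trans K c0 (Scan (c # k)) (x, z, P) =
     (if tgt K c \<inter> P = {} then (Scan (c # k), (x, z, P), 1) else act K c k (x, z, P))"
| "trans K c0 (Put r k) (x, z, P) = (Back K k, (x, z, insert r P), 0)"
| "trans K c0 (Back r k) (x, z, P) =
     (if K \<in> P then (Scan k, (x, z, insert r P), 0) else (Back r k, (x, z, P), -1))"
| "trans K c0 q (x, z, P) = (q, (x, z, P), 0)"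

type_synonym acfg = "ctl \<times> (int \<Rightarrow> cell) \<times> int"

definition astep :: "nat \<Rightarrow> com \<Rightarrow> acfg \<Rightarrow> acfg" where
  "astep K c0 a = (case a of (q, T, h) \<Rightarrow>
     if q = Acc \<or> q = Rej then (q, T, h)
     else (case trans K c0 q (T h) of (q', y, m) \<Rightarrow> (q', T(h := y), h + m)))"

definition atape :: "nat \<Rightarrow> nat list \<Rightarrow> store \<Rightarrow> int \<Rightarrow> cell" where
  "atape K w \<sigma> i = (if i < 0 then (0, 0, {})
     else (wsym w (nat i), snd \<sigma> (nat i), {r. r \<le> K \<and> fst \<sigma> r = nat i}))"

subsection \<open>Coding into natural numbers\<close>

text \<open>A cell without output and pebbles is coded by its input symbol itself, so the machine
  can start on a plain input word and end on a plain output word.\<close>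

fun enc :: "cell \<Rightarrow> nat" where
  "enc (x, z, P) = x + 4 * (z + 3 * set_encode P)"

definition dec :: "nat \<Rightarrow> cell" where
  "dec n = (n mod 4, n div 4 mod 3, set_decode (n div 12))"

definition cellok :: "nat \<Rightarrow> cell \<Rightarrow> bool" where
  "cellok K y = (case y of (x, z, P) \<Rightarrow> x < 4 \<and> z < 3 \<and> P \<subseteq> {..K})"

lemma set_encode_less: "P \<subseteq> {..K} \<Longrightarrow> set_encode P < 2 ^ Suc K"
proof -
  assume "P \<subseteq> {..K}"
  then have "set_encode P \<le> (\<Sum>i\<le>K. 2 ^ i)"
    unfolding set_encode_def by (auto intro!: sum_mono2)
  also have "\<dots> < 2 ^ Suc K"
    by (induction K) auto
  finally show ?thesis .
qed

lemma enc_less: "cellok K y \<Longrightarrow> enc y < 12 * 2 ^ Suc K"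
  using set_encode_less[of "snd (snd y)" K]
  by (cases y) (auto simp: cellok_def)

lemma dec_enc [simp]: "cellok K y \<Longrightarrow> dec (enc y) = y"
proof (cases y)
  case (fields x z P)
  assume a: "cellok K y"
  then have "finite P" using fields by (auto simp: cellok_def intro: finite_subset)
  moreover have d4: "(x + 4 * m) div 4 = m" if "x < 4" for m :: nat
    using that by simp
  moreover have "(x + 4 * m) mod 4 = x" if "x < 4" for m :: nat
    using that by simp
  moreover have "(x + 4 * (z + 3 * m)) div 12 = m" if "x < 4" "z < 3" for m :: nat
    using d4[of "z + 3 * m"] that div_mult2_eq[of "x + 4 * (z + 3 * m)" 4 3] by simp
  moreover have "(x + 4 * (z + 3 * m)) div 4 mod 3 = z" if "x < 4" "z < 3" for m :: nat
    unfolding d4[OF that(1)] using that by simp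
  ultimately show ?thesis using a fields
    by (simp add: cellok_def dec_def del: distrib_left_numeral)
qed

lemma cellok_dec: "n < 12 * 2 ^ Suc K \<Longrightarrow> cellok K (dec n)"
proof -
  assume "n < 12 * 2 ^ Suc K"
  then have m: "n div 12 < 2 ^ Suc K" by (simp add: less_mult_imp_div_less mult.commute)
  have "set_decode (n div 12) \<subseteq> {..K}"
  proof
    fix r assume "r \<in> set_decode (n div 12)"
    then have "odd (n div 12 div 2 ^ r)" by (simp add: set_decode_def)
    then have "2 ^ r \<le> n div 12" by (metis div_less even_zero not_le)
    then have "(2::nat) ^ r < 2 ^ Suc K" using m by linarith
    then show "r \<in> {..K}" using power_less_imp_less_exp[of "2::nat" r "Suc K"] by simp
  qed
  then show ?thesis by (simp add: cellok_def dec_def)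
qed

fun qc :: "ctl \<Rightarrow> nat" where
  "qc Start = 0" | "qc Acc = 1" | "qc Rej = 2" | "qc q = 3 + to_nat q"

definition qd :: "nat \<Rightarrow> ctl" where
  "qd n = (if n = 0 then Start else if n = 1 then Acc else if n = 2 then Rej else from_nat (n - 3))"

lemma qd_qc [simp]: "qd (qc q) = q"
  by (cases q) (auto simp: qd_def)

lemma qc_halt: "qc q = Suc 0 \<longleftrightarrow> q = Acc" "qc q = 2 \<longleftrightarrow> q = Rej"
  by (cases q; simp)+

definition stacks :: "com \<Rightarrow> com list set" where
  "stacks c0 = insert [] (reach c0)"

fun ctlok :: "nat \<Rightarrow> com \<Rightarrow> ctl \<Rightarrow> bool" where
  "ctlok K c0 (Scan k) = (k \<in> stacks c0)"
| "ctlok K c0 (Put r k) = (r \<le> K \<and> k \<in> stacks c0)"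
| "ctlok K c0 (Back r k) = (r \<le> K \<and> k \<in> stacks c0)"
| "ctlok K c0 _ = True"

definition ctls :: "nat \<Rightarrow> com \<Rightarrow> ctl set" where
  "ctls K c0 = Collect (ctlok K c0)"

lemma stacks_Nil [simp]: "[] \<in> stacks c0"
  and stacks_init [simp]: "[c0] \<in> stacks c0"
  and finite_stacks: "finite (stacks c0)"
  by (simp_all add: stacks_def)

lemma stacks_nxt: "c # k \<in> stacks c0 \<Longrightarrow> nxt c b k \<in> stacks c0"
  using reach_closed[of c k c0 b] by (auto simp: stacks_def)

lemma stacks_cok: "cok K c0 \<Longrightarrow> c # k \<in> stacks c0 \<Longrightarrow> cok K c"
  using reach_cok[of K c0] by (force simp: stacks_def)

lemma finite_ctls: "finite (ctls K c0)"
proof (rule finite_subset)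
  show "ctls K c0 \<subseteq> {Start, Acc, Rej} \<union> Scan ` stacks c0
     \<union> (\<Union>r\<in>{..K}. Put r ` stacks c0 \<union> Back r ` stacks c0)"
  proof
    fix q assume "q \<in> ctls K c0"
    then show "q \<in> {Start, Acc, Rej} \<union> Scan ` stacks c0
     \<union> (\<Union>r\<in>{..K}. Put r ` stacks c0 \<union> Back r ` stacks c0)"
      by (cases q) (auto simp: ctls_def)
  qed
qed (simp add: finite_stacks)

text \<open>\<open>tm_wf\<close> constrains all states below \<open>Q\<close>, while the codes of
  \<open>ctls\<close> may leave gaps; the default value keeps the gaps inside the bounds.\<close>

definition mk_tm :: "nat \<Rightarrow> com \<Rightarrow> tm" where
  "mk_tm K c0 q x = (if q \<in> qc ` ctls K c0
     then (case trans K c0 (qd q) (dec x) of (q', y, m) \<Rightarrow> (qc q', enc y, m)) else (0, 0, 0))"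

lemma trans_ok:
  assumes "cok K c0" "q \<in> ctls K c0" "cellok K y" "trans K c0 q y = (q', y', m)"
  shows "q' \<in> ctls K c0" "cellok K y'" "m \<in> {-1, 0, 1}"
proof -
  obtain x z P where y: "y = (x, z, P)" by (cases y)
  have q: "ctlok K c0 q" using assms(2) by (simp add: ctls_def)
  have *: "ctlok K c0 q' \<and> cellok K y' \<and> m \<in> {-1, 0, 1}"
  proof (cases q)
    case (Scan ks)
    show ?thesis
    proof (cases ks)
      case Nil
      then show ?thesis using assms(3,4) y Scan
        by (auto simp: cellok_def split: if_splits)
    next
      case (Cons c k)
      have ck: "c # k \<in> stacks c0" using q Scan Cons by simp
      have c: "cok K c" using stacks_cok[OF assms(1) ck] .
      have n: "nxt c b k \<in> stacks c0" for b using stacks_nxt[OF ck] .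
      show ?thesis
      proof (cases "tgt K c \<inter> P = {}")
        case True
        then show ?thesis using assms(3,4) y Scan Cons q by auto
      next
        case False
        then have a: "act K c k (x, z, P) = (q', y', m)" using assms(4) y Scan Cons by auto
        have xz: "x < 4" "z < 3" "P \<subseteq> {..K}" using assms(3) y by (auto simp: cellok_def)
        then have P: "P - A \<subseteq> {..K}" for A by auto
        from n[of "cttest c x P"] c a[symmetric] xz P show ?thesis
          by (cases c) (simp_all add: cellok_def)
      qed
    qed
  next
    case (Put r k)
    then show ?thesis using q assms(3) assms(4)[symmetric] y by (simp add: cellok_def)
  next
    case (Back r k)
    then show ?thesis using q assms(3) assms(4) y by (auto simp: cellok_def split: if_splits)
  qed (use assms(3,4) y in \<open>auto simp: cellok_def\<close>)
  then show "q' \<in> ctls K c0" "cellok K y'" "m \<in> {-1, 0, 1}" by (auto simp: ctls_def)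
qed

lemma mk_tm_wf:
  assumes "cok K c0"
  shows "\<exists>Q G. tm_wf Q G (mk_tm K c0)"
proof -
  define Q where "Q = Suc (Max (insert 2 (qc ` ctls K c0)))"
  define G where "G = (12::nat) * 2 ^ Suc K"
  have Q: "qc q < Q" if "q \<in> ctls K c0" for q
    unfolding Q_def less_Suc_eq_le using that finite_ctls by (intro Max_ge) auto
  have Q3: "2 < Q"
    unfolding Q_def less_Suc_eq_le using finite_ctls by (intro Max_ge) auto
  have G4: "4 \<le> G" unfolding G_def by simp
  have "fst (mk_tm K c0 q x) < Q \<and> fst (snd (mk_tm K c0 q x)) < G \<and> snd (snd (mk_tm K c0 q x)) \<in> {-1, 0, 1}"
    if "x < G" for q x
  proof (cases "q \<in> qc ` ctls K c0")
    case True
    then obtain q0 where q0: "q = qc q0" "q0 \<in> ctls K c0" by auto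
    obtain q' y m where t: "trans K c0 q0 (dec x) = (q', y, m)" by (metis prod_cases3)
    have "cellok K (dec x)" using that cellok_dec G_def by blast
    note tr = trans_ok[OF assms q0(2) this t]
    show ?thesis using q0 t tr Q enc_less[OF tr(2)] by (simp add: mk_tm_def G_def)
  next
    case False
    then show ?thesis using Q3 G4 by (simp add: mk_tm_def)
  qed
  then show ?thesis using Q3 G4 unfolding tm_wf_def by (intro exI[of _ Q] exI[of _ G]) simp
qed

definition cfg :: "acfg \<Rightarrow> config" where
  "cfg a = (case a of (q, T, h) \<Rightarrow> (qc q, enc \<circ> T, h))"

definition acfg_ok :: "nat \<Rightarrow> com \<Rightarrow> acfg \<Rightarrow> bool" where
  "acfg_ok K c0 a = (case a of (q, T, h) \<Rightarrow> q \<in> ctls K c0 \<and> (\<forall>i. cellok K (T i)))"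

lemma step_sim:
  assumes "cok K c0" "acfg_ok K c0 a"
  shows "acfg_ok K c0 (astep K c0 a)" "tm_step (mk_tm K c0) (cfg a) = cfg (astep K c0 a)"
proof -
  obtain q T h where a: "a = (q, T, h)" by (cases a)
  have q: "q \<in> ctls K c0" and T: "cellok K (T i)" for i using assms(2) a by (auto simp: acfg_ok_def)
  obtain q' y m where t: "trans K c0 q (T h) = (q', y, m)" by (metis prod_cases3)
  note tr = trans_ok[OF assms(1) q T t]
  show "acfg_ok K c0 (astep K c0 a)"
    using q T tr t by (cases "q = Acc \<or> q = Rej") (auto simp: acfg_ok_def astep_def a)
  have d: "dec (enc (T h)) = T h" using T by (rule dec_enc)
  show "tm_step (mk_tm K c0) (cfg a) = cfg (astep K c0 a)"
  proof (cases "q = Acc \<or> q = Rej")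
    case True
    then show ?thesis by (auto simp: a cfg_def tm_step_def astep_def)
  next
    case False
    have "(enc \<circ> T)(h := enc y) = enc \<circ> T(h := y)" by (simp add: fun_upd_comp)
    then show ?thesis using False q t d
      by (simp add: a cfg_def tm_step_def astep_def mk_tm_def qc_halt)
  qed
qed

lemma steps_sim:
  assumes "cok K c0" "acfg_ok K c0 a"
  shows "acfg_ok K c0 ((astep K c0 ^^ n) a) \<and>
    (tm_step (mk_tm K c0) ^^ n) (cfg a) = cfg ((astep K c0 ^^ n) a)"
  by (induction n) (use assms step_sim in auto)

lemma tm_init_cfg: "tm_init w = cfg (Start, (\<lambda>i. if i < 0 then raw 0 else raw (wsym w (nat i))), 0)"
  by (auto simp: tm_init_def cfg_def wsym_def fun_eq_iff)

lemma tm_run_sim: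
  assumes "cok K c0" "set w \<subseteq> {1, 2, 3}"
  shows "tm_run (mk_tm K c0) n w =
    cfg ((astep K c0 ^^ n) (Start, (\<lambda>i. if i < 0 then raw 0 else raw (wsym w (nat i))), 0))"
proof -
  have "wsym w i < 4" for i
    using subsetD[OF assms(2) nth_mem[of i w]] by (auto simp: wsym_def)
  then have "acfg_ok K c0 (Start, (\<lambda>i. if i < 0 then raw 0 else raw (wsym w (nat i))), 0)"
    by (auto simp: acfg_ok_def ctls_def cellok_def)
  then show ?thesis using steps_sim[OF assms(1)] unfolding tm_run_def tm_init_cfg by blast
qed

subsection \<open>Simulating one command step\<close>

lemma scan_right:
  assumes "\<And>i. h \<le> i \<Longrightarrow> i < h + int n \<Longrightarrow> tgt K c \<inter> snd (snd (T i)) = {}"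
  shows "(astep K c0 ^^ n) (Scan (c # k), T, h) = (Scan (c # k), T, h + int n)"
  using assms
proof (induction n)
  case (Suc n)
  obtain x z P where "T (h + int n) = (x, z, P)" by (metis prod_cases3)
  moreover from this have "tgt K c \<inter> P = {}" using Suc.prems[of "h + int n"] by auto
  ultimately show ?case using Suc by (auto simp: astep_def fun_upd_idem)
qed auto

lemma back_left:
  assumes "\<And>i. 0 < i \<Longrightarrow> i \<le> int n \<Longrightarrow> K \<notin> snd (snd (T i))" "T 0 = (x, z, P)" "K \<in> P"
  shows "(astep K c0 ^^ Suc n) (Back r k, T, int n) = (Scan k, T(0 := (x, z, insert r P)), 0)"
  using assms(1)
proof (induction n)
  case 0
  then show ?case using assms(2,3) by (auto simp: astep_def)
next
  case (Suc n)
  obtain x' z' P' where t: "T (int (Suc n)) = (x', z', P')" by (metis prod_cases3)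
  then have "K \<notin> P'" using Suc.prems[of "int (Suc n)"] by auto
  then have "astep K c0 (Back r k, T, int (Suc n)) = (Back r k, T, int n)"
    using t by (auto simp: astep_def fun_upd_idem)
  then show ?case using Suc by (simp only: funpow_Suc_right o_def) auto
qed

lemma back_atape:
  assumes "s K = 0"
  shows "(astep K c0 ^^ Suc n) (Back K k, atape K w (s, z), int n) = (Scan k, atape K w (s, z), 0)"
proof -
  have "(astep K c0 ^^ Suc n) (Back K k, atape K w (s, z), int n) =
     (Scan k, (atape K w (s, z))(0 := (wsym w 0, z 0, insert K {r. r \<le> K \<and> s r = 0})), 0)"
    by (rule back_left) (use assms in \<open>auto simp: atape_def\<close>)
  also have "(atape K w (s, z))(0 := (wsym w 0, z 0, insert K {r. r \<le> K \<and> s r = 0})) = atape K w (s, z)"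
    using assms by (intro fun_upd_idem) (auto simp: atape_def)
  finally show ?thesis .
qed

lemma tcnt_simps [simp]: "finite (tcnt t)" "tcnt t \<noteq> {}"
  by (cases t; simp)+

lemma atape_int [simp]: "atape K w (s, z) (int j) = (wsym w j, z j, {r. r \<le> K \<and> s r = j})"
  by (simp add: atape_def)

lemma tape_eqI:
  assumes "\<And>j. f (int j) = g (int j)" "\<And>i. i < 0 \<Longrightarrow> f i = g i"
  shows "f = g"
proof
  fix i :: int
  show "f i = g i" using assms(1)[of "nat i"] assms(2)[of i] by (cases "i < 0") auto
qed

lemma funpow_chain: "(f ^^ m) a = b \<Longrightarrow> (f ^^ n) b = c \<Longrightarrow> (f ^^ (n + m)) a = c"
  by (simp add: funpow_add)

text \<open>The sweep to the right stops at a target pebble, hence within \<open>B\<close> moves,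
  and the way back is as long; the constant pays for the action and the turns.\<close>

lemma cstep_sim:
  assumes "cok K c" "c \<noteq> Fail" "s K = 0" "\<And>r. s r \<le> B"
  shows "\<exists>m \<le> 2 * B + 5. (astep K c0 ^^ m) (Scan (c # k), atape K w (s, z), 0)
     = (Scan (fst (cstep w (c # k, s, z))), atape K w (snd (cstep w (c # k, s, z))), 0)"
proof -
  \<comment> \<open>The leftmost target pebble, where the sweep to the right stops.\<close>
  define p where "p = Min (s ` tgt K c)"
  have fin: "finite (tgt K c)" "tgt K c \<noteq> {}" "tgt K c \<subseteq> {..K}"
    using assms(1) by (cases c; force)+
  have "p \<in> s ` tgt K c" unfolding p_def using fin by (intro Min_in) auto
  then have ex: "\<exists>r\<in>tgt K c. s r = p" by auto
  have le: "\<forall>r\<in>tgt K c. p \<le> s r" unfolding p_def using fin by auto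
  have pB: "p \<le> B" using ex assms(4) by auto
  let ?T = "atape K w (s, z)"
  let ?P = "{r. r \<le> K \<and> s r = p}"
  have 1: "(astep K c0 ^^ p) (Scan (c # k), ?T, 0) = (Scan (c # k), ?T, int p)"
  proof -
    have "(astep K c0 ^^ p) (Scan (c # k), ?T, 0) = (Scan (c # k), ?T, 0 + int p)"
      by (rule scan_right) (use le in \<open>force simp: atape_def\<close>)
    then show ?thesis by simp
  qed
  have hit: "tgt K c \<inter> ?P \<noteq> {}" using ex fin by auto
  have cell: "?T (int p) = (wsym w p, z p, ?P)" by simp
  have 2: "astep K c0 (Scan (c # k), ?T, int p) =
      (case act K c k (wsym w p, z p, ?P) of (q', y, m) \<Rightarrow> (q', ?T(int p := y), int p + m))"
    using hit by (simp add: astep_def cell)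
  \<comment> \<open>Common pattern of all commands that leave the pebbles in place: one action at
    \<open>p\<close>, then a plain return.\<close>
  have simple: ?thesis if "nxt c (ctst w s c) k = k'" "eff c (s, z) = \<sigma>" "fst \<sigma> = s"
    "astep K c0 (Scan (c # k), ?T, int p) = (Back K k', atape K w \<sigma>, int p)" for k' \<sigma>
  proof -
    have "(astep K c0 ^^ Suc p) (Scan (c # k), ?T, 0) = (Back K k', atape K w \<sigma>, int p)"
      using 1 that(4) by simp
    moreover have "(astep K c0 ^^ Suc p) (Back K k', atape K w \<sigma>, int p) = (Scan k', atape K w \<sigma>, 0)"
      using back_atape[of s K p c0 k' w "snd \<sigma>"] assms(3) that(3) by (metis prod.collapse)
    ultimately have "(astep K c0 ^^ (Suc p + Suc p)) (Scan (c # k), ?T, 0) = (Scan k', atape K w \<sigma>, 0)"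
      by (rule funpow_chain)
    moreover have "cstep w (c # k, s, z) = (k', \<sigma>)"
      using that(1,2) assms(2) by (cases c) auto
    ultimately show ?thesis using pB by (intro exI[of _ "Suc p + Suc p"]) auto
  qed
  have upd: "?T(int p := (wsym w p, z p, ?P)) = ?T" using cell by (metis fun_upd_triv)
  show ?thesis
  proof (cases c)
    case (Inc r)
    have p: "p = s r" and r: "r < K" using Inc assms(1) by (simp_all add: p_def)
    define s' where "s' = s(r := Suc (s r))"
    define T' where "T' = ?T(int p := (wsym w p, z p, ?P - {r}))"
    have "astep K c0 (Scan (c # k), ?T, int p) = (Put r k, T', int (Suc p))"
      using 2 Inc by (simp add: T'_def add.commute)
    moreover have "astep K c0 (Put r k, T', int (Suc p)) = (Back K k, atape K w (s', z), int (Suc p))"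
    proof -
      have c: "T' (int (Suc p)) = (wsym w (Suc p), z (Suc p), {r. r \<le> K \<and> s r = Suc p})"
        unfolding T'_def by (simp del: of_nat_Suc)
      have "T'(int (Suc p) := (wsym w (Suc p), z (Suc p), insert r {r. r \<le> K \<and> s r = Suc p})) = atape K w (s', z)"
      proof (rule tape_eqI)
        fix j
        show "(T'(int (Suc p) := (wsym w (Suc p), z (Suc p), insert r {r. r \<le> K \<and> s r = Suc p}))) (int j) = atape K w (s', z) (int j)"
          unfolding T'_def s'_def fun_upd_apply of_nat_eq_iff atape_int using r p by auto
      next
        fix i :: int assume "i < 0"
        then show "(T'(int (Suc p) := (wsym w (Suc p), z (Suc p), insert r {r. r \<le> K \<and> s r = Suc p}))) i = atape K w (s', z) i"
          unfolding T'_def by (auto simp: atape_def)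
      qed
      then show ?thesis by (simp add: astep_def c del: of_nat_Suc)
    qed
    ultimately have "(astep K c0 ^^ (2 + p)) (Scan (c # k), ?T, 0) = (Back K k, atape K w (s', z), int (Suc p))"
      using 1 by (simp add: numeral_2_eq_2)
    moreover have "(astep K c0 ^^ Suc (Suc p)) (Back K k, atape K w (s', z), int (Suc p)) = (Scan k, atape K w (s', z), 0)"
      by (rule back_atape) (use assms(3) r in \<open>simp add: s'_def\<close>)
    ultimately have "(astep K c0 ^^ (Suc (Suc p) + (2 + p))) (Scan (c # k), ?T, 0) = (Scan k, atape K w (s', z), 0)"
      by (rule funpow_chain)
    then show ?thesis using Inc pB s'_def by (intro exI[of _ "Suc (Suc p) + (2 + p)"]) auto
  next
    case (Clr r)
    have p: "p = s r" and r: "r < K" using Clr assms(1) by (simp_all add: p_def)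
    define s' where "s' = s(r := 0)"
    define T' where "T' = ?T(int p := (wsym w p, z p, ?P - {r}))"
    have "astep K c0 (Scan (c # k), ?T, int p) = (Back r k, T', int p)"
      using 2 Clr by (simp add: T'_def)
    then have a: "(astep K c0 ^^ Suc p) (Scan (c # k), ?T, 0) = (Back r k, T', int p)"
      using 1 by simp
    have b: "(astep K c0 ^^ Suc p) (Back r k, T', int p) =
        (Scan k, T'(0 := (wsym w 0, z 0, insert r ({r. r \<le> K \<and> s r = 0} - {r}))), 0)"
      by (rule back_left) (use assms(3) r p in \<open>auto simp: T'_def atape_def\<close>)
    have "T'(0 := (wsym w 0, z 0, insert r ({r. r \<le> K \<and> s r = 0} - {r}))) = atape K w (s', z)"
    proof (rule tape_eqI)
      fix j
      show "(T'(0 := (wsym w 0, z 0, insert r ({r. r \<le> K \<and> s r = 0} - {r})))) (int j) = atape K w (s', z) (int j)"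
        unfolding T'_def s'_def fun_upd_apply of_nat_eq_iff of_nat_eq_0_iff atape_int using r p by auto
    qed (auto simp: T'_def atape_def)
    then have "(astep K c0 ^^ (Suc p + Suc p)) (Scan (c # k), ?T, 0) = (Scan k, atape K w (s', z), 0)"
      using funpow_chain[OF a b] by simp
    then show ?thesis using Clr pB s'_def by (intro exI[of _ "Suc p + Suc p"]) auto
  next
    case (Wr v r)
    have p: "p = s r" using Wr by (simp add: p_def)
    have "?T(int p := (wsym w p, v, ?P)) = atape K w (s, z(p := v))"
      by (rule tape_eqI) (auto simp: atape_def)
    then show ?thesis using Wr 2 p by (intro simple) auto
  next
    case (Sq c1 c2)
    then show ?thesis using 2 upd by (intro simple) auto
  next
    case (Cond t c1 c2)
    have "ttest t (wsym w p) ?P = tval w s t"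
      using le ex Cond assms(1) by (cases t) (auto simp: p_def)
    then show ?thesis using Cond 2 upd by (intro simple) auto
  next
    case (Wh t c1)
    have "ttest t (wsym w p) ?P = tval w s t"
      using le ex Wh assms(1) by (cases t) (auto simp: p_def)
    then show ?thesis using Wh 2 upd by (intro simple) auto
  qed (use assms in auto)
qed

lemma cstep_counters:
  assumes "cok K c" "s K = 0" "\<And>r. s r \<le> B"
  shows "fst (snd (cstep w (c # k, s, z))) K = 0" "fst (snd (cstep w (c # k, s, z))) r \<le> Suc B"
  using assms(1,2) assms(3)[of r] by (cases c; auto)+

lemma cstep_stacks:
  "ks \<in> stacks c0 \<Longrightarrow> fst (cstep w (ks, \<sigma>)) \<in> stacks c0"
proof (cases ks)
  case (Cons c k)
  then show "ks \<in> stacks c0 \<Longrightarrow> ?thesis" using stacks_nxt[of c k c0] by (cases c) auto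
qed simp

definition init_store :: store where "init_store = ((\<lambda>_. 0), (\<lambda>_. 0))"

text \<open>A step increases a counter by at most 1, so after \<open>n\<close> steps every sweep has
  length at most \<open>n\<close>, and the simulation costs quadratic time.\<close>

lemma csteps_sim:
  assumes "cok K c0" "(cstep w ^^ n) ([c0], init_store) = (ks, s, z)"
  shows "ks \<in> stacks c0 \<and> s K = 0 \<and> (\<forall>r. s r \<le> n) \<and>
    (\<exists>m \<le> n * (2 * n + 5). (astep K c0 ^^ m) (Scan [c0], atape K w init_store, 0) = (Scan ks, atape K w (s, z), 0))"
  using assms(2)
proof (induction n arbitrary: ks s z)
  case 0
  then show ?case by (auto simp: init_store_def)
next
  case (Suc n)
  obtain ks0 s0 z0 where 0: "(cstep w ^^ n) ([c0], init_store) = (ks0, s0, z0)" by (metis prod_cases3)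
  have IH1: "ks0 \<in> stacks c0" "s0 K = 0" "\<And>r. s0 r \<le> n" using Suc.IH[OF 0] by auto
  obtain m where m: "m \<le> n * (2 * n + 5)"
    "(astep K c0 ^^ m) (Scan [c0], atape K w init_store, 0) = (Scan ks0, atape K w (s0, z0), 0)"
    using Suc.IH[OF 0] by blast
  have st: "cstep w (ks0, s0, z0) = (ks, s, z)" using Suc.prems 0 by simp
  show ?case
  proof (cases "ks0 = [] \<or> (\<exists>k. ks0 = Fail # k)")
    case True
    then have "ks = ks0" "s = s0" "z = z0" using st by auto
    moreover have "m \<le> Suc n * (2 * Suc n + 5)" using m(1) by (rule order_trans) (intro mult_le_mono; simp)
    ultimately show ?thesis using IH1 m(2) le_SucI by blast
  next
    case False
    then obtain c k where ks0: "ks0 = c # k" "c \<noteq> Fail" by (cases ks0) auto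
    have c: "cok K c" using stacks_cok[OF assms(1)] IH1(1) ks0 by blast
    obtain m' where m': "m' \<le> 2 * n + 5"
      "(astep K c0 ^^ m') (Scan (c # k), atape K w (s0, z0), 0) = (Scan ks, atape K w (s, z), 0)"
      using cstep_sim[where s = s0 and B = n, OF c ks0(2) IH1(2,3), of c0 k w z0] st ks0 by auto
    have "(astep K c0 ^^ (m' + m)) (Scan [c0], atape K w init_store, 0) = (Scan ks, atape K w (s, z), 0)"
      using funpow_chain[OF m(2)] m'(2) ks0 by blast
    moreover have "m' + m \<le> Suc n * (2 * Suc n + 5)"
      using m(1) m'(1) by (simp add: algebra_simps)
    moreover have "ks \<in> stacks c0" using cstep_stacks[OF IH1(1), of w "(s0, z0)"] st by simp
    moreover have "s K = 0" "\<forall>r. s r \<le> Suc n"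
      using cstep_counters[where s = s0 and B = n, OF c IH1(2,3), of w k z0] st ks0 by auto
    ultimately show ?thesis by blast
  qed
qed

lemma start_step:
  "astep K c0 (Start, (\<lambda>i. if i < 0 then raw 0 else raw (wsym w (nat i))), 0)
    = (Scan [c0], atape K w init_store, 0)"
  by (auto simp: astep_def atape_def init_store_def fun_eq_iff)

lemma convert:
  assumes "\<And>i. i < l \<Longrightarrow> z i \<noteq> 0" "j \<le> l"
  shows "(astep K c0 ^^ j) (Scan [], atape K w (s, z), 0) =
    (Scan [], (\<lambda>i. if 0 \<le> i \<and> i < int j then raw (z (nat i)) else atape K w (s, z) i), int j)"
  using assms(2)
proof (induction j)
  case 0
  show ?case by (auto simp: fun_eq_iff)
next
  case (Suc j)
  then have "z j \<noteq> 0" using assms(1) by simp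
  then show ?case using Suc by (auto simp: astep_def fun_eq_iff)
qed

lemma run_accept:
  assumes "cok K c0" "set w \<subseteq> {1, 2, 3}" "(cstep w ^^ n) ([c0], init_store) = ([], s, z)"
    "\<And>i. i < l \<Longrightarrow> z i \<noteq> 0" "z l = 0" "l \<le> n"
  shows "\<exists>t \<le> 2 * n * n + 6 * n + 2. \<exists>tp h. tm_run (mk_tm K c0) t w = (1, tp, h) \<and>
    (\<forall>i<l. tp (int i) = z i) \<and> tp (int l) = 0"
proof -
  obtain m where m: "m \<le> n * (2 * n + 5)"
    "(astep K c0 ^^ m) (Scan [c0], atape K w init_store, 0) = (Scan [], atape K w (s, z), 0)"
    using csteps_sim[OF assms(1,3)] by blast
  define T where "T = (\<lambda>i. if 0 \<le> i \<and> i < int l then raw (z (nat i)) else atape K w (s, z) i)"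
  have "(astep K c0 ^^ l) (Scan [], atape K w (s, z), 0) = (Scan [], T, int l)"
    using convert[of l z l] assms(4) by (simp add: T_def)
  moreover have "astep K c0 (Scan [], T, int l) = (Acc, T(int l := raw 0), int l)"
    using assms(5) by (simp add: astep_def T_def)
  ultimately have "(astep K c0 ^^ Suc l) (Scan [], atape K w (s, z), 0) = (Acc, T(int l := raw 0), int l)"
    by simp
  then have "(astep K c0 ^^ (Suc l + m + 1)) (Start, (\<lambda>i. if i < 0 then raw 0 else raw (wsym w (nat i))), 0)
      = (Acc, T(int l := raw 0), int l)"
    by (intro funpow_chain[of 1, OF _ funpow_chain[OF m(2)]]) (simp_all add: start_step)
  then have "tm_run (mk_tm K c0) (Suc l + m + 1) w = (1, enc \<circ> T(int l := raw 0), int l)"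
    by (simp only: tm_run_sim[OF assms(1,2)]) (simp add: cfg_def)
  moreover have "Suc l + m + 1 \<le> 2 * n * n + 6 * n + 2" using m(1) assms(6) by (simp add: algebra_simps)
  ultimately show ?thesis
    by (intro exI[of _ "Suc l + m + 1"] conjI) (auto simp: T_def)
qed

lemma run_reject:
  assumes "cok K c0" "set w \<subseteq> {1, 2, 3}" "(cstep w ^^ n) ([c0], init_store) = (Fail # k, s, z)"
  shows "\<exists>t \<le> 2 * n * n + 6 * n + 2. fst (tm_run (mk_tm K c0) t w) = 2"
proof -
  have F: "s K = 0" using csteps_sim[OF assms(1,3)] by blast
  obtain m where m: "m \<le> n * (2 * n + 5)"
    "(astep K c0 ^^ m) (Scan [c0], atape K w init_store, 0) = (Scan (Fail # k), atape K w (s, z), 0)"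
    using csteps_sim[OF assms(1,3)] by blast
  obtain T where T: "(astep K c0 ^^ 1) (Scan (Fail # k), atape K w (s, z), 0) = (Rej, T, 0)"
    using F by (simp add: astep_def atape_def)
  have "(astep K c0 ^^ (1 + m + 1)) (Start, (\<lambda>i. if i < 0 then raw 0 else raw (wsym w (nat i))), 0) = (Rej, T, 0)"
    by (intro funpow_chain[of 1, OF _ funpow_chain[OF m(2) T]]) (simp add: start_step)
  then have "fst (tm_run (mk_tm K c0) (1 + m + 1) w) = 2"
    by (simp only: tm_run_sim[OF assms(1,2)]) (simp add: cfg_def)
  moreover have "1 + m + 1 \<le> 2 * n * n + 6 * n + 2" using m(1) by (simp add: algebra_simps)
  ultimately show ?thesis by blast
qed

lemma tm_run_halted:
  assumes "fst (tm_run \<delta> t w) \<in> {1, 2}" "t \<le> t'"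
  shows "tm_run \<delta> t' w = tm_run \<delta> t w"
  using assms(2)
proof (induction t' rule: dec_induct)
  case (step n)
  then show ?case using assms(1) by (auto simp: tm_run_def tm_step_def split: prod.split)
qed simp

subsection \<open>A Hoare logic with running times\<close>

text \<open>Quantifying over the remaining stack \<open>k\<close> is what lets runs be
  composed.\<close>

definition exe :: "nat list \<Rightarrow> com \<Rightarrow> store \<Rightarrow> nat \<Rightarrow> store \<Rightarrow> bool" where
  "exe w c \<sigma> n \<sigma>' \<longleftrightarrow> (\<forall>k. (cstep w ^^ n) (c # k, \<sigma>) = (k, \<sigma>'))"

definition agree :: "nat \<Rightarrow> (nat \<Rightarrow> nat) \<Rightarrow> (nat \<Rightarrow> nat) \<Rightarrow> store \<Rightarrow> bool" where
  "agree d s z \<sigma> \<longleftrightarrow> snd \<sigma> = z \<and> (\<forall>r<d. fst \<sigma> r = s r)"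

text \<open>Only the first \<open>d\<close> counters of the start state and the first \<open>d'\<close> counters of the final
  state are specified; the others are scratch.\<close>

definition tri :: "nat list \<Rightarrow> nat \<Rightarrow> (nat \<Rightarrow> nat) \<Rightarrow> (nat \<Rightarrow> nat) \<Rightarrow> com \<Rightarrow> nat \<Rightarrow> nat \<Rightarrow>
    (nat \<Rightarrow> nat) \<Rightarrow> (nat \<Rightarrow> nat) \<Rightarrow> bool" where
  "tri w d s z c B d' s' z' \<longleftrightarrow>
    (\<forall>\<sigma>. agree d s z \<sigma> \<longrightarrow> (\<exists>n\<le>B. \<exists>\<sigma>'. exe w c \<sigma> n \<sigma>' \<and> agree d' s' z' \<sigma>'))"

lemma exe_basic:
  assumes "\<And>k. cstep w (c # k, \<sigma>) = (k, \<sigma>')"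
  shows "exe w c \<sigma> 1 \<sigma>'"
  using assms by (simp add: exe_def)

lemma triI1:
  assumes "\<And>\<sigma>. agree d s z \<sigma> \<Longrightarrow> \<exists>\<sigma>'. (\<forall>k. cstep w (c # k, \<sigma>) = (k, \<sigma>')) \<and> agree d' s' z' \<sigma>'"
  shows "tri w d s z c 1 d' s' z'"
  unfolding tri_def using assms exe_basic by (metis order_refl)

lemma tri_Inc: "r < d \<Longrightarrow> tri w d s z (Inc r) 1 d (s(r := Suc (s r))) z"
  by (rule triI1) (auto simp: agree_def)

lemma tri_Clr: "tri w d s z (Clr d) 1 (Suc d) (s(d := 0)) z"
  by (rule triI1) (auto simp: agree_def)

lemma tri_Clr': "r < d \<Longrightarrow> tri w d s z (Clr r) 1 d (s(r := 0)) z"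
  by (rule triI1) (auto simp: agree_def)

lemma tri_Wr: "r < d \<Longrightarrow> tri w d s z (Wr v r) 1 d s (z(s r := v))"
  by (rule triI1) (auto simp: agree_def)

lemma exe_Sq:
  assumes "exe w c \<sigma> n \<sigma>'" "exe w c' \<sigma>' n' \<sigma>''"
  shows "exe w (Sq c c') \<sigma> (n' + n + 1) \<sigma>''"
  unfolding exe_def
proof
  fix k
  have "(cstep w ^^ 1) (Sq c c' # k, \<sigma>) = (c # c' # k, \<sigma>)" by (cases \<sigma>) simp
  then show "(cstep w ^^ (n' + n + 1)) (Sq c c' # k, \<sigma>) = (k, \<sigma>'')"
    using assms unfolding exe_def
    by (metis (no_types, lifting) funpow_chain)
qed

lemma tri_Sq:
  assumes "tri w d s z c B d1 s1 z1" "tri w d1 s1 z1 c' B' d2 s2 z2"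
  shows "tri w d s z (Sq c c') (B' + B + 1) d2 s2 z2"
  unfolding tri_def
proof (intro allI impI)
  fix \<sigma> assume "agree d s z \<sigma>"
  then obtain n \<sigma>' where 1: "n \<le> B" "exe w c \<sigma> n \<sigma>'" "agree d1 s1 z1 \<sigma>'"
    using assms(1) unfolding tri_def by blast
  then obtain n' \<sigma>'' where 2: "n' \<le> B'" "exe w c' \<sigma>' n' \<sigma>''" "agree d2 s2 z2 \<sigma>''"
    using assms(2) unfolding tri_def by blast
  show "\<exists>n\<le>B' + B + 1. \<exists>\<sigma>'. exe w (Sq c c') \<sigma> n \<sigma>' \<and> agree d2 s2 z2 \<sigma>'"
    using exe_Sq[OF 1(2) 2(2)] 1(1) 2(1,3) by (intro exI[of _ "n' + n + 1"] conjI exI[of _ \<sigma>'']) auto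
qed

lemma tval_agree:
  "tcnt t \<subseteq> {..<d} \<Longrightarrow> agree d s z \<sigma> \<Longrightarrow> tval w (fst \<sigma>) t = tval w s t"
  by (cases t) (auto simp: agree_def)

lemma tri_Cond:
  assumes "tcnt t \<subseteq> {..<d}"
    "tval w s t \<Longrightarrow> tri w d s z c B d' s' z'" "\<not> tval w s t \<Longrightarrow> tri w d s z c' B d' s' z'"
  shows "tri w d s z (Cond t c c') (B + 1) d' s' z'"
  unfolding tri_def
proof (intro allI impI)
  fix \<sigma> assume a: "agree d s z \<sigma>"
  define c1 where "c1 = (if tval w s t then c else c')"
  have "tri w d s z c1 B d' s' z'" using assms(2,3) by (simp add: c1_def)
  then obtain n \<sigma>' where 1: "n \<le> B" "exe w c1 \<sigma> n \<sigma>'" "agree d' s' z' \<sigma>'"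
    using a unfolding tri_def by blast
  have "(cstep w ^^ 1) (Cond t c c' # k, \<sigma>) = (c1 # k, \<sigma>)" for k
    using tval_agree[OF assms(1) a, of w] by (cases \<sigma>) (simp add: c1_def)
  then have "exe w (Cond t c c') \<sigma> (n + 1) \<sigma>'"
    using 1(2) unfolding exe_def by (metis funpow_chain)
  then show "\<exists>n\<le>B + 1. \<exists>\<sigma>'. exe w (Cond t c c') \<sigma> n \<sigma>' \<and> agree d' s' z' \<sigma>'"
    using 1 by (intro exI[of _ "n + 1"] conjI exI[of _ \<sigma>']) auto
qed

text \<open>\<open>S i\<close> and \<open>Z i\<close> describe the store after \<open>i\<close>
  passes. Fixing the number of passes in advance gives termination and the time bound at
  once.\<close>

lemma tri_Wh:
  assumes t: "tcnt t \<subseteq> {..<d}"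
    and "\<And>i. i < N \<Longrightarrow> tval w (S i) t" "\<not> tval w (S N) t"
    and "\<And>i. i < N \<Longrightarrow> tri w d (S i) (Z i) c B d (S (Suc i)) (Z (Suc i))"
  shows "tri w d (S 0) (Z 0) (Wh t c) (N * (B + 1) + 1) d (S N) (Z N)"
  using assms(2-)
proof (induction N arbitrary: S Z)
  case 0
  have "\<exists>\<sigma>'. (\<forall>k. cstep w (Wh t c # k, \<sigma>) = (k, \<sigma>')) \<and> agree d (S 0) (Z 0) \<sigma>'"
    if "agree d (S 0) (Z 0) \<sigma>" for \<sigma>
    using 0(2) tval_agree[OF t that, of w] that by (cases \<sigma>) (simp, blast?)
  then show ?case using triI1[of d "S 0" "Z 0" w "Wh t c" d "S 0" "Z 0"] by simp
next
  case (Suc N)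
  have IH: "tri w d (S (Suc 0)) (Z (Suc 0)) (Wh t c) (N * (B + 1) + 1) d (S (Suc N)) (Z (Suc N))"
    using Suc.IH[of "\<lambda>i. S (Suc i)" "\<lambda>i. Z (Suc i)"] Suc.prems by simp
  show ?case
    unfolding tri_def
  proof (intro allI impI)
    fix \<sigma> assume a: "agree d (S 0) (Z 0) \<sigma>"
    obtain n \<sigma>' where 1: "n \<le> B" "exe w c \<sigma> n \<sigma>'" "agree d (S (Suc 0)) (Z (Suc 0)) \<sigma>'"
      using Suc.prems(3)[of 0] a unfolding tri_def by blast
    obtain n' \<sigma>'' where 2: "n' \<le> N * (B + 1) + 1" "exe w (Wh t c) \<sigma>' n' \<sigma>''" "agree d (S (Suc N)) (Z (Suc N)) \<sigma>''"
      using IH 1(3) unfolding tri_def by blast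
    have "(cstep w ^^ 1) (Wh t c # k, \<sigma>) = (c # Wh t c # k, \<sigma>)" for k
      using Suc.prems(1)[of 0] tval_agree[OF t a, of w] by (cases \<sigma>) simp
    then have "exe w (Wh t c) \<sigma> (n' + n + 1) \<sigma>''"
      using 1(2) 2(2) unfolding exe_def by (metis (no_types, lifting) funpow_chain)
    then show "\<exists>n\<le>Suc N * (B + 1) + 1. \<exists>\<sigma>'. exe w (Wh t c) \<sigma> n \<sigma>' \<and> agree d (S (Suc N)) (Z (Suc N)) \<sigma>'"
      using 1(1) 2(1,3) by (intro exI[of _ "n' + n + 1"] conjI exI[of _ \<sigma>'']) auto
  qed
qed

lemma tri_mono:
  assumes "tri w d s z c B d1 s1 z1" "B \<le> B'" "d2 \<le> d1" "\<And>r. r < d2 \<Longrightarrow> s1 r = s2 r"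
  shows "tri w d s z c B' d2 s2 z1"
  unfolding tri_def
proof (intro allI impI)
  fix \<sigma> assume "agree d s z \<sigma>"
  then obtain n \<sigma>' where "n \<le> B" "exe w c \<sigma> n \<sigma>'" "agree d1 s1 z1 \<sigma>'"
    using assms(1) unfolding tri_def by blast
  then show "\<exists>n\<le>B'. \<exists>\<sigma>'. exe w c \<sigma> n \<sigma>' \<and> agree d2 s2 z1 \<sigma>'"
    using assms(2-4) by (intro exI[of _ n] conjI exI[of _ \<sigma>']) (auto simp: agree_def)
qed

lemma tri_run:
  assumes "tri w d (\<lambda>_. 0) (\<lambda>_. 0) c B d' s' z'"
  shows "\<exists>n\<le>B. \<exists>s. (cstep w ^^ n) (c # k, init_store) = (k, s, z') \<and> (\<forall>r<d'. s r = s' r)"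
proof -
  have "agree d (\<lambda>_. 0) (\<lambda>_. 0) init_store" by (simp add: agree_def init_store_def)
  then obtain n \<sigma>' where "n \<le> B" "exe w c init_store n \<sigma>'" "agree d' s' z' \<sigma>'"
    using assms unfolding tri_def by blast
  then show ?thesis unfolding exe_def agree_def by (metis prod.collapse)
qed

section \<open>Terms evaluated in polynomial time\<close>

text \<open>Terms denote natural numbers over an input word and a de Bruijn environment.
  \<open>TLoop n c a b\<close> iterates \<open>b\<close>, starting from \<open>a\<close>, with results truncated at \<open>c\<close>;
  in \<open>b\<close>, index 0 is the accumulator and index 1 the iteration number.\<close>

datatype trm = TVar nat | TNum nat | TLen | TSym trm | TAdd trm trm | TMul trm trm
  | TLess trm trm | TLoop trm trm trm trm

primrec eval :: "nat list \<Rightarrow> trm \<Rightarrow> nat list \<Rightarrow> nat" where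
  "eval w (TVar i) e = (if i < length e then e ! i else 0)"
| "eval w (TNum n) e = n"
| "eval w TLen e = length w"
| "eval w (TSym t) e = wsym w (eval w t e)"
| "eval w (TAdd a b) e = eval w a e + eval w b e"
| "eval w (TMul a b) e = eval w a e * eval w b e"
| "eval w (TLess a b) e = (if eval w a e < eval w b e then 1 else 0)"
| "eval w (TLoop n c a b) e =
     rec_nat (eval w a e) (\<lambda>i x. min (eval w c e) (eval w b (x # i # e))) (eval w n e)"

primrec incs :: "nat \<Rightarrow> nat \<Rightarrow> com" where
  "incs d 0 = Clr d"
| "incs d (Suc n) = Sq (incs d n) (Inc d)"

definition copy :: "nat \<Rightarrow> nat \<Rightarrow> com" where
  "copy d r = Sq (Clr d) (Wh (Lt d r) (Inc d))"

primrec compile :: "trm \<Rightarrow> nat list \<Rightarrow> nat \<Rightarrow> com" where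
  "compile (TVar i) vs d = (if i < length vs then copy d (vs ! i) else Clr d)"
| "compile (TNum n) vs d = incs d n"
| "compile TLen vs d = Sq (Clr d) (Wh (Ne d 0) (Inc d))"
| "compile (TSym t) vs d = Sq (compile t vs d) (Cond (Ne d 1) (Cond (Ne d 2) (Cond (Ne d 3) (incs d 0) (incs d 3)) (incs d 2)) (incs d 1))"
| "compile (TAdd a b) vs d = Sq (compile a vs d) (Sq (compile b vs (d + 1)) (Sq (Clr (d + 2))
     (Wh (Lt (d + 2) (d + 1)) (Sq (Inc (d + 2)) (Inc d)))))"
| "compile (TMul a b) vs d = Sq (Clr d) (Sq (compile a vs (d + 1)) (Sq (compile b vs (d + 2)) (Sq (Clr (d + 3))
     (Wh (Lt (d + 3) (d + 1)) (Sq (Sq (Clr (d + 4)) (Wh (Lt (d + 4) (d + 2)) (Sq (Inc (d + 4)) (Inc d))))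
       (Inc (d + 3)))))))"
| "compile (TLess a b) vs d = Sq (compile a vs d) (Sq (compile b vs (d + 1)) (Cond (Lt d (d + 1)) (incs d 1) (incs d 0)))"
| "compile (TLoop n c a b) vs d = Sq (compile a vs d) (Sq (compile n vs (d + 1)) (Sq (compile c vs (d + 2)) (Sq (Clr (d + 3))
     (Wh (Lt (d + 3) (d + 1)) (Sq (Sq (compile b (d # (d + 3) # vs) (d + 4))
       (Cond (Lt (d + 2) (d + 4)) (copy d (d + 2)) (copy d (d + 4)))) (Inc (d + 3)))))))"

text \<open>Whatever the body does, a loop is bounded by its start value plus its cap. This is the
  gain from truncation: the bound is a polynomial in \<open>M\<close>.\<close>

primrec valb :: "trm \<Rightarrow> nat \<Rightarrow> nat" where
  "valb (TVar i) M = M"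
| "valb (TNum n) M = n"
| "valb TLen M = M"
| "valb (TSym t) M = 3"
| "valb (TAdd a b) M = valb a M + valb b M"
| "valb (TMul a b) M = valb a M * valb b M"
| "valb (TLess a b) M = 1"
| "valb (TLoop n c a b) M = valb a M + valb c M"

primrec timb :: "trm \<Rightarrow> nat \<Rightarrow> nat" where
  "timb (TVar i) M = 2 * M + 3"
| "timb (TNum n) M = 2 * n + 1"
| "timb TLen M = 2 * M + 3"
| "timb (TSym t) M = timb t M + 12"
| "timb (TAdd a b) M = timb a M + timb b M + 4 * valb b M + 5"
| "timb (TMul a b) M = timb a M + timb b M + valb a M * (4 * valb b M + 6) + 7"
| "timb (TLess a b) M = timb a M + timb b M + 6"
| "timb (TLoop n c a b) M = timb a M + timb n M + timb c M + 6 +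
     valb n M * (timb b (M + valb n M + valb a M + valb c M) + 2 * valb c M + 8)"

definition wordb :: "nat list \<Rightarrow> bool" where
  "wordb w \<longleftrightarrow> set w \<subseteq> {1, 2, 3}"

lemma wsym_le: "wordb w \<Longrightarrow> wsym w i \<le> 3"
proof -
  assume "wordb w"
  then have "w ! i \<in> {1, 2, 3}" if "i < length w"
    using nth_mem[OF that] unfolding wordb_def by blast
  then show ?thesis by (cases "i < length w") (auto simp: wsym_def)
qed

lemma wsym_0: "wordb w \<Longrightarrow> wsym w i = 0 \<longleftrightarrow> length w \<le> i"
proof -
  assume "wordb w"
  then have "w ! i \<in> {1, 2, 3}" if "i < length w"
    using nth_mem[OF that] unfolding wordb_def by blast
  then show ?thesis by (cases "i < length w") (auto simp: wsym_def)
qed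

lemma rec_min_le: "rec_nat a (\<lambda>i x. min c (f i x)) n \<le> a + (c::nat)"
  by (cases n) auto

lemma eval_valb:
  "wordb w \<Longrightarrow> length w \<le> M \<Longrightarrow> \<forall>x\<in>set e. x \<le> M \<Longrightarrow> eval w t e \<le> valb t M"
proof (induction t arbitrary: e)
  case (TLoop n c a b)
  have "eval w (TLoop n c a b) e \<le> eval w a e + eval w c e" using rec_min_le by simp
  then show ?case using TLoop.IH(2,3)[OF TLoop.prems] by simp
qed (auto simp: wsym_le intro: add_mono mult_le_mono)

lemma tri_incs: "tri w d s z (incs d n) (2 * n + 1) (Suc d) (s(d := n)) z"
proof (induction n)
  case 0
  show ?case unfolding incs.simps by (rule tri_mono[OF tri_Clr]) auto
next
  case (Suc n)
  have "tri w (Suc d) (s(d := n)) z (Inc d) 1 (Suc d) ((s(d := n))(d := Suc ((s(d := n)) d))) z"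
    by (rule tri_Inc) simp
  from tri_Sq[OF Suc this] show ?case unfolding incs.simps by (rule tri_mono) auto
qed

lemma tri_incs': 
  assumes "r < d" shows "tri w d s z (incs r n) (2 * n + 1) d (s(r := n)) z"
proof (induction n)
  case 0
  show ?case unfolding incs.simps by (rule tri_mono[OF tri_Clr'[OF assms]]) auto
next
  case (Suc n)
  have "tri w d (s(r := n)) z (Inc r) 1 d ((s(r := n))(r := Suc ((s(r := n)) r))) z"
    by (rule tri_Inc) (rule assms)
  from tri_Sq[OF Suc this] show ?case unfolding incs.simps by (rule tri_mono) auto
qed

lemma tri_copy_loop:
  assumes "r < d" "q < d" "q \<noteq> r" "s q = 0"
  shows "tri w d s z (Wh (Lt q r) (Inc q)) (s r * 2 + 1) d (s(q := s r)) z"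
proof -
  have "tri w d ((\<lambda>i. s(q := i)) 0) ((\<lambda>_. z) 0) (Wh (Lt q r) (Inc q)) (s r * (1 + 1) + 1) d
      ((\<lambda>i. s(q := i)) (s r)) ((\<lambda>_. z) (s r))"
  proof (rule tri_Wh)
    fix i
    have "tri w d (s(q := i)) z (Inc q) 1 d ((s(q := i))(q := Suc ((s(q := i)) q))) z"
      by (rule tri_Inc) (rule assms)
    then show "tri w d (s(q := i)) z (Inc q) 1 d (s(q := Suc i)) z" by simp
  qed (use assms in auto)
  moreover have "s(q := 0) = s" using assms by (simp add: fun_upd_idem)
  ultimately show ?thesis by (auto intro: tri_mono)
qed

lemma tri_copy:
  assumes "r < d"
  shows "tri w d s z (copy d r) (2 * s r + 3) (Suc d) (s(d := s r)) z"
proof -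
  have "tri w (Suc d) (s(d := 0)) z (Wh (Lt d r) (Inc d)) ((s(d := 0)) r * 2 + 1) (Suc d)
      ((s(d := 0))(d := (s(d := 0)) r)) z"
    by (rule tri_copy_loop) (use assms in auto)
  from tri_Sq[OF tri_Clr this] show ?thesis unfolding copy_def
    by (rule tri_mono) (use assms in auto)
qed

lemma tri_copy':
  assumes "r < d" "q < d" "q \<noteq> r"
  shows "tri w d s z (copy q r) (2 * s r + 3) d (s(q := s r)) z"
proof -
  have "tri w d (s(q := 0)) z (Wh (Lt q r) (Inc q)) ((s(q := 0)) r * 2 + 1) d
      ((s(q := 0))(q := (s(q := 0)) r)) z"
    by (rule tri_copy_loop) (use assms in auto)
  from tri_Sq[OF tri_Clr'[OF assms(2)] this] show ?thesis unfolding copy_def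
    by (rule tri_mono) (use assms in auto)
qed

lemma tri_add_loop:
  assumes "p < d" "q < d" "r < d" "p \<noteq> q" "p \<noteq> r" "q \<noteq> r" "s q = 0"
  shows "tri w d s z (Wh (Lt q r) (Sq (Inc q) (Inc p))) (s r * 4 + 1) d (s(q := s r, p := s p + s r)) z"
proof -
  have "tri w d ((\<lambda>i. s(q := i, p := s p + i)) 0) ((\<lambda>_. z) 0) (Wh (Lt q r) (Sq (Inc q) (Inc p))) (s r * ((1 + 1 + 1) + 1) + 1) d
      ((\<lambda>i. s(q := i, p := s p + i)) (s r)) ((\<lambda>_. z) (s r))"
  proof (rule tri_Wh)
    fix i
    let ?s = "s(q := i, p := s p + i)"
    have "tri w d ?s z (Inc q) 1 d (?s(q := Suc (?s q))) z"
      by (rule tri_Inc) (rule assms)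
    moreover have "tri w d (?s(q := Suc (?s q))) z (Inc p) 1 d ((?s(q := Suc (?s q)))(p := Suc ((?s(q := Suc (?s q))) p))) z"
      by (rule tri_Inc) (rule assms)
    moreover have "(?s(q := Suc (?s q)))(p := Suc ((?s(q := Suc (?s q))) p)) = s(q := Suc i, p := s p + Suc i)"
      using assms by (auto simp: fun_eq_iff)
    ultimately show "tri w d ?s z (Sq (Inc q) (Inc p)) (1 + 1 + 1) d (s(q := Suc i, p := s p + Suc i)) z"
      using tri_Sq by metis
  qed (use assms in auto)
  moreover have "s(q := 0, p := s p + 0) = s" using assms by (auto simp: fun_eq_iff)
  ultimately show ?thesis by (auto intro: tri_mono)
qed

lemma vs_env: "\<forall>v\<in>set vs. v < (d::nat) \<Longrightarrow> d \<le> r \<Longrightarrow> map (s(r := x)) vs = map s vs"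
  by (intro map_cong) fastforce+

lemma tri_compile:
  assumes "wordb w" "length w \<le> M" "\<forall>v\<in>set vs. v < d" "\<forall>v\<in>set vs. s v \<le> M"
  shows "tri w d s z (compile t vs d) (timb t M) (Suc d) (s(d := eval w t (map s vs))) z"
  using assms
proof (induction t arbitrary: vs d s M)
  case (TVar i)
  show ?case
  proof (cases "i < length vs")
    case True
    then have v: "vs ! i \<in> set vs" by simp
    then have "tri w d s z (copy d (vs ! i)) (2 * s (vs ! i) + 3) (Suc d) (s(d := s (vs ! i))) z"
      using TVar by (intro tri_copy) auto
    then show ?thesis using True TVar v by (auto intro: tri_mono)
  next
    case False
    have "tri w d s z (Clr d) 1 (Suc d) (s(d := 0)) z" by (rule tri_Clr)
    then show ?thesis using False by (auto intro: tri_mono)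
  qed
next
  case (TNum n)
  show ?case unfolding compile.simps eval.simps timb.simps by (rule tri_incs)
next
  case TLen
  have "tri w (Suc d) ((\<lambda>i. s(d := i)) 0) ((\<lambda>_. z) 0) (Wh (Ne d 0) (Inc d)) (length w * (1 + 1) + 1) (Suc d)
      ((\<lambda>i. s(d := i)) (length w)) ((\<lambda>_. z) (length w))"
  proof (rule tri_Wh)
    fix i
    have "tri w (Suc d) (s(d := i)) z (Inc d) 1 (Suc d) ((s(d := i))(d := Suc ((s(d := i)) d))) z"
      by (rule tri_Inc) simp
    then show "tri w (Suc d) (s(d := i)) z (Inc d) 1 (Suc d) (s(d := Suc i)) z" by simp
  qed (use TLen wsym_0[OF TLen(1)] in auto)
  from tri_Sq[OF tri_Clr this] show ?case
    unfolding compile.simps by (rule tri_mono) (use TLen in auto)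
next
  case (TSym t)
  let ?v = "eval w t (map s vs)"
  let ?s = "s(d := ?v)"
  have 1: "tri w d s z (compile t vs d) (timb t M) (Suc d) ?s z" using TSym by blast
  have 2: "tri w (Suc d) ?s z (incs d n) (2 * n + 1) (Suc d) (?s(d := n)) z" for n
    by (rule tri_incs') simp
  have 3: "tri w (Suc d) ?s z (incs d n) B (Suc d) (s(d := wsym w ?v)) z" if "7 \<le> B" "n \<le> 3" "wsym w ?v = n" for n B
    using 2 by (rule tri_mono) (use that in auto)
  have "tri w (Suc d) ?s z (Cond (Ne d 1) (Cond (Ne d 2) (Cond (Ne d 3) (incs d 0) (incs d 3)) (incs d 2)) (incs d 1))
      (((7 + 1) + 1) + 1) (Suc d) (s(d := wsym w ?v)) z"
  proof (rule tri_Cond, simp, rule tri_Cond, simp, rule tri_Cond, simp)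
    assume "tval w ?s (Ne d 1)" "tval w ?s (Ne d 2)" "tval w ?s (Ne d 3)"
    then have "wsym w ?v = 0" using wsym_le[OF TSym.prems(1), of ?v] by auto
    then show "tri w (Suc d) ?s z (incs d 0) 7 (Suc d) (s(d := wsym w ?v)) z" by (intro 3) auto
  qed (intro 3; simp)+
  from tri_Sq[OF 1 this] show ?case unfolding compile.simps by (rule tri_mono) auto
next
  case (TAdd a b)
  let ?e = "map s vs"
  let ?s1 = "s(d := eval w a ?e)"
  let ?s2 = "?s1(Suc d := eval w b ?e)"
  have 1: "tri w d s z (compile a vs d) (timb a M) (Suc d) ?s1 z" using TAdd by blast
  have "tri w (Suc d) ?s1 z (compile b vs (Suc d)) (timb b M) (Suc (Suc d)) (?s1(Suc d := eval w b (map ?s1 vs))) z"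
    by (rule TAdd.IH(2)) (use TAdd.prems in auto)
  then have 2: "tri w (Suc d) ?s1 z (compile b vs (Suc d)) (timb b M) (Suc (Suc d)) ?s2 z"
    using TAdd.prems vs_env[of vs d d s] by simp
  have 3: "tri w (Suc (Suc d)) ?s2 z (Clr (Suc (Suc d))) 1 (Suc (Suc (Suc d))) (?s2(Suc (Suc d) := 0)) z" by (rule tri_Clr)
  let ?s3 = "?s2(Suc (Suc d) := 0)"
  have 4: "tri w (Suc (Suc (Suc d))) ?s3 z (Wh (Lt (Suc (Suc d)) (Suc d)) (Sq (Inc (Suc (Suc d))) (Inc d))) (?s3 (Suc d) * 4 + 1)
     (Suc (Suc (Suc d))) (?s3(Suc (Suc d) := ?s3 (Suc d), d := ?s3 d + ?s3 (Suc d))) z"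
    by (rule tri_add_loop) auto
  have "eval w b ?e \<le> valb b M" using TAdd.prems by (intro eval_valb) auto
  note vb = this
  from tri_Sq[OF 1 tri_Sq[OF 2 tri_Sq[OF 3 4]]] show ?case
    unfolding compile.simps Suc_eq_plus1[symmetric] add_2_eq_Suc' by (rule tri_mono) (use vb in auto)
next
  case (TMul a b)
  let ?e = "map s vs"
  define va where "va = eval w a ?e"
  define vb where "vb = eval w b ?e"
  define S where "S = (\<lambda>i j x. s(d := x, Suc d := va, d + 2 := vb, d + 3 := i, d + 4 := j))"
  have vav: "va \<le> valb a M" "vb \<le> valb b M"
    unfolding va_def vb_def using TMul.prems by (auto intro!: eval_valb)
  have 0: "tri w d s z (Clr d) 1 (Suc d) (s(d := 0)) z" by (rule tri_Clr)
  have "tri w (Suc d) (s(d := 0)) z (compile a vs (Suc d)) (timb a M) (Suc (Suc d)) ((s(d := 0))(Suc d := eval w a (map (s(d := 0)) vs))) z"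
    by (rule TMul.IH(1)) (use TMul.prems in auto)
  then have 1: "tri w (Suc d) (s(d := 0)) z (compile a vs (Suc d)) (timb a M) (Suc (Suc d)) ((s(d := 0))(Suc d := va)) z"
    using TMul.prems vs_env[of vs d d s] by (simp add: va_def)
  have m: "map ((s(d := 0))(Suc d := va)) vs = ?e"
    unfolding vs_env[OF TMul.prems(3) le_SucI[OF order_refl]] by (rule vs_env[OF TMul.prems(3) order_refl])
  have "tri w (d + 2) ((s(d := 0))(Suc d := va)) z (compile b vs (d + 2)) (timb b M) (Suc (d + 2))
      ((s(d := 0))(Suc d := va, d + 2 := eval w b (map ((s(d := 0))(Suc d := va)) vs))) z"
    by (rule TMul.IH(2)) (use TMul.prems in auto)
  then have 2: "tri w (Suc (Suc d)) ((s(d := 0))(Suc d := va)) z (compile b vs (d + 2)) (timb b M) (d + 3)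
      ((s(d := 0))(Suc d := va, d + 2 := vb)) z"
    unfolding m vb_def by (simp add: numeral_3_eq_3)
  have 3: "tri w (d + 3) ((s(d := 0))(Suc d := va, d + 2 := vb)) z (Clr (d + 3)) 1 (Suc (d + 3)) (((s(d := 0))(Suc d := va, d + 2 := vb))(d + 3 := 0)) z"
    by (rule tri_Clr)
  have 3: "tri w (d + 3) ((s(d := 0))(Suc d := va, d + 2 := vb)) z (Clr (d + 3)) 1 (d + 4) (S 0 0 0) z"
    by (rule tri_mono[OF 3]) (auto simp: S_def)
  have 4: "tri w (d + 4) ((\<lambda>i. S i 0 (i * vb)) 0) ((\<lambda>_. z) 0)
      (Wh (Lt (d + 3) (d + 1)) (Sq (Sq (Clr (d + 4)) (Wh (Lt (d + 4) (d + 2)) (Sq (Inc (d + 4)) (Inc d)))) (Inc (d + 3))))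
      (va * ((4 * vb + 5) + 1) + 1) (d + 4) ((\<lambda>i. S i 0 (i * vb)) va) ((\<lambda>_. z) va)"
  proof (rule tri_Wh)
    fix i
    have "tri w (d + 4) (S i 0 (i * vb)) z (Clr (d + 4)) 1 (Suc (d + 4)) ((S i 0 (i * vb))(d + 4 := 0)) z"
      by (rule tri_Clr)
    then have a: "tri w (d + 4) (S i 0 (i * vb)) z (Clr (d + 4)) 1 (d + 5) (S i 0 (i * vb)) z"
      by (rule tri_mono) (auto simp: S_def)
    let ?s = "S i 0 (i * vb)"
    have b: "tri w (d + 5) ?s z (Wh (Lt (d + 4) (d + 2)) (Sq (Inc (d + 4)) (Inc d))) (?s (d + 2) * 4 + 1)
       (d + 5) (?s(d + 4 := ?s (d + 2), d := ?s d + ?s (d + 2))) z"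
      by (rule tri_add_loop) (auto simp: S_def)
    let ?s' = "?s(d + 4 := ?s (d + 2), d := ?s d + ?s (d + 2))"
    have c: "tri w (d + 5) ?s' z (Inc (d + 3)) 1 (d + 5) (?s'(d + 3 := Suc (?s' (d + 3)))) z"
      by (rule tri_Inc) simp
    from tri_Sq[OF tri_Sq[OF a b] c]
    show "tri w (d + 4) (S i 0 (i * vb)) z (Sq (Sq (Clr (d + 4)) (Wh (Lt (d + 4) (d + 2)) (Sq (Inc (d + 4)) (Inc d)))) (Inc (d + 3)))
       (4 * vb + 5) (d + 4) (S (Suc i) 0 (Suc i * vb)) z"
      by (rule tri_mono) (auto simp: S_def)
  qed (auto simp: S_def)
  have le: "va * ((4 * vb + 5) + 1) + 1 \<le> valb a M * (4 * valb b M + 6) + 1"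
    using vav by (intro add_le_mono1 mult_le_mono) auto
  from 4 have 4: "tri w (d + 4) (S 0 0 0) z
      (Wh (Lt (d + 3) (d + 1)) (Sq (Sq (Clr (d + 4)) (Wh (Lt (d + 4) (d + 2)) (Sq (Inc (d + 4)) (Inc d)))) (Inc (d + 3))))
      (valb a M * (4 * valb b M + 6) + 1) (d + 4) (S va 0 (va * vb)) z"
    unfolding mult_0 by (rule tri_mono[OF _ le]) auto
  from 2 have 2: "tri w (Suc (Suc d)) ((s(d := 0))(Suc d := va)) z (compile b vs (Suc (Suc d))) (timb b M) (d + 3)
      ((s(d := 0))(Suc d := va, d + 2 := vb)) z" by simp
  from tri_Sq[OF 0 tri_Sq[OF 1 tri_Sq[OF 2 tri_Sq[OF 3 4]]]] show ?case
    unfolding compile.simps Suc_eq_plus1[symmetric] add_2_eq_Suc'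
    by (rule tri_mono) (auto simp: S_def va_def vb_def)
next
  case (TLess a b)
  let ?e = "map s vs"
  let ?s1 = "s(d := eval w a ?e)"
  let ?s2 = "?s1(Suc d := eval w b ?e)"
  have 1: "tri w d s z (compile a vs d) (timb a M) (Suc d) ?s1 z" using TLess by blast
  have "tri w (Suc d) ?s1 z (compile b vs (Suc d)) (timb b M) (Suc (Suc d)) (?s1(Suc d := eval w b (map ?s1 vs))) z"
    by (rule TLess.IH(2)) (use TLess.prems in auto)
  then have 2: "tri w (Suc d) ?s1 z (compile b vs (Suc d)) (timb b M) (Suc (Suc d)) ?s2 z"
    using TLess.prems vs_env[of vs d d s] by simp
  have i: "tri w (Suc (Suc d)) ?s2 z (incs d n) (2 * n + 1) (Suc (Suc d)) (?s2(d := n)) z" for n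
    by (rule tri_incs') simp
  have "tri w (Suc (Suc d)) ?s2 z (Cond (Lt d (Suc d)) (incs d 1) (incs d 0)) (3 + 1) (Suc (Suc d))
     (?s2(d := eval w (TLess a b) ?e)) z"
  proof (rule tri_Cond)
    assume "tval w ?s2 (Lt d (Suc d))"
    then show "tri w (Suc (Suc d)) ?s2 z (incs d 1) 3 (Suc (Suc d)) (?s2(d := eval w (TLess a b) ?e)) z"
      by (intro tri_mono[OF i]) auto
  next
    assume "\<not> tval w ?s2 (Lt d (Suc d))"
    then show "tri w (Suc (Suc d)) ?s2 z (incs d 0) 3 (Suc (Suc d)) (?s2(d := eval w (TLess a b) ?e)) z"
      by (intro tri_mono[OF i]) auto
  qed auto
  from tri_Sq[OF 1 tri_Sq[OF 2 this]] show ?case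
    unfolding compile.simps Suc_eq_plus1[symmetric] by (rule tri_mono) auto
next
  case (TLoop n c a b)
  let ?e = "map s vs"
  define va where "va = eval w a ?e"
  define vn where "vn = eval w n ?e"
  define vc where "vc = eval w c ?e"
  define X where "X = rec_nat va (\<lambda>i x. min vc (eval w b (x # i # ?e)))"
  define S where "S = (\<lambda>i x. s(d := x, Suc d := vn, d + 2 := vc, d + 3 := i))"
  have vav: "va \<le> valb a M" "vn \<le> valb n M" "vc \<le> valb c M"
    unfolding va_def vn_def vc_def using TLoop.prems by (auto intro!: eval_valb)
  have X: "X i \<le> va + vc" for i unfolding X_def by (rule rec_min_le)
  have 1: "tri w d s z (compile a vs d) (timb a M) (Suc d) (s(d := va)) z"
    unfolding va_def using TLoop by blast
  have "tri w (Suc d) (s(d := va)) z (compile n vs (Suc d)) (timb n M) (Suc (Suc d)) ((s(d := va))(Suc d := eval w n (map (s(d := va)) vs))) z"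
    by (rule TLoop.IH(1)) (use TLoop.prems in auto)
  then have 2: "tri w (Suc d) (s(d := va)) z (compile n vs (Suc d)) (timb n M) (d + 2) ((s(d := va))(Suc d := vn)) z"
    using TLoop.prems vs_env[of vs d d s] by (simp add: vn_def)
  have m: "map ((s(d := va))(Suc d := vn)) vs = ?e"
    unfolding vs_env[OF TLoop.prems(3) le_SucI[OF order_refl]] by (rule vs_env[OF TLoop.prems(3) order_refl])
  have "tri w (d + 2) ((s(d := va))(Suc d := vn)) z (compile c vs (d + 2)) (timb c M) (Suc (d + 2))
      ((s(d := va))(Suc d := vn, d + 2 := eval w c (map ((s(d := va))(Suc d := vn)) vs))) z"
    by (rule TLoop.IH(2)) (use TLoop.prems in auto)
  then have 3: "tri w (d + 2) ((s(d := va))(Suc d := vn)) z (compile c vs (d + 2)) (timb c M) (d + 3)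
      ((s(d := va))(Suc d := vn, d + 2 := vc)) z"
    unfolding m vc_def by (simp add: numeral_3_eq_3)
  have 4: "tri w (d + 3) ((s(d := va))(Suc d := vn, d + 2 := vc)) z (Clr (d + 3)) 1 (Suc (d + 3)) (((s(d := va))(Suc d := vn, d + 2 := vc))(d + 3 := 0)) z"
    by (rule tri_Clr)
  have 4: "tri w (d + 3) ((s(d := va))(Suc d := vn, d + 2 := vc)) z (Clr (d + 3)) 1 (d + 4) (S 0 va) z"
    by (rule tri_mono[OF 4]) (auto simp: S_def)
  \<comment> \<open>The body sees two further variables, the iteration number and the accumulator,
    so the bound on its environment grows by bounds for both.\<close>
  let ?M = "M + valb n M + valb a M + valb c M"
  have 5: "tri w (d + 4) ((\<lambda>i. S i (X i)) 0) ((\<lambda>_. z) 0)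
      (Wh (Lt (d + 3) (d + 1)) (Sq (Sq (compile b (d # (d + 3) # vs) (d + 4))
       (Cond (Lt (d + 2) (d + 4)) (copy d (d + 2)) (copy d (d + 4)))) (Inc (d + 3))))
      (vn * ((timb b ?M + 2 * valb c M + 7) + 1) + 1) (d + 4) ((\<lambda>i. S i (X i)) vn) ((\<lambda>_. z) vn)"
  proof (rule tri_Wh)
    fix i assume i: "i < vn"
    let ?s = "S i (X i)"
    define vb where "vb = eval w b (X i # i # ?e)"
    have m: "map ?s (d # (d + 3) # vs) = X i # i # ?e"
      using TLoop.prems by (auto simp: S_def)
    have "tri w (d + 4) ?s z (compile b (d # (d + 3) # vs) (d + 4)) (timb b ?M) (Suc (d + 4)) (?s(d + 4 := eval w b (map ?s (d # (d + 3) # vs)))) z"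
    proof (rule TLoop.IH(4))
      show "\<forall>v\<in>set (d # (d + 3) # vs). S i (X i) v \<le> ?M"
        using TLoop.prems vav X[of i] i by (fastforce simp: S_def)
    qed (use TLoop.prems in auto)
    then have a: "tri w (d + 4) ?s z (compile b (d # (d + 3) # vs) (d + 4)) (timb b ?M) (d + 5) (?s(d + 4 := vb)) z"
      unfolding m vb_def by (simp add: numeral_eq_Suc)
    let ?s' = "?s(d + 4 := vb)"
    have cp: "tri w (d + 5) ?s' z (copy d r) (2 * ?s' r + 3) (d + 5) (?s'(d := ?s' r)) z" if "r < d + 5" "r \<noteq> d" for r
      by (rule tri_copy') (use that in auto)
    have b: "tri w (d + 5) ?s' z (Cond (Lt (d + 2) (d + 4)) (copy d (d + 2)) (copy d (d + 4))) ((2 * vc + 3) + 1) (d + 5) (?s'(d := X (Suc i))) z"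
    proof (rule tri_Cond)
      assume "tval w ?s' (Lt (d + 2) (d + 4))"
      then have "vc < vb" by (simp add: S_def)
      then have "X (Suc i) = vc" by (simp add: X_def vb_def)
      then show "tri w (d + 5) ?s' z (copy d (d + 2)) (2 * vc + 3) (d + 5) (?s'(d := X (Suc i))) z"
        by (intro tri_mono[OF cp]) (auto simp: S_def)
    next
      assume "\<not> tval w ?s' (Lt (d + 2) (d + 4))"
      then have v: "vb \<le> vc" by (simp add: S_def)
      then have "X (Suc i) = vb" by (simp add: X_def vb_def)
      then show "tri w (d + 5) ?s' z (copy d (d + 4)) (2 * vc + 3) (d + 5) (?s'(d := X (Suc i))) z"
        using v by (intro tri_mono[OF cp]) (auto simp: S_def)
    qed auto
    let ?s'' = "?s'(d := X (Suc i))"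
    have c: "tri w (d + 5) ?s'' z (Inc (d + 3)) 1 (d + 5) (?s''(d + 3 := Suc (?s'' (d + 3)))) z"
      by (rule tri_Inc) simp
    from tri_Sq[OF tri_Sq[OF a b] c]
    show "tri w (d + 4) (S i (X i)) z (Sq (Sq (compile b (d # (d + 3) # vs) (d + 4))
       (Cond (Lt (d + 2) (d + 4)) (copy d (d + 2)) (copy d (d + 4)))) (Inc (d + 3)))
       (timb b ?M + 2 * valb c M + 7) (d + 4) (S (Suc i) (X (Suc i))) z"
      by (rule tri_mono) (use vav in \<open>auto simp: S_def\<close>)
  qed (auto simp: S_def)
  have S0: "S 0 (X 0) = S 0 va" by (simp add: X_def)
  have le: "vn * ((timb b ?M + 2 * valb c M + 7) + 1) + 1 \<le> valb n M * (timb b ?M + 2 * valb c M + 8) + 1"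
    using vav by (intro add_le_mono1 mult_le_mono) auto
  have ev: "X vn = eval w (TLoop n c a b) ?e" by (simp add: X_def va_def vn_def vc_def)
  from 5 have 5: "tri w (d + 4) (S 0 va) z
      (Wh (Lt (d + 3) (d + 1)) (Sq (Sq (compile b (d # (d + 3) # vs) (d + 4))
       (Cond (Lt (d + 2) (d + 4)) (copy d (d + 2)) (copy d (d + 4)))) (Inc (d + 3))))
      (valb n M * (timb b ?M + 2 * valb c M + 8) + 1) (d + 4) (S vn (X vn)) z"
    unfolding S0 by (rule tri_mono[OF _ le]) auto
  have "tri w d s z (compile (TLoop n c a b) vs d) (timb (TLoop n c a b) M) (Suc d) (s(d := X vn)) z"
    using tri_Sq[OF 1 tri_Sq[OF 2 tri_Sq[OF 3 tri_Sq[OF 4 5]]]]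
    unfolding compile.simps Suc_eq_plus1[symmetric]
    by (rule tri_mono) (auto simp: S_def)
  then show ?case unfolding ev .
qed

section \<open>Programs emitting an output word\<close>

datatype cmd = Emit bool | CSeq cmd cmd | CFor trm cmd | CIf trm cmd cmd

primrec out :: "nat list \<Rightarrow> cmd \<Rightarrow> nat list \<Rightarrow> bool list" where
  "out w (Emit b) e = [b]"
| "out w (CSeq c c') e = out w c e @ out w c' e"
| "out w (CFor t c) e = concat (map (\<lambda>i. out w c (i # e)) [0..<eval w t e])"
| "out w (CIf t c c') e = (if 0 < eval w t e then out w c e else out w c' e)"

text \<open>Counter 0 is reserved for the length of the output written so far; variables live in
  positive counters.\<close>

primrec compile_cmd :: "cmd \<Rightarrow> nat list \<Rightarrow> nat \<Rightarrow> com" where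
  "compile_cmd (Emit b) vs d = Sq (Wr (sym b) 0) (Inc 0)"
| "compile_cmd (CSeq c c') vs d = Sq (compile_cmd c vs d) (compile_cmd c' vs d)"
| "compile_cmd (CFor t c) vs d = Sq (compile t vs d) (Sq (Clr (d + 1))
     (Wh (Lt (d + 1) d) (Sq (compile_cmd c ((d + 1) # vs) (d + 2)) (Inc (d + 1)))))"
| "compile_cmd (CIf t c c') vs d = Sq (compile t vs d) (Sq (Clr (d + 1))
     (Cond (Lt (d + 1) d) (compile_cmd c vs (d + 2)) (compile_cmd c' vs (d + 2))))"

primrec ctime :: "cmd \<Rightarrow> nat \<Rightarrow> nat" where
  "ctime (Emit b) M = 3"
| "ctime (CSeq c c') M = ctime c M + ctime c' M + 1"
| "ctime (CFor t c) M = timb t M + 4 + valb t M * (ctime c (M + valb t M) + 3)"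
| "ctime (CIf t c c') M = timb t M + ctime c M + ctime c' M + 4"

definition olist :: "bool list \<Rightarrow> nat \<Rightarrow> nat" where
  "olist l i = (if i < length l then sym (l ! i) else 0)"

lemma olist_snoc: "(olist l)(length l := sym b) = olist (l @ [b])"
  by (auto simp: olist_def fun_eq_iff nth_append)

lemma olist_Nil: "olist [] = (\<lambda>_. 0)"
  by (auto simp: olist_def)

lemma tri_compile_cmd:
  assumes "wordb w" "length w \<le> M" "\<forall>v\<in>set vs. 0 < v \<and> v < d" "\<forall>v\<in>set vs. s v \<le> M"
    "0 < d" "s 0 = length l"
  shows "tri w d s (olist l) (compile_cmd c vs d) (ctime c M) d
    (s(0 := length (l @ out w c (map s vs)))) (olist (l @ out w c (map s vs)))"
  using assms
proof (induction c arbitrary: vs d s M l)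
  case (Emit b)
  have 1: "tri w d s (olist l) (Wr (sym b) 0) 1 d s ((olist l)(s 0 := sym b))"
    by (rule tri_Wr) (use Emit in simp)
  have 2: "tri w d s ((olist l)(s 0 := sym b)) (Inc 0) 1 d (s(0 := Suc (s 0))) ((olist l)(s 0 := sym b))"
    by (rule tri_Inc) (use Emit in simp)
  have e: "(olist l)(s 0 := sym b) = olist (l @ [b])"
    using Emit.prems olist_snoc by simp
  from tri_Sq[OF 1 2] show ?case unfolding compile_cmd.simps out.simps ctime.simps e
    by (rule tri_mono) (use Emit.prems in simp_all)
next
  case (CSeq c c')
  let ?l = "l @ out w c (map s vs)"
  let ?s = "s(0 := length ?l)"
  have m: "map s vs = map ?s vs" using CSeq.prems by auto
  have "tri w d ?s (olist ?l) (compile_cmd c' vs d) (ctime c' M) d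
    (?s(0 := length (?l @ out w c' (map ?s vs)))) (olist (?l @ out w c' (map ?s vs)))"
    by (rule CSeq.IH(2)) (use CSeq.prems in auto)
  then have 2: "tri w d ?s (olist ?l) (compile_cmd c' vs d) (ctime c' M) d
    (?s(0 := length (?l @ out w c' (map s vs)))) (olist (?l @ out w c' (map s vs)))" unfolding m[symmetric] .
  from tri_Sq[OF CSeq.IH(1)[OF CSeq.prems] 2] show ?case
    unfolding compile_cmd.simps out.simps append_assoc by (rule tri_mono) auto
next
  case (CFor t c)
  define N where "N = eval w t (map s vs)"
  define L where "L = (\<lambda>i. l @ concat (map (\<lambda>i. out w c (i # map s vs)) [0..<i]))"
  define S where "S = (\<lambda>i. s(0 := length (L i), d := N, Suc d := i))"
  have N: "N \<le> valb t M" unfolding N_def using CFor.prems by (intro eval_valb) auto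
  have 1: "tri w d s (olist l) (compile t vs d) (timb t M) (Suc d) (s(d := N)) (olist l)"
    unfolding N_def by (rule tri_compile) (use CFor.prems in auto)
  have 2: "tri w (Suc d) (s(d := N)) (olist l) (Clr (Suc d)) 1 (d + 2) (S 0) (olist l)"
    by (rule tri_mono[OF tri_Clr]) (use CFor.prems in \<open>auto simp: S_def L_def\<close>)
  have 3: "tri w (d + 2) (S 0) (olist (L 0)) (Wh (Lt (Suc d) d) (Sq (compile_cmd c (Suc d # vs) (d + 2)) (Inc (Suc d))))
     (N * ((ctime c (M + valb t M) + 2) + 1) + 1) (d + 2) (S N) (olist (L N))"
  proof (rule tri_Wh[where Z = "\<lambda>i. olist (L i)"])
    fix i assume i: "i < N"
    have m: "map (S i) (Suc d # vs) = i # map s vs" using CFor.prems by (auto simp: S_def)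
    have l: "L i @ out w c (map (S i) (Suc d # vs)) = L (Suc i)"
      unfolding m by (simp add: L_def)
    have "tri w (d + 2) (S i) (olist (L i)) (compile_cmd c (Suc d # vs) (d + 2)) (ctime c (M + valb t M)) (d + 2)
      ((S i)(0 := length (L i @ out w c (map (S i) (Suc d # vs))))) (olist (L i @ out w c (map (S i) (Suc d # vs))))"
    proof (rule CFor.IH)
      show "\<forall>v\<in>set (Suc d # vs). S i v \<le> M + valb t M"
        using CFor.prems N i by (fastforce simp: S_def)
    qed (use CFor.prems in \<open>auto simp: S_def\<close>)
    then have a: "tri w (d + 2) (S i) (olist (L i)) (compile_cmd c (Suc d # vs) (d + 2)) (ctime c (M + valb t M)) (d + 2)
      ((S i)(0 := length (L (Suc i)))) (olist (L (Suc i)))" unfolding l .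
    let ?s = "(S i)(0 := length (L (Suc i)))"
    have b: "tri w (d + 2) ?s (olist (L (Suc i))) (Inc (Suc d)) 1 (d + 2) (?s(Suc d := Suc (?s (Suc d)))) (olist (L (Suc i)))"
      by (rule tri_Inc) simp
    from tri_Sq[OF a b] show "tri w (d + 2) (S i) (olist (L i)) (Sq (compile_cmd c (Suc d # vs) (d + 2)) (Inc (Suc d)))
      (ctime c (M + valb t M) + 2) (d + 2) (S (Suc i)) (olist (L (Suc i)))"
      by (rule tri_mono) (use CFor.prems in \<open>auto simp: S_def\<close>)
  qed (auto simp: S_def)
  have le: "N * ((ctime c (M + valb t M) + 2) + 1) \<le> valb t M * (ctime c (M + valb t M) + 3)"
    using N by (intro mult_le_mono) auto
  have L0: "olist (L 0) = olist l" and LN: "L N = l @ out w (CFor t c) (map s vs)"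
    by (simp_all add: L_def N_def)
  from tri_Sq[OF 1 tri_Sq[OF 2 3[unfolded L0]]] show ?case
    unfolding compile_cmd.simps LN Suc_eq_plus1[symmetric]
    by (rule tri_mono) (use le CFor.prems in \<open>auto simp: S_def LN algebra_simps\<close>)
next
  case (CIf t c c')
  define N where "N = eval w t (map s vs)"
  let ?s = "(s(d := N))(Suc d := 0)"
  let ?o = "out w (CIf t c c') (map s vs)"
  have 1: "tri w d s (olist l) (compile t vs d) (timb t M) (Suc d) (s(d := N)) (olist l)"
    unfolding N_def by (rule tri_compile) (use CIf.prems in auto)
  have 2: "tri w (Suc d) (s(d := N)) (olist l) (Clr (Suc d)) 1 (d + 2) ?s (olist l)"
    by (rule tri_mono[OF tri_Clr]) auto
  have m: "map ?s vs = map s vs" using CIf.prems by auto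
  have 3: "tri w (d + 2) ?s (olist l) (Cond (Lt (Suc d) d) (compile_cmd c vs (d + 2)) (compile_cmd c' vs (d + 2)))
     (ctime c M + ctime c' M + 1) (d + 2) (?s(0 := length (l @ ?o))) (olist (l @ ?o))"
  proof (rule tri_Cond)
    assume "tval w ?s (Lt (Suc d) d)"
    then have "0 < N" by simp
    then have o: "?o = out w c (map ?s vs)" unfolding m by (simp add: N_def)
    have "tri w (d + 2) ?s (olist l) (compile_cmd c vs (d + 2)) (ctime c M) (d + 2) (?s(0 := length (l @ ?o))) (olist (l @ ?o))"
      unfolding o by (rule CIf.IH(1)) (use CIf.prems in auto)
    then show "tri w (d + 2) ?s (olist l) (compile_cmd c vs (d + 2)) (ctime c M + ctime c' M) (d + 2) (?s(0 := length (l @ ?o))) (olist (l @ ?o))"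
      by (rule tri_mono) auto
  next
    assume "\<not> tval w ?s (Lt (Suc d) d)"
    then have "N = 0" by simp
    then have o: "?o = out w c' (map ?s vs)" unfolding m by (simp add: N_def)
    have "tri w (d + 2) ?s (olist l) (compile_cmd c' vs (d + 2)) (ctime c' M) (d + 2) (?s(0 := length (l @ ?o))) (olist (l @ ?o))"
      unfolding o by (rule CIf.IH(2)) (use CIf.prems in auto)
    then show "tri w (d + 2) ?s (olist l) (compile_cmd c' vs (d + 2)) (ctime c M + ctime c' M) (d + 2) (?s(0 := length (l @ ?o))) (olist (l @ ?o))"
      by (rule tri_mono) auto
  qed auto
  from tri_Sq[OF 1 tri_Sq[OF 2 3]] show ?case
    unfolding compile_cmd.simps Suc_eq_plus1[symmetric]
    by (rule tri_mono) (use CIf.prems in auto)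
qed

subsection \<open>Polynomial bounds\<close>

definition pb :: "(nat \<Rightarrow> nat) \<Rightarrow> bool" where
  "pb f \<longleftrightarrow> (\<exists>C k. \<forall>M. f M \<le> C * (M + 1) ^ k)"

lemma pbI: "(\<And>M. f M \<le> C * (M + 1) ^ k) \<Longrightarrow> pb f"
  unfolding pb_def by blast

lemma pb_const: "pb (\<lambda>_. c)"
  by (rule pbI[of _ c 0]) simp

lemma pb_id: "pb (\<lambda>M. M)"
  by (rule pbI[of _ 1 1]) simp

lemma pb_add: assumes "pb f" "pb g" shows "pb (\<lambda>M. f M + g M)"
proof -
  obtain C k D l where 1: "\<And>M. f M \<le> C * (M + 1) ^ k" "\<And>M. g M \<le> D * (M + 1) ^ l"
    using assms unfolding pb_def by blast
  show ?thesis
  proof (rule pbI)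
    fix M :: nat
    have "f M + g M \<le> C * (M + 1) ^ (k + l) + D * (M + 1) ^ (k + l)"
      by (intro add_mono order_trans[OF 1(1)] order_trans[OF 1(2)] mult_le_mono2 power_increasing) auto
    then show "f M + g M \<le> (C + D) * (M + 1) ^ (k + l)" by (simp add: algebra_simps)
  qed
qed

lemma pb_mult: assumes "pb f" "pb g" shows "pb (\<lambda>M. f M * g M)"
proof -
  obtain C k D l where 1: "\<And>M. f M \<le> C * (M + 1) ^ k" "\<And>M. g M \<le> D * (M + 1) ^ l"
    using assms unfolding pb_def by blast
  show ?thesis
  proof (rule pbI)
    fix M :: nat
    have "f M * g M \<le> (C * (M + 1) ^ k) * (D * (M + 1) ^ l)" using 1 by (intro mult_mono) auto
    then show "f M * g M \<le> (C * D) * (M + 1) ^ (k + l)" by (simp add: power_add algebra_simps)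
  qed
qed

text \<open>Composition occurs because a loop body runs under an enlarged environment bound; the
  depth of nesting is fixed by the program text.\<close>

lemma pb_comp: assumes "pb f" "pb g" shows "pb (\<lambda>M. f (g M))"
proof -
  obtain C k D l where 1: "\<And>M. f M \<le> C * (M + 1) ^ k" "\<And>M. g M \<le> D * (M + 1) ^ l"
    using assms unfolding pb_def by blast
  show ?thesis
  proof (rule pbI)
    fix M :: nat
    have "1 \<le> (M + 1) ^ l" by (rule one_le_power) simp
    with 1(2) have "g M + 1 \<le> D * (M + 1) ^ l + (M + 1) ^ l" by (rule add_mono)
    then have "g M + 1 \<le> (D + 1) * (M + 1) ^ l" unfolding distrib_right[of D] mult_1 .
    then have "(g M + 1) ^ k \<le> ((D + 1) * (M + 1) ^ l) ^ k" by (intro power_mono) auto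
    then have "C * (g M + 1) ^ k \<le> C * ((D + 1) ^ k * (M + 1) ^ (l * k))"
      unfolding power_mult_distrib power_mult by (rule mult_le_mono2)
    then show "f (g M) \<le> (C * (D + 1) ^ k) * (M + 1) ^ (l * k)"
      using 1(1)[of "g M"] unfolding mult.assoc by (rule order_trans[rotated])
  qed
qed

lemmas pb_intros = pb_const pb_id pb_add pb_mult

lemma pb_valb: "pb (valb t)"
  by (induction t) (unfold valb.simps, (rule pb_intros | assumption)+)

lemma pb_timb: "pb (timb t)"
proof (induction t)
  case (TLoop n c a b)
  have "pb (\<lambda>M. timb b (M + valb n M + valb a M + valb c M))"
    by (rule pb_comp[OF TLoop(4)]) (intro pb_intros pb_valb)
  then show ?case unfolding timb.simps by (intro pb_intros pb_valb TLoop)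
qed (unfold timb.simps, (rule pb_intros pb_valb | assumption)+)

lemma pb_ctime: "pb (ctime c)"
proof (induction c)
  case (CFor t c)
  have "pb (\<lambda>M. ctime c (M + valb t M))"
    by (rule pb_comp[OF CFor]) (intro pb_intros pb_valb)
  then show ?case unfolding ctime.simps by (intro pb_intros pb_valb pb_timb)
qed (unfold ctime.simps, (rule pb_intros pb_valb pb_timb | assumption)+)

section \<open>Turing machines for output programs and for decision terms\<close>

primrec wrok :: "com \<Rightarrow> bool" where
  "wrok (Inc r) = True"
| "wrok (Clr r) = True"
| "wrok (Wr v r) = (v < 3)"
| "wrok Fail = True"
| "wrok (Sq c c') = (wrok c \<and> wrok c')"
| "wrok (Cond t c c') = (wrok c \<and> wrok c')"
| "wrok (Wh t c) = wrok c"

lemma tcnt_bound: "Suc (Max (tcnt t)) \<le> L \<Longrightarrow> tcnt t \<subseteq> {..<L}"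
proof
  fix r assume "Suc (Max (tcnt t)) \<le> L" "r \<in> tcnt t"
  moreover have "r \<le> Max (tcnt t)" using calculation by (intro Max_ge) simp_all
  ultimately show "r \<in> {..<L}" unfolding lessThan_iff by linarith
qed

lemma ex_cok: "wrok c \<Longrightarrow> \<exists>K. \<forall>K'\<ge>K. cok K' c"
proof (induction c)
  case (Sq c c')
  then obtain K K' where "\<forall>L\<ge>K. cok L c" "\<forall>L\<ge>K'. cok L c'" by auto
  then show ?case by (intro exI[of _ "max K K'"]) auto
next
  case (Cond t c c')
  then obtain K K' where "\<forall>L\<ge>K. cok L c" "\<forall>L\<ge>K'. cok L c'" by auto
  then show ?case by (intro exI[of _ "max (Suc (Max (tcnt t))) (max K K')"])
      (simp add: tcnt_bound)
next
  case (Wh t c)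
  then obtain K where "\<forall>L\<ge>K. cok L c" by auto
  then show ?case by (intro exI[of _ "max (Suc (Max (tcnt t))) K"])
      (simp add: tcnt_bound)
next
  case (Inc r) then show ?case by (intro exI[of _ "Suc r"]) auto
next
  case (Clr r) then show ?case by (intro exI[of _ "Suc r"]) auto
next
  case (Wr v r) then show ?case by (intro exI[of _ "Suc r"]) auto
qed auto

lemma wrok_incs [simp]: "wrok (incs d n)"
  by (induction n) auto

lemma wrok_compile [simp]: "wrok (compile t vs d)"
  by (induction t arbitrary: vs d) (auto simp: copy_def)

lemma wrok_compile_cmd [simp]: "wrok (compile_cmd c vs d)"
  by (induction c arbitrary: vs d) (auto simp: sym_def)

lemma wordb_sym: "wordb (map sym x)"
  by (auto simp: wordb_def sym_def)

theorem cmd_poly_computable: "poly_computable (\<lambda>x. out (map sym x) c [])"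
proof -
  define P where "P = compile_cmd c [] 1"
  obtain K where K: "cok K P" using ex_cok[of P] by (auto simp: P_def)
  obtain Q G where wf: "tm_wf Q G (mk_tm K P)" using mk_tm_wf[OF K] by blast
  have "pb (\<lambda>M. 2 * ctime c M * ctime c M + 6 * ctime c M + 2)"
    by (intro pb_intros pb_ctime)
  then obtain C k where Ck: "\<And>M. 2 * ctime c M * ctime c M + 6 * ctime c M + 2 \<le> C * (M + 1) ^ k"
    unfolding pb_def by blast
  have "\<exists>t\<le>C * (length x + 1) ^ k. (case tm_run (mk_tm K P) t (map sym x) of (q, tp, h) \<Rightarrow>
           q = 1 \<and> (\<forall>i < length (out (map sym x) c []). tp (int i) = sym (out (map sym x) c [] ! i)) \<and>
           tp (int (length (out (map sym x) c []))) = 0)" for x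
  proof -
    let ?w = "map sym x"
    let ?o = "out ?w c []"
    have "tri ?w 1 (\<lambda>_. 0) (\<lambda>_. 0) P (ctime c (length x)) 1 ((\<lambda>_. 0)(0 := length ?o)) (olist ?o)"
      using tri_compile_cmd[of ?w "length x" "[]" 1 "\<lambda>_. 0" "[]" c] wordb_sym[of x]
      by (simp add: P_def olist_Nil)
    from tri_run[OF this, of "[]"] obtain n s where n: "n \<le> ctime c (length x)"
      "(cstep ?w ^^ n) ([P], init_store) = ([], s, olist ?o)" "s 0 = length ?o" by auto
    \<comment> \<open>The output is no longer than the run that wrote it, so converting it to plain
      symbols stays within the time bound.\<close>
    have "s 0 \<le> n" using csteps_sim[OF K n(2)] by blast
    then have "\<exists>t \<le> 2 * n * n + 6 * n + 2. \<exists>tp h. tm_run (mk_tm K P) t ?w = (1, tp, h) \<and>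
      (\<forall>i<length ?o. tp (int i) = olist ?o i) \<and> tp (int (length ?o)) = 0"
      using n(3) by (intro run_accept[OF K _ n(2)]) (use wordb_sym in \<open>auto simp: wordb_def olist_def sym_def\<close>)
    then obtain t tp h where t: "t \<le> 2 * n * n + 6 * n + 2" "tm_run (mk_tm K P) t ?w = (1, tp, h)"
      "\<forall>i<length ?o. tp (int i) = olist ?o i" "tp (int (length ?o)) = 0" by blast
    have "2 * n * n + 6 * n + 2 \<le> 2 * ctime c (length x) * ctime c (length x) + 6 * ctime c (length x) + 2"
      using n(1) by (intro add_le_mono mult_le_mono) auto
    then have "t \<le> C * (length x + 1) ^ k" using t(1) Ck[of "length x"] by linarith
    then show ?thesis using t by (intro exI[of _ t]) (auto simp: olist_def)
  qed
  then show ?thesis unfolding poly_computable_def using wf by blast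
qed

theorem trm_decider:
  "\<exists>Q G \<delta>. tm_wf Q G \<delta> \<and> poly_time_tm \<delta> \<and>
    (\<forall>w. wordb w \<longrightarrow> (tm_accepts \<delta> w \<longleftrightarrow> 0 < eval w t []))"
proof -
  define P1 where "P1 = Sq (compile t [] 1) (Clr 2)"
  \<comment> \<open>Counter 2 holds 0 for comparison: \<open>Lt 2 1\<close> asks whether the value
    in counter 1 is positive.\<close>
  define P where "P = Sq P1 (Cond (Lt 2 1) (Clr 2) Fail)"
  obtain K where K: "cok K P" using ex_cok[of P] by (auto simp: P_def P1_def)
  obtain Q G where wf: "tm_wf Q G (mk_tm K P)" using mk_tm_wf[OF K] by blast
  define B where "B = (\<lambda>M. 1 + (1 + timb t M + 1 + 3))"
  have "pb (\<lambda>M. 2 * B M * B M + 6 * B M + 2)"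
    unfolding B_def by (intro pb_intros pb_timb)
  then obtain C k where Ck: "\<And>M. 2 * B M * B M + 6 * B M + 2 \<le> C * (M + 1) ^ k"
    unfolding pb_def by blast
  have *: "\<exists>u\<le>C * (length w + 1) ^ k. fst (tm_run (mk_tm K P) u w) = (if 0 < eval w t [] then 1 else 2)"
    if w: "wordb w" for w
  proof -
    have w': "set w \<subseteq> {1, 2, 3}" using w by (simp add: wordb_def)
    have 1: "tri w 1 (\<lambda>_. 0) (\<lambda>_. 0) (compile t [] 1) (timb t (length w)) 2 ((\<lambda>_. 0)(1 := eval w t [])) (\<lambda>_. 0)"
      using tri_compile[of w "length w" "[]" 1 "\<lambda>_. 0" "\<lambda>_. 0" t] w by (simp add: numeral_2_eq_2)
    have 2: "tri w 1 (\<lambda>_. 0) (\<lambda>_. 0) P1 (1 + timb t (length w) + 1) (Suc 2)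
       (((\<lambda>_. 0)(1 := eval w t []))(2 := 0)) (\<lambda>_. 0)"
      using tri_Sq[OF 1 tri_Clr] by (simp add: P1_def)
    from tri_run[OF this, of "[Cond (Lt 2 1) (Clr 2) Fail]"] obtain n s where n: "n \<le> 1 + timb t (length w) + 1"
      "(cstep w ^^ n) ([P1, Cond (Lt 2 1) (Clr 2) Fail], init_store) = ([Cond (Lt 2 1) (Clr 2) Fail], s, \<lambda>_. 0)"
      "\<forall>r<Suc 2. s r = (((\<lambda>_. 0)(1 := eval w t []))(2 := 0)) r" by blast
    have s12: "s (Suc 0) = eval w t []" "s 2 = 0" using n(3) by auto
    have st: "(cstep w ^^ 1) ([P], init_store) = ([P1, Cond (Lt 2 1) (Clr 2) Fail], init_store)"
      by (simp add: P_def init_store_def)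
    note st = funpow_chain[OF st n(2)]
    have mono: "2 * m * m + 6 * m + 2 \<le> C * (length w + 1) ^ k" if "m \<le> B (length w)" for m
    proof -
      have "2 * m * m + 6 * m + 2 \<le> 2 * B (length w) * B (length w) + 6 * B (length w) + 2"
        using that by (intro add_le_mono mult_le_mono) auto
      then show ?thesis using Ck[of "length w"] by linarith
    qed
    show ?thesis
    proof (cases "0 < eval w t []")
      case True
      then have "(cstep w ^^ 2) ([Cond (Lt 2 1) (Clr 2) Fail], s, \<lambda>_. 0) = ([], s(2 := 0), \<lambda>_. 0)"
        using s12 by (simp add: numeral_2_eq_2)
      from run_accept[OF K w' funpow_chain[OF st this], of 0]
      obtain u tp h where u: "u \<le> 2 * (2 + (n + 1)) * (2 + (n + 1)) + 6 * (2 + (n + 1)) + 2" "tm_run (mk_tm K P) u w = (1, tp, h)"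
        by auto
      have "u \<le> C * (length w + 1) ^ k" using u(1) mono[of "2 + (n + 1)"] n(1) by (simp add: B_def)
      then show ?thesis using u(2) True by (intro exI[of _ u]) simp
    next
      case False
      then have "(cstep w ^^ 1) ([Cond (Lt 2 1) (Clr 2) Fail], s, \<lambda>_. 0) = ([Fail], s, \<lambda>_. 0)"
        using s12 by simp
      from run_reject[OF K w' funpow_chain[OF st this]]
      obtain u where u: "u \<le> 2 * (1 + (n + 1)) * (1 + (n + 1)) + 6 * (1 + (n + 1)) + 2" "fst (tm_run (mk_tm K P) u w) = 2"
        by auto
      have "u \<le> C * (length w + 1) ^ k" using u(1) mono[of "1 + (n + 1)"] n(1) by (simp add: B_def)
      then show ?thesis using u(2) False by (intro exI[of _ u]) simp
    qed
  qed
  have **: "fst (tm_run (mk_tm K P) u' w) = (if 0 < eval w t [] then 1 else 2)"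
    if w: "wordb w" and "C * (length w + 1) ^ k \<le> u'" for w u'
  proof -
    obtain u where u: "u\<le>C * (length w + 1) ^ k" "fst (tm_run (mk_tm K P) u w) = (if 0 < eval w t [] then 1 else 2)"
      using *[OF w] by blast
    then have "tm_run (mk_tm K P) u' w = tm_run (mk_tm K P) u w"
      using that(2) by (intro tm_run_halted) auto
    then show ?thesis using u by simp
  qed
  have "poly_time_tm (mk_tm K P)"
    unfolding poly_time_tm_def using ** by (intro exI[of _ C] exI[of _ k]) (auto simp: wordb_def)
  moreover have "tm_accepts (mk_tm K P) w \<longleftrightarrow> 0 < eval w t []" if w: "wordb w" for w
  proof
    assume "tm_accepts (mk_tm K P) w"
    then obtain u where u: "fst (tm_run (mk_tm K P) u w) = 1" unfolding tm_accepts_def by blast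
    define v where "v = max u (C * (length w + 1) ^ k)"
    have v: "u \<le> v" "C * (length w + 1) ^ k \<le> v" unfolding v_def by (rule max.cobounded1, rule max.cobounded2)
    have "tm_run (mk_tm K P) v w = tm_run (mk_tm K P) u w"
      by (rule tm_run_halted[OF _ v(1)]) (simp add: u)
    then show "0 < eval w t []" using **[OF w v(2)] u by (cases "0 < eval w t []") simp_all
  next
    assume "0 < eval w t []"
    then show "tm_accepts (mk_tm K P) w"
      unfolding tm_accepts_def using **[OF w order_refl] by (intro exI[of _ "C * (length w + 1) ^ k"]) simp
  qed
  ultimately show ?thesis
    using wf by (intro exI[of _ Q] exI[of _ G] exI[of _ "mk_tm K P"]) simp
qed

section \<open>Derived term constructs\<close>

primrec lift :: "trm \<Rightarrow> nat \<Rightarrow> trm" where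
  "lift (TVar i) k = TVar (if i < k then i else Suc i)"
| "lift (TNum n) k = TNum n"
| "lift TLen k = TLen"
| "lift (TSym t) k = TSym (lift t k)"
| "lift (TAdd a b) k = TAdd (lift a k) (lift b k)"
| "lift (TMul a b) k = TMul (lift a k) (lift b k)"
| "lift (TLess a b) k = TLess (lift a k) (lift b k)"
| "lift (TLoop n c a b) k = TLoop (lift n k) (lift c k) (lift a k) (lift b (Suc (Suc k)))"

lemma eval_lift_append:
  "eval w (lift t (length e1)) (e1 @ x # e2) = eval w t (e1 @ e2)"
proof (induction t arbitrary: e1)
  case (TVar i)
  then show ?case by (auto simp: nth_append nth_Cons' not_less Suc_diff_le)
next
  case (TLoop n c a b)
  have "eval w (lift b (Suc (Suc (length e1)))) (y # i # e1 @ x # e2) = eval w b (y # i # e1 @ e2)" for y i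
    using TLoop(4)[of "y # i # e1"] by simp
  then show ?case using TLoop(1-3) by simp
qed auto

lemma eval_lift [simp]: "eval w (lift t 0) (x # e) = eval w t e"
  using eval_lift_append[of w t "[]" x e] by simp

lemma eval_TLess [simp]: "eval w (TLess a b) e = of_bool (eval w a e < eval w b e)"
  by simp

declare eval.simps(7) [simp del]

definition TNot where "TNot a = TLess a (TNum 1)"
definition TAnd where "TAnd a b = TLess (TNum 0) (TMul a b)"
definition TOr where "TOr a b = TLess (TNum 0) (TAdd a b)"
definition TLe where "TLe a b = TNot (TLess b a)"
definition TEq where "TEq a b = TAnd (TLe a b) (TLe b a)"
definition TIf where "TIf c a b = TAdd (TMul (TLess (TNum 0) c) a) (TMul (TNot c) b)"

lemma eval_TNot [simp]: "eval w (TNot a) e = of_bool (\<not> 0 < eval w a e)"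
  by (simp add: TNot_def)

lemma eval_TAnd [simp]: "eval w (TAnd a b) e = of_bool (0 < eval w a e \<and> 0 < eval w b e)"
  by (simp add: TAnd_def)

lemma eval_TOr [simp]: "eval w (TOr a b) e = of_bool (0 < eval w a e \<or> 0 < eval w b e)"
  by (auto simp: TOr_def)

lemma eval_TLe [simp]: "eval w (TLe a b) e = of_bool (eval w a e \<le> eval w b e)"
  by (simp add: TLe_def not_less)

lemma eval_TEq [simp]: "eval w (TEq a b) e = of_bool (eval w a e = eval w b e)"
  by (auto simp: TEq_def)

lemma eval_TIf [simp]: "eval w (TIf c a b) e = (if 0 < eval w c e then eval w a e else eval w b e)"
  by (simp add: TIf_def)

definition TImp where "TImp a b = TOr (TNot a) b"
definition TIff where "TIff a b = TAnd (TImp a b) (TImp b a)"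

lemma eval_TImp [simp]: "eval w (TImp a b) e = of_bool (0 < eval w a e \<longrightarrow> 0 < eval w b e)"
  by (auto simp: TImp_def)

lemma eval_TIff [simp]: "eval w (TIff a b) e = of_bool (0 < eval w a e \<longleftrightarrow> 0 < eval w b e)"
  by (auto simp: TIff_def)

text \<open>The cap \<open>n\<close> never cuts anything off, as at most \<open>n\<close> indices
  are counted. Quantifiers, subtraction and division all reduce to counting.\<close>

definition TCount where
  "TCount n b = TLoop n n (TNum 0) (TAdd (TVar 0) (TLess (TNum 0) (lift b 0)))"

lemma card_less_Suc_if:
  "card {i. i < Suc m \<and> P i} = card {i. i < m \<and> P i} + of_bool (P m)"
proof -
  have "{i. i < Suc m \<and> P i} = (if P m then insert m {i. i < m \<and> P i} else {i. i < m \<and> P i})"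
    by (auto simp: less_Suc_eq)
  then show ?thesis by auto
qed

lemma card_less_le: "card {i. i < m \<and> P i} \<le> (m::nat)"
  using card_mono[of "{..<m}" "{i. i < m \<and> P i}"] by (auto simp: subset_iff)

lemma eval_TCount [simp]:
  "eval w (TCount n b) e = card {i. i < eval w n e \<and> 0 < eval w b (i # e)}"
proof -
  let ?N = "eval w n e"
  have "m \<le> ?N \<Longrightarrow> rec_nat 0 (\<lambda>i x. min ?N (x + of_bool (0 < eval w b (i # e)))) m
     = card {i. i < m \<and> 0 < eval w b (i # e)}" for m
  proof (induction m)
    case (Suc m)
    have "card {i. i < Suc m \<and> 0 < eval w b (i # e)} \<le> ?N"
      using card_less_le[of "Suc m"] Suc.prems by (meson order_trans)
    then show ?case using Suc by (simp add: card_less_Suc_if)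
  qed simp
  then show ?thesis by (simp add: TCount_def)
qed

definition TEx where "TEx n b = TLess (TNum 0) (TCount n b)"
definition TAll where "TAll n b = TNot (TEx n (TNot b))"

lemma eval_TEx [simp]: "eval w (TEx n b) e = of_bool (\<exists>i<eval w n e. 0 < eval w b (i # e))"
  by (auto simp: TEx_def card_gt_0_iff)

lemma eval_TAll [simp]: "eval w (TAll n b) e = of_bool (\<forall>i<eval w n e. 0 < eval w b (i # e))"
  by (auto simp: TAll_def)

definition TSub where "TSub a b = TCount a (TLe (lift b 0) (TVar 0))"
definition TDiv where "TDiv a b = TCount a (TLe (TMul (TAdd (TVar 0) (TNum 1)) (lift b 0)) (lift a 0))"
definition TMod where "TMod a b = TSub a (TMul (TDiv a b) b)"

lemma eval_TSub [simp]: "eval w (TSub a b) e = eval w a e - eval w b e"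
proof -
  have "{i. i < m \<and> n \<le> i} = {n..<m}" for m n :: nat by auto
  then show ?thesis by (simp add: TSub_def)
qed

lemma eval_TDiv [simp]: "0 < eval w b e \<Longrightarrow> eval w (TDiv a b) e = eval w a e div eval w b e"
proof -
  assume b: "0 < eval w b e"
  have "{i. i < m \<and> Suc i * n \<le> m} = {..<m div n}" if "0 < n" for m n :: nat
  proof -
    have "Suc i * n \<le> m \<longleftrightarrow> i < m div n" for i
      using less_eq_div_iff_mult_less_eq[OF that, of "Suc i" m] by (simp add: Suc_le_eq)
    moreover have "i < m" if "i < m div n" for i
      using that div_le_dividend[of m n] by linarith
    ultimately show ?thesis by blast
  qed
  then show ?thesis using b by (simp add: TDiv_def)
qed

lemma eval_TMod [simp]: "0 < eval w b e \<Longrightarrow> eval w (TMod a b) e = eval w a e mod eval w b e"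
  by (simp add: TMod_def minus_div_mult_eq_mod)

primrec TPow :: "trm \<Rightarrow> nat \<Rightarrow> trm" where
  "TPow t 0 = TNum 1"
| "TPow t (Suc k) = TMul t (TPow t k)"

lemma eval_TPow [simp]: "eval w (TPow t k) e = eval w t e ^ k"
  by (induction k) auto

text \<open>The way in which an arbitrary function on a finite range, such as one derived from a
  transition function, enters a term.\<close>

primrec TTab :: "(nat \<Rightarrow> nat) \<Rightarrow> nat \<Rightarrow> trm \<Rightarrow> trm" where
  "TTab f 0 t = TNum 0"
| "TTab f (Suc k) t = TIf (TEq t (TNum k)) (TNum (f k)) (TTab f k t)"

lemma eval_TTab [simp]: "eval w t e < k \<Longrightarrow> eval w (TTab f k t) e = f (eval w t e)"
  by (induction k) (auto simp: less_Suc_eq)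

section \<open>Merge sequences\<close>

text \<open>A sequence of merges is described by the representatives (least elements) \<open>a \<sigma> < b \<sigma>\<close> of
  the two versions merged at time \<open>\<sigma>\<close>; \<open>a \<sigma> = b \<sigma>\<close> encodes an idle step.\<close>

primrec rt :: "(nat \<Rightarrow> nat) \<Rightarrow> (nat \<Rightarrow> nat) \<Rightarrow> nat \<Rightarrow> nat \<Rightarrow> nat" where
  "rt a b 0 i = i"
| "rt a b (Suc \<sigma>) i = (if rt a b \<sigma> i = b \<sigma> then a \<sigma> else rt a b \<sigma> i)"

lemma rt_cong: "(\<And>\<sigma>. \<sigma> < \<tau> \<Longrightarrow> a \<sigma> = a' \<sigma> \<and> b \<sigma> = b' \<sigma>) \<Longrightarrow> rt a b \<tau> i = rt a' b' \<tau> i"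
  by (induction \<tau>) auto

definition cls :: "nat \<Rightarrow> (nat \<Rightarrow> nat) \<Rightarrow> nat \<Rightarrow> nat set" where
  "cls n r c = {i. i < n \<and> r i = c}"

definition reps :: "nat \<Rightarrow> (nat \<Rightarrow> nat) \<Rightarrow> nat set" where
  "reps n r = {c. c < n \<and> r c = c}"

definition bef :: "nat list \<Rightarrow> (nat \<Rightarrow> nat) \<Rightarrow> nat \<Rightarrow> nat \<Rightarrow> bool" where
  "bef cs r c d \<longleftrightarrow> gs_count cs (cls (length cs) r d) < gs_count cs (cls (length cs) r c) \<or>
     gs_count cs (cls (length cs) r c) = gs_count cs (cls (length cs) r d) \<and> c < d"

definition rk :: "nat list \<Rightarrow> (nat \<Rightarrow> nat) \<Rightarrow> nat \<Rightarrow> nat" where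
  "rk cs r d = card {c. c < length cs \<and> r c = c \<and> bef cs r c d}"

definition legal :: "nat \<Rightarrow> nat list \<Rightarrow> nat list \<Rightarrow> (nat \<Rightarrow> nat) \<Rightarrow> nat \<Rightarrow> nat \<Rightarrow> bool" where
  "legal p cs ls r a b \<longleftrightarrow> a < b \<and> b < length cs \<and> r a = a \<and> r b = b \<and>
     rk cs r a div p = rk cs r b div p \<and>
     (\<forall>i<length cs. \<forall>j<length cs. (r i = a \<or> r i = b) \<and> (r j = a \<or> r j = b) \<longrightarrow> ls ! i = ls ! j)"

lemma legalD:
  assumes "legal p cs ls r a b"
  shows "a < b" "b < length cs" "r a = a" "r b = b"
  using assms unfolding legal_def by blast+

definition idem :: "nat \<Rightarrow> (nat \<Rightarrow> nat) \<Rightarrow> bool" where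
  "idem n r \<longleftrightarrow> (\<forall>i<n. r i \<le> i \<and> r (r i) = r i)"

definition mrg :: "(nat \<Rightarrow> nat) \<Rightarrow> nat \<Rightarrow> nat \<Rightarrow> nat \<Rightarrow> nat" where
  "mrg r a b i = (if r i = b then a else r i)"

lemma rt_Suc: "rt a b (Suc \<sigma>) = mrg (rt a b \<sigma>) (a \<sigma>) (b \<sigma>)"
  by (simp add: mrg_def fun_eq_iff)

lemma idem_mrg: "idem n r \<Longrightarrow> a < b \<Longrightarrow> b < n \<Longrightarrow> r a = a \<Longrightarrow> r b = b \<Longrightarrow> idem n (mrg r a b)"
  by (auto simp: idem_def mrg_def)

text \<open>This turns the tie-break by \<open>Min\<close> in \<open>gs_before\<close> into the
  comparison of representatives in \<open>bef\<close>.\<close>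

lemma Min_cls:
  assumes "idem n r" "c \<in> reps n r" shows "Min (cls n r c) = c"
proof (rule Min_eqI)
  show "finite (cls n r c)" by (simp add: cls_def)
next
  fix y assume "y \<in> cls n r c"
  then show "c \<le> y" using assms(1) unfolding cls_def idem_def by blast
next
  show "c \<in> cls n r c" using assms(2) unfolding cls_def reps_def by blast
qed

lemma cls_inj: "inj_on (cls n r) (reps n r)"
proof (rule inj_onI)
  fix x y assume xy: "x \<in> reps n r" "cls n r x = cls n r y"
  then have "x \<in> cls n r x" unfolding cls_def reps_def by blast
  then show "x = y" unfolding xy(2) using xy(1) unfolding cls_def reps_def by simp
qed

lemma gs_rank_cls:
  assumes "idem (length cs) r" "d \<in> reps (length cs) r"
  shows "gs_rank cs (cls (length cs) r ` reps (length cs) r) (cls (length cs) r d) = rk cs r d"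
proof -
  let ?n = "length cs"
  have "{W \<in> cls ?n r ` reps ?n r. gs_before cs W (cls ?n r d)} = cls ?n r ` {c. c < ?n \<and> r c = c \<and> bef cs r c d}"
  proof -
    have "gs_before cs (cls ?n r c) (cls ?n r d) \<longleftrightarrow> bef cs r c d" if "c \<in> reps ?n r" for c
      unfolding gs_before_def bef_def Min_cls[OF assms(1) that] Min_cls[OF assms] ..
    then have "{W \<in> cls ?n r ` reps ?n r. gs_before cs W (cls ?n r d)} = cls ?n r ` {c \<in> reps ?n r. bef cs r c d}"
      by blast
    then show ?thesis by (simp add: reps_def conj_assoc)
  qed
  moreover have "inj_on (cls ?n r) {c. c < ?n \<and> r c = c \<and> bef cs r c d}"
    by (rule inj_on_subset[OF cls_inj]) (auto simp: reps_def)
  ultimately show ?thesis by (simp add: gs_rank_def rk_def card_image)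
qed

lemma reps_mrg:
  assumes "a < b" "b < n" "r a = a" "r b = b"
  shows "reps n (mrg r a b) = reps n r - {b}"
  using assms by (auto simp: reps_def mrg_def)

lemma cls_mrg:
  assumes "a < b" "b < n" "r a = a" "r b = b"
  shows "cls n (mrg r a b) ` reps n (mrg r a b) =
    insert (cls n r a \<union> cls n r b) (cls n r ` reps n r - {cls n r a, cls n r b})"
proof -
  have ab: "a \<in> reps n r" "b \<in> reps n r" using assms by (auto simp: reps_def)
  have 1: "cls n (mrg r a b) a = cls n r a \<union> cls n r b"
    using assms by (auto simp: cls_def mrg_def)
  have 2: "cls n (mrg r a b) c = cls n r c" if "c \<noteq> a" "c \<noteq> b" for c
    using that by (auto simp: cls_def mrg_def)
  have 3: "reps n (mrg r a b) = insert a (reps n r - {a, b})"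
    unfolding reps_mrg[OF assms] using ab assms(1) by auto
  have "cls n r ` reps n r - {cls n r a, cls n r b} = cls n r ` (reps n r - {a, b})"
    using inj_on_image_set_diff[where f = "cls n r" and A = "reps n r" and B = "{a, b}", OF cls_inj] ab by auto
  moreover have "cls n (mrg r a b) ` (reps n r - {a, b}) = cls n r ` (reps n r - {a, b})"
    using 2 by (intro image_cong) auto
  ultimately show ?thesis unfolding 3 using 1 by simp
qed

lemma legal_step:
  assumes "idem (length cs) r" "legal p cs ls r a b"
  shows "gs_merge_step p cs ls (cls (length cs) r ` reps (length cs) r)
     (cls (length cs) (mrg r a b) ` reps (length cs) (mrg r a b))"
proof -
  let ?n = "length cs"
  note l = legalD[OF assms(2)]
  have ab: "a \<in> reps ?n r" "b \<in> reps ?n r" using l by (auto simp: reps_def)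
  have "cls ?n r a \<noteq> cls ?n r b" using inj_onD[OF cls_inj _ ab] l(1) by auto
  moreover have "\<forall>i\<in>cls ?n r a \<union> cls ?n r b. \<forall>j\<in>cls ?n r a \<union> cls ?n r b. ls ! i = ls ! j"
    using assms(2) unfolding legal_def cls_def by blast
  moreover have "rk cs r a div p = rk cs r b div p" using assms(2) unfolding legal_def by blast
  ultimately show ?thesis
    unfolding gs_merge_step_def cls_mrg[OF l]
    using ab by (rule_tac exI[of _ "cls ?n r a"], rule_tac exI[of _ "cls ?n r b"], intro conjI)
      (simp_all only: gs_rank_cls[OF assms(1)] imageI)
qed

lemma step_legal:
  assumes "idem (length cs) r" "gs_merge_step p cs ls (cls (length cs) r ` reps (length cs) r) S'"
  shows "\<exists>a b. legal p cs ls r a b \<and> S' = cls (length cs) (mrg r a b) ` reps (length cs) (mrg r a b)"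
proof -
  let ?n = "length cs"
  let ?S = "cls ?n r ` reps ?n r"
  have *: "legal p cs ls r a b \<and> S' = cls ?n (mrg r a b) ` reps ?n (mrg r a b)"
    if "a < b" "a \<in> reps ?n r" "b \<in> reps ?n r"
      "gs_rank cs ?S (cls ?n r a) div p = gs_rank cs ?S (cls ?n r b) div p"
      "\<forall>i\<in>cls ?n r a \<union> cls ?n r b. \<forall>j\<in>cls ?n r a \<union> cls ?n r b. ls ! i = ls ! j"
      "S' = insert (cls ?n r a \<union> cls ?n r b) (?S - {cls ?n r a, cls ?n r b})" for a b
  proof -
    have l: "b < ?n" "r a = a" "r b = b" using that by (auto simp: reps_def)
    have "legal p cs ls r a b"
      unfolding legal_def
    proof (intro conjI)
      show "rk cs r a div p = rk cs r b div p"
        using that(4) gs_rank_cls[OF assms(1)] that(2,3) by simp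
      show "\<forall>i<?n. \<forall>j<?n. (r i = a \<or> r i = b) \<and> (r j = a \<or> r j = b) \<longrightarrow> ls ! i = ls ! j"
        using that(5) unfolding cls_def by blast
    qed (use that(1) l in auto)
    then show ?thesis using cls_mrg[OF that(1) l] that(6) by simp
  qed
  obtain c d where cd: "c \<in> reps ?n r" "d \<in> reps ?n r" "cls ?n r c \<noteq> cls ?n r d"
      "gs_rank cs ?S (cls ?n r c) div p = gs_rank cs ?S (cls ?n r d) div p"
      "\<forall>i\<in>cls ?n r c \<union> cls ?n r d. \<forall>j\<in>cls ?n r c \<union> cls ?n r d. ls ! i = ls ! j"
      "S' = insert (cls ?n r c \<union> cls ?n r d) (?S - {cls ?n r c, cls ?n r d})"
    using assms(2) unfolding gs_merge_step_def by blast
  then have "c < d \<or> d < c" using nat_neq_iff by blast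
  then show ?thesis
  proof
    assume "c < d"
    then show ?thesis using *[of c d] cd by blast
  next
    assume "d < c"
    have sym: "cls ?n r c \<union> cls ?n r d = cls ?n r d \<union> cls ?n r c" "{cls ?n r c, cls ?n r d} = {cls ?n r d, cls ?n r c}"
      by auto
    show ?thesis
      using *[OF \<open>d < c\<close> cd(2,1) cd(4)[symmetric] cd(5)[unfolded sym(1)] cd(6)[unfolded sym]] by blast
  qed
qed

lemma gs_init_cls: "gs_init n = cls n id ` reps n id"
  by (force simp: gs_init_def cls_def reps_def)

text \<open>The number of steps is fixed to the number of versions, with idle steps as padding, so
  that all certificates have one shape.\<close>

definition valid :: "nat \<Rightarrow> nat list \<Rightarrow> nat list \<Rightarrow> (nat \<Rightarrow> nat) \<Rightarrow> (nat \<Rightarrow> nat) \<Rightarrow> bool" where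
  "valid p cs ls a b \<longleftrightarrow>
     (\<forall>\<sigma><length cs. a \<sigma> = b \<sigma> \<or> legal p cs ls (rt a b \<sigma>) (a \<sigma>) (b \<sigma>)) \<and>
     (\<forall>i<length cs. \<forall>j<length cs. ls ! i = ls ! j \<longrightarrow> rt a b (length cs) i = rt a b (length cs) j)"

lemma mrg_idle: "mrg r a a = r"
  by (auto simp: mrg_def fun_eq_iff)

lemma idem_rt:
  assumes "\<And>\<sigma>. \<sigma> < \<tau> \<Longrightarrow> a \<sigma> = b \<sigma> \<or> legal p cs ls (rt a b \<sigma>) (a \<sigma>) (b \<sigma>)"
  shows "idem (length cs) (rt a b \<tau>) \<and>
    (gs_merge_step p cs ls)\<^sup>*\<^sup>* (gs_init (length cs)) (cls (length cs) (rt a b \<tau>) ` reps (length cs) (rt a b \<tau>))"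
  using assms
proof (induction \<tau>)
  case 0
  show ?case by (simp add: gs_init_cls idem_def id_def)
next
  case (Suc \<tau>)
  then have IH: "idem (length cs) (rt a b \<tau>)"
    "(gs_merge_step p cs ls)\<^sup>*\<^sup>* (gs_init (length cs)) (cls (length cs) (rt a b \<tau>) ` reps (length cs) (rt a b \<tau>))" by auto
  show ?case
  proof (cases "a \<tau> = b \<tau>")
    case True
    then show ?thesis unfolding rt_Suc using IH by (simp add: mrg_idle)
  next
    case False
    then have l: "legal p cs ls (rt a b \<tau>) (a \<tau>) (b \<tau>)" using Suc.prems by blast
    have "idem (length cs) (mrg (rt a b \<tau>) (a \<tau>) (b \<tau>))"
      by (rule idem_mrg[OF IH(1) legalD[OF l]])
    moreover have "(gs_merge_step p cs ls)\<^sup>*\<^sup>* (gs_init (length cs))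
      (cls (length cs) (mrg (rt a b \<tau>) (a \<tau>) (b \<tau>)) ` reps (length cs) (mrg (rt a b \<tau>) (a \<tau>) (b \<tau>)))"
      by (rule rtranclp.rtrancl_into_rtrancl[of "gs_merge_step p cs ls", OF IH(2) legal_step[OF IH(1) l]])
    ultimately show ?thesis by (simp only: rt_Suc)
  qed
qed

lemma reach_rt:
  assumes "(gs_merge_step p cs ls)\<^sup>*\<^sup>* (gs_init (length cs)) S"
  shows "\<exists>m a b. (\<forall>\<sigma><m. legal p cs ls (rt a b \<sigma>) (a \<sigma>) (b \<sigma>)) \<and>
    S = cls (length cs) (rt a b m) ` reps (length cs) (rt a b m)"
  using assms
proof (induction rule: rtranclp_induct)
  case base
  show ?case by (rule exI[of _ 0]) (simp add: gs_init_cls id_def)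
next
  case (step S S')
  then obtain m a b where m: "\<forall>\<sigma><m. legal p cs ls (rt a b \<sigma>) (a \<sigma>) (b \<sigma>)"
    "S = cls (length cs) (rt a b m) ` reps (length cs) (rt a b m)" by blast
  then have "idem (length cs) (rt a b m)" using idem_rt[of m a b p cs ls] by blast
  from step_legal[OF this] step(2) m(2) obtain c d where cd: "legal p cs ls (rt a b m) c d"
    "S' = cls (length cs) (mrg (rt a b m) c d) ` reps (length cs) (mrg (rt a b m) c d)" by blast
  define a' where "a' = a(m := c)"
  define b' where "b' = b(m := d)"
  have eq: "rt a' b' \<tau> = rt a b \<tau>" if "\<tau> \<le> m" for \<tau>
    by (rule ext, rule rt_cong) (use that in \<open>auto simp: a'_def b'_def\<close>)
  have "legal p cs ls (rt a' b' \<sigma>) (a' \<sigma>) (b' \<sigma>)" if "\<sigma> < Suc m" for \<sigma>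
  proof (cases "\<sigma> = m")
    case True then show ?thesis using eq[of m] cd(1) by (simp add: a'_def b'_def)
  next
    case False
    then have "\<sigma> < m" using that by simp
    then show ?thesis using eq[of \<sigma>] m(1) by (simp add: a'_def b'_def)
  qed
  moreover have "rt a' b' (Suc m) = mrg (rt a b m) c d"
    unfolding rt_Suc using eq[of m] by (simp add: a'_def b'_def)
  ultimately show ?case using cd(2) by (intro exI[of _ "Suc m"] exI[of _ a'] exI[of _ b']) simp
qed

text \<open>Each merge removes exactly one representative; hence a sequence has at most
  \<open>length cs\<close> merges and fits into a certificate.\<close>

lemma card_reps_rt:
  assumes "\<And>\<sigma>. \<sigma> < m \<Longrightarrow> legal p cs ls (rt a b \<sigma>) (a \<sigma>) (b \<sigma>)"
  shows "card (reps (length cs) (rt a b m)) + m = length cs"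
  using assms
proof (induction m)
  case 0
  have "reps (length cs) (rt a b 0) = {..<length cs}" by (auto simp: reps_def)
  then show ?case by (simp only: card_lessThan add_0_right)
next
  case (Suc m)
  have l: "legal p cs ls (rt a b m) (a m) (b m)" using Suc.prems by blast
  have "finite (reps (length cs) (rt a b m))" "b m \<in> reps (length cs) (rt a b m)"
    using legalD[OF l] by (auto simp: reps_def)
  moreover have "reps (length cs) (rt a b (Suc m)) = reps (length cs) (rt a b m) - {b m}"
    unfolding rt_Suc by (rule reps_mrg[OF legalD[OF l]])
  ultimately have "card (reps (length cs) (rt a b m)) = Suc (card (reps (length cs) (rt a b (Suc m))))"
    by (metis card.remove)
  moreover have "card (reps (length cs) (rt a b m)) + m = length cs" using Suc by simp
  ultimately show ?case by linarith
qed

text \<open>The bound on the entries lets each of them be written in unary in one row of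
  \<open>length cs\<close> bits.\<close>

theorem gs_yes_iff_valid:
  "gs_yes p cs ls \<longleftrightarrow> (\<exists>a b. (\<forall>\<sigma>. a \<sigma> \<le> length cs \<and> b \<sigma> \<le> length cs) \<and> valid p cs ls a b)"
proof
  let ?n = "length cs"
  assume "gs_yes p cs ls"
  then obtain S where S: "(gs_merge_step p cs ls)\<^sup>*\<^sup>* (gs_init ?n) S"
    "\<forall>i < ?n. \<forall>j < ?n. ls ! i = ls ! j \<longrightarrow> (\<exists>V\<in>S. i \<in> V \<and> j \<in> V)" unfolding gs_yes_def by blast
  obtain m a b where m: "\<And>\<sigma>. \<sigma> < m \<Longrightarrow> legal p cs ls (rt a b \<sigma>) (a \<sigma>) (b \<sigma>)"
    "S = cls ?n (rt a b m) ` reps ?n (rt a b m)" using reach_rt[OF S(1)] by blast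
  have mn: "m \<le> ?n" using card_reps_rt[of m p cs ls a b] m(1) by simp
  define a' where "a' = (\<lambda>\<sigma>. if \<sigma> < m then a \<sigma> else 0)"
  define b' where "b' = (\<lambda>\<sigma>. if \<sigma> < m then b \<sigma> else 0)"
  have eq: "rt a' b' \<tau> = rt a b \<tau>" if "\<tau> \<le> m" for \<tau>
    by (rule ext, rule rt_cong) (use that in \<open>auto simp: a'_def b'_def\<close>)
  have late: "rt a' b' (m + k) = rt a b m" for k
  proof (induction k)
    case (Suc k)
    then show ?case by (simp add: rt_Suc a'_def b'_def mrg_idle del: rt.simps)
  qed (simp add: eq)
  have fin: "rt a' b' ?n = rt a b m" using late[of "?n - m"] mn by simp
  have "valid p cs ls a' b'"
    unfolding valid_def
  proof (intro conjI allI impI)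
    fix \<sigma> show "a' \<sigma> = b' \<sigma> \<or> legal p cs ls (rt a' b' \<sigma>) (a' \<sigma>) (b' \<sigma>)"
      using m(1)[of \<sigma>] eq[of \<sigma>] by (auto simp: a'_def b'_def)
  next
    fix i j assume "i < ?n" "j < ?n" "ls ! i = ls ! j"
    then obtain V where "V \<in> S" "i \<in> V" "j \<in> V" using S(2) by blast
    then show "rt a' b' ?n i = rt a' b' ?n j" unfolding fin m(2) by (auto simp: cls_def)
  qed
  moreover have "a' \<sigma> \<le> ?n \<and> b' \<sigma> \<le> ?n" for \<sigma>
    using legalD(1,2)[OF m(1)[of \<sigma>]] by (auto simp: a'_def b'_def)
  ultimately show "\<exists>a b. (\<forall>\<sigma>. a \<sigma> \<le> length cs \<and> b \<sigma> \<le> length cs) \<and> valid p cs ls a b" by blast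
next
  let ?n = "length cs"
  assume "\<exists>a b. (\<forall>\<sigma>. a \<sigma> \<le> length cs \<and> b \<sigma> \<le> length cs) \<and> valid p cs ls a b"
  then obtain a b where v: "valid p cs ls a b" by blast
  then have "\<And>\<sigma>. \<sigma> < ?n \<Longrightarrow> a \<sigma> = b \<sigma> \<or> legal p cs ls (rt a b \<sigma>) (a \<sigma>) (b \<sigma>)"
    unfolding valid_def by blast
  from idem_rt[OF this] have 1: "idem ?n (rt a b ?n)"
    "(gs_merge_step p cs ls)\<^sup>*\<^sup>* (gs_init ?n) (cls ?n (rt a b ?n) ` reps ?n (rt a b ?n))" by auto
  have "\<exists>V\<in>cls ?n (rt a b ?n) ` reps ?n (rt a b ?n). i \<in> V \<and> j \<in> V"
    if "i < ?n" "j < ?n" "ls ! i = ls ! j" for i j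
  proof -
    have "rt a b ?n i = rt a b ?n j" using v that unfolding valid_def by blast
    moreover have "rt a b ?n i \<in> reps ?n (rt a b ?n)"
      using 1(1) that(1) by (auto simp: idem_def reps_def intro: le_less_trans)
    ultimately show ?thesis using that by (intro bexI[of _ "cls ?n (rt a b ?n) (rt a b ?n i)"]) (auto simp: cls_def)
  qed
  then show "gs_yes p cs ls" unfolding gs_yes_def using 1(2) by blast
qed

section \<open>Membership in NP\<close>

subsection \<open>Decoding instances\<close>

text \<open>Encoded numbers are handled as lists of bit pairs, data pairs \<open>(True, b)\<close>
  and an end pair; pair \<open>q\<close> then starts at symbol \<open>2 * q\<close>.\<close>

definition prs :: "nat \<Rightarrow> (bool \<times> bool) list" where
  "prs n = map (Pair True) (bits n) @ [(False, False)]"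

definition flat :: "(bool \<times> bool) list \<Rightarrow> bool list" where
  "flat ps = concat (map (\<lambda>(a, b). [a, b]) ps)"

declare bits.simps [simp del]

lemma bits_0 [simp]: "bits 0 = []"
  by (simp add: bits.simps)

lemma bits_pos: "0 < n \<Longrightarrow> bits n = odd n # bits (n div 2)"
  by (subst bits.simps) simp

lemma flat_simps [simp]: "flat [] = []" "flat (p # ps) = fst p # snd p # flat ps"
  "flat (ps @ qs) = flat ps @ flat qs"
  by (auto simp: flat_def split: prod.split)

lemma enc_nat_flat: "enc_nat n = flat (prs n)"
proof -
  have "concat (map (\<lambda>b. [True, b]) l) = flat (map (Pair True) l)" for l by (induction l) auto
  then show ?thesis by (simp add: enc_nat_def prs_def)
qed

lemma encs_flat: "concat (map enc_nat vs) = flat (concat (map prs vs))"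
  by (induction vs) (auto simp: enc_nat_flat)

lemma length_flat [simp]: "length (flat ps) = 2 * length ps"
  by (induction ps) auto

lemma nth_flat: "q < length ps \<Longrightarrow> flat ps ! (2 * q) = fst (ps ! q) \<and> flat ps ! Suc (2 * q) = snd (ps ! q)"
proof (induction ps arbitrary: q)
  case (Cons p ps)
  then show ?case by (cases q) auto
qed simp

lemma ex_flat: "even (length x) \<Longrightarrow> \<exists>ps. x = flat ps"
proof (induction x rule: length_induct)
  case (1 x)
  show ?case
  proof (cases x)
    case Nil
    then show ?thesis by (intro exI[of _ "[]"]) simp
  next
    case (Cons a x')
    then obtain b x'' where x: "x = a # b # x''" using 1(2) by (cases x') auto
    then obtain ps where "x'' = flat ps" using 1 by force
    then show ?thesis using x by (intro exI[of _ "(a, b) # ps"]) simp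
  qed
qed

text \<open>The values of \<open>bits\<close> never end in a 0 bit, so each number has one encoding;
  the condition on the pair before an end pair checks this. All conditions are local and therefore
  expressible by a term.\<close>

fun okp :: "(bool \<times> bool) list \<Rightarrow> bool" where
  "okp [] = True"
| "okp ((a, b) # ps) = ((\<not> a \<longrightarrow> \<not> b) \<and> (a \<longrightarrow> ps \<noteq> [] \<and> (\<not> fst (hd ps) \<longrightarrow> b)) \<and> okp ps)"

lemma okp_nth: "okp ps \<longleftrightarrow> (\<forall>q<length ps. (\<not> fst (ps ! q) \<longrightarrow> \<not> snd (ps ! q)) \<and>
    (fst (ps ! q) \<longrightarrow> Suc q < length ps \<and> (\<not> fst (ps ! Suc q) \<longrightarrow> snd (ps ! q))))"
proof (induction ps)
  case (Cons p ps)
  obtain a b where p: "p = (a, b)" by (cases p)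
  show ?case unfolding p using Cons
    by (cases ps) (auto simp: All_less_Suc2)
qed simp

text \<open>Read from the right: an end pair starts a new number 0, and a data pair doubles the
  number behind it and adds its bit. The condition on end pairs prevents doubling 0 with bit
  0.\<close>

lemma okp_ex: "okp ps \<Longrightarrow> \<exists>vs. ps = concat (map prs vs)"
proof (induction ps)
  case Nil
  show ?case by (intro exI[of _ "[]"]) simp
next
  case (Cons p ps)
  obtain a b where p: "p = (a, b)" by (cases p)
  obtain vs where vs: "ps = concat (map prs vs)" using Cons p by auto
  show ?case
  proof (cases a)
    case False
    then have "p # ps = concat (map prs (0 # vs))" using Cons.prems p vs by (simp add: prs_def)
    then show ?thesis by blast
  next
    case True
    then have ne: "ps \<noteq> []" "\<not> fst (hd ps) \<longrightarrow> b" using Cons.prems p by auto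
    then obtain v vs' where v: "vs = v # vs'" using vs by (cases vs) auto
    have "v = 0 \<longrightarrow> b" using ne vs v by (auto simp: prs_def)
    then have "0 < 2 * v + of_bool b" by auto
    then have "bits (2 * v + of_bool b) = b # bits v" by (subst bits_pos) auto
    then have "p # ps = concat (map prs ((2 * v + of_bool b) # vs'))"
      using p True vs v by (simp add: prs_def)
    then show ?thesis by blast
  qed
qed

lemma okp_prs: "okp ps \<Longrightarrow> okp (prs v @ ps)"
proof (induction v rule: less_induct)
  case (less v)
  show ?case
  proof (cases "v = 0")
    case True
    then show ?thesis using less by (simp add: prs_def)
  next
    case False
    then have p: "prs v = (True, odd v) # prs (v div 2)" by (simp add: prs_def bits_pos)
    have ne: "prs (v div 2) \<noteq> []" by (simp add: prs_def)
    have "odd v" if "\<not> fst (hd (prs (v div 2)))"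
    proof -
      have "v div 2 = 0"
        using that bits_pos[of "v div 2"] by (cases "v div 2 = 0") (auto simp: prs_def)
      then show ?thesis using False by presburger
    qed
    then show ?thesis unfolding p using less ne False by (auto simp: hd_append)
  qed
qed

lemma okp_concat: "okp (concat (map prs vs))"
  by (induction vs) (auto intro: okp_prs)

lemma bits_nth: "(if k < length (bits v) then bits v ! k else False) = odd (v div 2 ^ k)"
proof (induction k arbitrary: v)
  case 0
  then show ?case by (cases "v = 0") (auto simp: bits_pos)
next
  case (Suc k)
  have "v div 2 ^ Suc k = v div 2 div 2 ^ k" by (simp add: div_mult2_eq)
  then show ?case using Suc[of "v div 2"] by (cases "v = 0") (auto simp: bits_pos)
qed

lemma bits_bound: "v < 2 ^ length (bits v)"
proof (induction v rule: less_induct)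
  case (less v)
  show ?case
  proof (cases "v = 0")
    case False
    then have "v div 2 < 2 ^ length (bits (v div 2))" using less by simp
    then show ?thesis using False by (simp add: bits_pos)
  qed simp
qed

section \<open>Locating the numbers of an encoded instance\<close>

definition tcount :: "(bool \<times> bool) list \<Rightarrow> nat" where
  "tcount ps = length (filter (\<lambda>p. \<not> fst p) ps)"

lemma tcount_append [simp]: "tcount (ps @ qs) = tcount ps + tcount qs"
  by (simp add: tcount_def)

lemma tcount_Nil [simp]: "tcount [] = 0"
  by (simp add: tcount_def)

lemma tcount_data [simp]: "tcount (map (Pair True) l) = 0"
  by (simp add: tcount_def)

lemma tcount_prs [simp]: "tcount (prs v) = 1"
  unfolding prs_def by (simp add: tcount_def)

lemma tcount_concat [simp]: "tcount (concat (map prs vs)) = length vs"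
  by (induction vs) auto

lemma tcount_take_mono: "i \<le> j \<Longrightarrow> tcount (take i ps) \<le> tcount (take j ps)"
proof -
  assume "i \<le> j"
  then have "take i ps @ drop i (take j ps) = take j ps"
    using append_take_drop_id[of i "take j ps"] by (simp add: min_absorb1)
  then show ?thesis using tcount_append by (metis le_add1)
qed

lemma tcount_card: "q \<le> length ps \<Longrightarrow> card {i. i < q \<and> \<not> fst (ps ! i)} = tcount (take q ps)"
proof (induction q)
  case (Suc q)
  then show ?case by (simp add: card_less_Suc_if take_Suc_conv_app_nth) (simp add: tcount_def)
qed simp

definition tstart :: "nat list \<Rightarrow> nat \<Rightarrow> nat" where
  "tstart vs j = length (concat (map prs (take j vs)))"

lemma split_tok: "j < length vs \<Longrightarrow>
  concat (map prs vs) = concat (map prs (take j vs)) @ prs (vs ! j) @ concat (map prs (drop (Suc j) vs))"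
  by (metis concat_append id_take_nth_drop list.simps(9) concat.simps(2) map_append)

text \<open>The number of end pairs before a pair is the index of the number it belongs to; the
  verifier finds numbers by this count.\<close>

lemma tok_at:
  assumes "j < length vs" "k \<le> length (bits (vs ! j))"
  shows "tcount (take (tstart vs j + k) (concat (map prs vs))) = j"
    "tstart vs j + k < length (concat (map prs vs))"
    "concat (map prs vs) ! (tstart vs j + k) =
      (if k < length (bits (vs ! j)) then (True, bits (vs ! j) ! k) else (False, False))"
  unfolding split_tok[OF assms(1)] tstart_def
  using assms by (auto simp: prs_def nth_append take_map)

lemma tok_before:
  assumes "j < length vs" "q < tstart vs j"
  shows "tcount (take q (concat (map prs vs))) < j"
proof -
  obtain j' where j': "j = Suc j'" using assms by (cases j) (auto simp: tstart_def)
  have "take j vs = take j' vs @ [vs ! j']" using assms j' by (simp add: take_Suc_conv_app_nth)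
  then have "tstart vs j = tstart vs j' + length (bits (vs ! j')) + 1"
    by (simp add: tstart_def prs_def)
  then have "q \<le> tstart vs j' + length (bits (vs ! j'))" using assms by simp
  then have "tcount (take q (concat (map prs vs))) \<le> tcount (take (tstart vs j' + length (bits (vs ! j'))) (concat (map prs vs)))"
    by (rule tcount_take_mono)
  also have "\<dots> = j'" using assms j' by (intro tok_at) auto
  finally show ?thesis using j' by simp
qed

lemma tok_from: "j < length vs \<Longrightarrow> tstart vs j \<le> q \<Longrightarrow> j \<le> tcount (take q (concat (map prs vs)))"
  using tcount_take_mono[of "tstart vs j" q "concat (map prs vs)"] tok_at(1)[of j vs 0] by simp

subsection \<open>The verifier\<close>

text \<open>The separator 3 first occurs right behind the instance, so the instance is the longest
  prefix free of 3.\<close>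

definition tX where "tX = TCount TLen (TAll (TAdd (TVar 0) (TNum 1)) (TNot (TEq (TSym (TVar 0)) (TNum 3))))"
definition tH where "tH = TDiv tX (TNum 2)"
definition tTk where "tTk q = TCount q (TEq (TSym (TMul (TNum 2) (TVar 0))) (TNum 1))"
definition tSt where "tSt j = TCount tH (TLess (tTk (TVar 0)) (lift j 0))"
text \<open>The first conjunct checks that the pair still belongs to number \<open>j\<close>: bits
  beyond its end must read as 0, not as bits of a later number.\<close>

definition tBit where "tBit j k = TAnd (TEq (tTk (TAdd (tSt j) k)) j)
  (TAnd (TEq (TSym (TMul (TNum 2) (TAdd (tSt j) k))) (TNum 2))
        (TEq (TSym (TAdd (TMul (TNum 2) (TAdd (tSt j) k)) (TNum 1))) (TNum 2)))"
text \<open>Horner's rule from the top bit down. The number itself may be exponential, so it is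
  capped just above the length of the instance.\<close>

definition tCap where "tCap j = TLoop tH (TAdd tX (TNum 1)) (TNum 0)
  (TAdd (TMul (TNum 2) (TVar 0)) (tBit (lift (lift j 0) 0) (TSub (TSub tH (TNum 1)) (TVar 1))))"
definition tN where "tN = TDiv (TSub (tTk tH) (TNum 2)) (TNum 2)"
text \<open>Certificate entries are unary, as the number of ones in a row, so that every word is a
  certificate of some entries in range.\<close>

definition tRow where "tRow r = TCount tN (TEq (TSym (TAdd (TAdd tX (TNum 1))
  (TAdd (TMul (lift r 0) tN) (TVar 0)))) (TNum 2))"
definition tA where "tA s = tRow (TMul (TNum 2) s)"
definition tB where "tB s = tRow (TAdd (TMul (TNum 2) s) (TNum 1))"
definition tR where "tR s i = TLoop s tN i (TIf (TEq (TVar 0) (tB (TVar 1))) (tA (TVar 1)) (TVar 0))"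
definition tCol where "tCol s c k = TCount tN (TAnd (TEq (tR (lift s 0) (TVar 0)) (lift c 0))
  (tBit (TAdd (TNum 2) (TVar 0)) (lift k 0)))"
text \<open>A carry is at most the number of summands, hence within the cap \<open>tN\<close>,
  although the sum itself is exponential.\<close>

definition tCar where "tCar s c j = TLoop j tN (TNum 0)
  (TDiv (TAdd (TVar 0) (tCol (lift (lift s 0) 0) (lift (lift c 0) 0) (TVar 1))) (TNum 2))"
definition tSb where "tSb s c j = TMod (TAdd (tCar s c j) (tCol s c j)) (TNum 2)"
text \<open>Width of a citation count: \<open>tH\<close> bits for each summand and \<open>tN\<close>
  more for adding at most \<open>tN\<close> of them.\<close>

definition tJ where "tJ = TAdd tN tH"
definition tGt where "tGt s c d = TEx tJ (TAnd (TAnd (tSb (lift s 0) (lift c 0) (TVar 0))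
   (TNot (tSb (lift s 0) (lift d 0) (TVar 0))))
   (TAll tJ (TImp (TLess (TVar 1) (TVar 0))
      (TIff (tSb (lift (lift s 0) 0) (lift (lift c 0) 0) (TVar 0)) (tSb (lift (lift s 0) 0) (lift (lift d 0) 0) (TVar 0))))))"
definition tEqv where "tEqv s c d = TAll tJ (TIff (tSb (lift s 0) (lift c 0) (TVar 0)) (tSb (lift s 0) (lift d 0) (TVar 0)))"
definition tBef where "tBef s c d = TOr (tGt s c d) (TAnd (tEqv s c d) (TLess c d))"
definition tRk where "tRk s d = TCount tN (TAnd (TEq (tR (lift s 0) (TVar 0)) (TVar 0)) (tBef (lift s 0) (TVar 0) (lift d 0)))"
definition tLab where "tLab i j = TAll tH (TIff (tBit (TAdd (TAdd (TNum 2) tN) (lift i 0)) (TVar 0))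
   (tBit (TAdd (TAdd (TNum 2) tN) (lift j 0)) (TVar 0)))"
definition tIn where "tIn s a b i = TOr (TEq (tR s i) a) (TEq (tR s i) b)"
definition tLegal where "tLegal s a b = TAnd (TLess a b) (TAnd (TLess b tN) (TAnd (TEq (tR s a) a) (TAnd (TEq (tR s b) b)
  (TAnd (TEq (TDiv (tRk s a) (tCap (TNum 0))) (TDiv (tRk s b) (tCap (TNum 0))))
   (TAll tN (TAll tN (TImp
     (TAnd (tIn (lift (lift s 0) 0) (lift (lift a 0) 0) (lift (lift b 0) 0) (TVar 1))
       (tIn (lift (lift s 0) 0) (lift (lift a 0) 0) (lift (lift b 0) 0) (TVar 0)))
     (tLab (TVar 1) (TVar 0)))))))))"
definition tValid where "tValid = TAnd
   (TAll tN (TOr (TEq (tA (TVar 0)) (tB (TVar 0))) (tLegal (TVar 0) (tA (TVar 0)) (tB (TVar 0)))))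
   (TAll tN (TAll tN (TImp (tLab (TVar 1) (TVar 0)) (TEq (tR tN (TVar 1)) (tR tN (TVar 0))))))"
definition tEnc where "tEnc = TAnd (TEq (TMul (TNum 2) tH) tX)
   (TAll tH (TAnd (TImp (TEq (TSym (TMul (TNum 2) (TVar 0))) (TNum 1)) (TEq (TSym (TAdd (TMul (TNum 2) (TVar 0)) (TNum 1))) (TNum 1)))
      (TImp (TEq (TSym (TMul (TNum 2) (TVar 0))) (TNum 2))
        (TAnd (TLess (TAdd (TVar 0) (TNum 1)) tH)
          (TImp (TEq (TSym (TAdd (TMul (TNum 2) (TVar 0)) (TNum 2))) (TNum 1))
            (TEq (TSym (TAdd (TMul (TNum 2) (TVar 0)) (TNum 1))) (TNum 2)))))))"
text \<open>Comparing the capped second number with \<open>tN\<close> is exact, because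
  \<open>tN\<close> is at most the length of the instance and so below the cap.\<close>

definition tHead where "tHead = TAnd (TEq (tTk tH) (TAdd (TMul (TNum 2) tN) (TNum 2)))
   (TAnd (TLess (TNum 0) (tCap (TNum 0))) (TEq (tCap (TNum 1)) tN))"
definition tVer where "tVer = TAnd tEnc (TAnd tHead tValid)"

definition vword :: "bool list \<Rightarrow> bool list \<Rightarrow> nat list" where
  "vword x y = map sym x @ [3] @ map sym y"

lemma sym_simps [simp]: "sym b = 1 \<longleftrightarrow> \<not> b" "sym b = Suc 0 \<longleftrightarrow> \<not> b" "sym b = 2 \<longleftrightarrow> b" "sym b = 3 \<longleftrightarrow> False"
  by (auto simp: sym_def)

lemma wsym_vword:
  "i < length x \<Longrightarrow> wsym (vword x y) i = sym (x ! i)"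
  "wsym (vword x y) (length x) = 3"
  "wsym (vword x y) (Suc (length x + i)) = 2 \<longleftrightarrow> i < length y \<and> y ! i"
  by (auto simp: wsym_def vword_def nth_append)

lemma eval_tX [simp]: "eval (vword x y) tX e = length x"
proof -
  have "{i. i < length (vword x y) \<and> (\<forall>j<Suc i. wsym (vword x y) j \<noteq> 3)} = {..<length x}"
  proof (intro set_eqI iffI)
    fix i assume "i \<in> {i. i < length (vword x y) \<and> (\<forall>j<Suc i. wsym (vword x y) j \<noteq> 3)}"
    then show "i \<in> {..<length x}" using wsym_vword(2)[of x y] by (metis (mono_tags, lifting) lessThan_iff mem_Collect_eq not_less_eq)
  next
    fix i assume "i \<in> {..<length x}"
    then show "i \<in> {i. i < length (vword x y) \<and> (\<forall>j<Suc i. wsym (vword x y) j \<noteq> 3)}"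
      using wsym_vword(1)[of _ x y] by (auto simp: vword_def)
  qed
  then show ?thesis by (simp add: tX_def)
qed

lemma eval_tH [simp]: "eval (vword x y) tH e = length x div 2"
  by (simp add: tH_def)

lemma eval_tEnc:
  "0 < eval (vword x y) tEnc [] \<longleftrightarrow> (\<exists>vs. x = concat (map enc_nat vs))"
proof (cases "even (length x)")
  case False
  have "\<not> (\<exists>vs. x = concat (map enc_nat vs))" using False by (auto simp: encs_flat)
  moreover have "\<not> 0 < eval (vword x y) tEnc []"
    using False by (cases x) (auto simp: tEnc_def)
  ultimately show ?thesis by blast
next
  case True
  then obtain ps where x: "x = flat ps" using ex_flat by blast
  have e: "wsym (vword x y) (2 * q) = sym (fst (ps ! q))" "wsym (vword x y) (Suc (2 * q)) = sym (snd (ps ! q))"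
    if "q < length ps" for q
    using wsym_vword(1)[of "2 * q" x y] wsym_vword(1)[of "Suc (2 * q)" x y] nth_flat[OF that] that by (auto simp: x)
  have e2: "wsym (vword x y) (Suc (Suc (2 * q))) = sym (fst (ps ! Suc q))" if "Suc q < length ps" for q
    using e(1)[OF that] by simp
  have "0 < eval (vword x y) tEnc [] \<longleftrightarrow> okp ps"
    unfolding okp_nth using e e2 by (auto simp: tEnc_def x)
  also have "\<dots> \<longleftrightarrow> (\<exists>vs. ps = concat (map prs vs))" using okp_ex okp_concat by blast
  also have "\<dots> \<longleftrightarrow> (\<exists>vs. x = concat (map enc_nat vs))"
  proof -
    have "flat ps = flat qs \<Longrightarrow> ps = qs" for qs
    proof (induction ps arbitrary: qs)
      case Nil then show ?case by (cases qs) auto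
    next
      case (Cons p ps) then show ?case by (cases qs) (auto simp: prod_eq_iff)
    qed
    then show ?thesis unfolding encs_flat x by blast
  qed
  finally show ?thesis .
qed

section \<open>Addition and comparison by binary digits\<close>

lemma mod_Suc_pow2: "(f::nat) mod 2 ^ Suc j = f mod 2 ^ j + 2 ^ j * of_bool (odd (f div 2 ^ j))"
  using mod_mult2_eq[of f "2 ^ j" 2] by (simp add: mult.commute mod_2_eq_odd)

lemma sum_of_bool_card: "finite V \<Longrightarrow> (\<Sum>i\<in>V. of_bool (P i)) = card {i\<in>V. P i}"
  by (simp add: Collect_conj_eq Int_commute)

definition carry :: "(nat \<Rightarrow> nat) \<Rightarrow> nat set \<Rightarrow> nat \<Rightarrow> nat" where
  "carry f V j = (\<Sum>i\<in>V. f i mod 2 ^ j) div 2 ^ j"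

lemma carry_0 [simp]: "carry f V 0 = 0"
  by (simp add: carry_def)

text \<open>Passing from the lowest \<open>j\<close> columns to one more adds \<open>2 ^ j\<close>
  times the number of ones in column \<open>j\<close>.\<close>

lemma carry_Suc:
  assumes "finite V"
  shows "carry f V (Suc j) = (carry f V j + card {i\<in>V. odd (f i div 2 ^ j)}) div 2"
proof -
  have "(\<Sum>i\<in>V. f i mod 2 ^ Suc j) = (\<Sum>i\<in>V. f i mod 2 ^ j) + 2 ^ j * card {i\<in>V. odd (f i div 2 ^ j)}"
    using assms by (simp only: mod_Suc_pow2 sum.distrib sum_distrib_left[symmetric] sum_of_bool_card)
  then show ?thesis unfolding carry_def power_Suc2 div_mult2_eq by simp
qed

text \<open>The shifted sum is the sum of the shifted terms plus the carry; its parity sees only the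
  carry and the ones of column \<open>j\<close>.\<close>

lemma carry_odd:
  assumes "finite V"
  shows "odd (sum f V div 2 ^ j) \<longleftrightarrow> odd (carry f V j + card {i\<in>V. odd (f i div 2 ^ j)})"
proof -
  have "sum f V = (\<Sum>i\<in>V. 2 ^ j * (f i div 2 ^ j) + f i mod 2 ^ j)" by simp
  also have "\<dots> = 2 ^ j * (\<Sum>i\<in>V. f i div 2 ^ j) + (\<Sum>i\<in>V. f i mod 2 ^ j)"
    by (simp only: sum.distrib sum_distrib_left)
  finally have "sum f V div 2 ^ j = (\<Sum>i\<in>V. f i div 2 ^ j) + carry f V j"
    by (simp add: carry_def)
  moreover have "even (\<Sum>i\<in>V. g i) \<longleftrightarrow> even (card {i\<in>V. odd (g i)})" for g :: "nat \<Rightarrow> nat"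
    using even_sum_iff[OF assms, of g] by simp
  ultimately show ?thesis by auto
qed

lemma carry_le:
  assumes "finite V" shows "carry f V j \<le> card V"
proof -
  have "(\<Sum>i\<in>V. f i mod 2 ^ j) \<le> (\<Sum>i\<in>V. 2 ^ j)" by (intro sum_mono) (simp add: less_imp_le)
  then have "carry f V j \<le> (card V * 2 ^ j) div 2 ^ j"
    unfolding carry_def by (intro div_le_mono) simp
  then show ?thesis by simp
qed

lemma odd_bit: "odd ((a::nat) div 2 ^ k) = bit a k"
  by (simp add: bit_iff_odd)

lemma bit_bound: "(a::nat) < 2 ^ J \<Longrightarrow> J \<le> k \<Longrightarrow> \<not> bit a k"
proof -
  assume "a < 2 ^ J" "J \<le> k"
  then have "a < 2 ^ k" using power_increasing[of J k "2::nat"] by linarith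
  then show ?thesis by (simp add: bit_iff_odd)
qed

lemma bits_eq:
  assumes "(a::nat) < 2 ^ J" "b < 2 ^ J"
  shows "a = b \<longleftrightarrow> (\<forall>k<J. bit a k = bit b k)"
proof
  assume "\<forall>k<J. bit a k = bit b k"
  then show "a = b" using bit_bound assms by (intro bit_eqI) (metis not_le)
qed simp

lemma bits_gt_imp:
  assumes "(a::nat) < 2 ^ J" "b < 2 ^ J" "bit a k" "\<not> bit b k" "\<forall>k'<J. k < k' \<longrightarrow> bit a k' = bit b k'"
  shows "b < a"
proof -
  have "bit (a div 2 ^ Suc k) i = bit (b div 2 ^ Suc k) i" for i
  proof -
    have "bit a (Suc k + i) = bit b (Suc k + i)"
      using assms(5) bit_bound[OF assms(1)] bit_bound[OF assms(2)] by (cases "Suc k + i < J") auto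
    then show ?thesis by (simp only: bit_drop_bit_eq[unfolded drop_bit_eq_div, symmetric] drop_bit_eq_div[symmetric] bit_drop_bit_eq comp_def)
  qed
  then have e: "a div 2 ^ k div 2 = b div 2 ^ k div 2"
    by (intro bit_eqI) (simp add: div_mult2_eq power_Suc2 del: power_Suc)
  have "odd (a div 2 ^ k)" "even (b div 2 ^ k)" using assms(3,4) by (auto simp: bit_iff_odd)
  moreover have "q < p" if "odd p" "even q" "p div 2 = q div 2" for p q :: nat
    using that by presburger
  ultimately have "b div 2 ^ k < a div 2 ^ k" using e by blast
  then show ?thesis using div_le_mono[of a b "2 ^ k"] by linarith
qed

lemma bits_gt:
  assumes "(a::nat) < 2 ^ J" "b < 2 ^ J"
  shows "b < a \<longleftrightarrow> (\<exists>k<J. bit a k \<and> \<not> bit b k \<and> (\<forall>k'<J. k < k' \<longrightarrow> bit a k' = bit b k'))"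
proof
  assume ba: "b < a"
  define D where "D = {k. k < J \<and> bit a k \<noteq> bit b k}"
  have "D \<noteq> {}" using bits_eq[OF assms] ba by (auto simp: D_def)
  moreover have fin: "finite D" by (simp add: D_def)
  ultimately have m: "Max D \<in> D" by (rule Max_in[rotated])
  define K where "K = Max D"
  have K: "K < J" "bit a K \<noteq> bit b K"
    using m[folded K_def] unfolding D_def by auto
  have up: "\<forall>k'<J. K < k' \<longrightarrow> bit a k' = bit b k'"
  proof (intro allI impI)
    fix k' assume k': "k' < J" "K < k'"
    then have "k' \<notin> D" using Max_ge[OF fin, of k'] unfolding K_def by (meson not_le)
    then show "bit a k' = bit b k'" using k' unfolding D_def by blast
  qed
  have "bit a K"
  proof (rule ccontr)
    assume "\<not> bit a K"
    then have "a < b" using bits_gt_imp[OF assms(2,1), of K] K up by blast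
    then show False using ba by simp
  qed
  then show "\<exists>k<J. bit a k \<and> \<not> bit b k \<and> (\<forall>k'<J. k < k' \<longrightarrow> bit a k' = bit b k')"
    using K up by blast
qed (use bits_gt_imp[OF assms] in blast)

text \<open>Capping may be done at every step: once a prefix reaches the cap, doubling and adding a
  bit cannot bring it below again.\<close>

lemma horner:
  assumes "(v::nat) < 2 ^ h" "i \<le> h"
  shows "rec_nat 0 (\<lambda>i acc. min c (2 * acc + of_bool (odd (v div 2 ^ (h - Suc 0 - i))))) i = min c (v div 2 ^ (h - i))"
  using assms(2)
proof (induction i)
  case 0
  then show ?case using assms(1) by simp
next
  case (Suc i)
  have "h - i = Suc (h - Suc i)" using Suc.prems by simp
  then have "v div 2 ^ (h - i) = v div 2 ^ (h - Suc i) div 2" by (simp only: power_Suc2 div_mult2_eq)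
  moreover have "h - Suc 0 - i = h - Suc i" by simp
  moreover have "u = 2 * (u div 2) + of_bool (odd u)" for u :: nat by (metis mod_2_eq_odd mult_div_mod_eq)
  ultimately have V: "2 * (v div 2 ^ (h - i)) + of_bool (odd (v div 2 ^ (h - Suc 0 - i))) = v div 2 ^ (h - Suc i)" by metis
  have "min c (2 * min c U + b) = min c (2 * U + b)" for U b :: nat by (auto simp: min_def)
  from this[of "v div 2 ^ (h - i)" "of_bool (odd (v div 2 ^ (h - Suc 0 - i)))"]
  have "min c (2 * min c (v div 2 ^ (h - i)) + of_bool (odd (v div 2 ^ (h - Suc 0 - i)))) = min c (v div 2 ^ (h - Suc i))"
    unfolding V .
  then show ?case unfolding old.nat.simps(7) Suc.IH[OF Suc_leD[OF Suc.prems]] .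
qed

definition yrow :: "nat \<Rightarrow> bool list \<Rightarrow> nat \<Rightarrow> nat" where
  "yrow n y r = card {i. i < n \<and> r * n + i < length y \<and> y ! (r * n + i)}"

lemma yrow_le: "yrow n y r \<le> n"
  unfolding yrow_def by (rule card_less_le)

section \<open>Correctness of the verifier\<close>

locale enc_word =
  fixes x y :: "bool list" and vs :: "nat list"
  assumes x: "x = concat (map enc_nat vs)"
begin

abbreviation "w \<equiv> vword x y"
definition "ps = concat (map prs vs)"

lemma x_flat: "x = flat ps"
  by (simp add: x encs_flat ps_def)

lemma len_x: "length x div 2 = length ps"
  by (simp add: x_flat)

lemma w_ps:
  assumes "q < length ps"
  shows "wsym w (2 * q) = sym (fst (ps ! q))" "wsym w (Suc (2 * q)) = sym (snd (ps ! q))"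
  using wsym_vword(1)[of "2 * q" x y] wsym_vword(1)[of "Suc (2 * q)" x y] nth_flat[OF assms] assms
  by (auto simp: x_flat)

lemma eval_tTk: "eval w (tTk q) e = card {i. i < eval w q e \<and> wsym w (2 * i) = 1}"
  by (simp add: tTk_def)

lemma tTk_ps: "eval w q e \<le> length ps \<Longrightarrow> eval w (tTk q) e = tcount (take (eval w q e) ps)"
proof -
  assume q: "eval w q e \<le> length ps"
  then have "{i. i < eval w q e \<and> wsym w (2 * i) = 1} = {i. i < eval w q e \<and> \<not> fst (ps ! i)}"
    using w_ps(1) by auto
  then show ?thesis using tcount_card[OF q] by (simp add: eval_tTk)
qed

lemma tTk_mono: "eval w q e \<le> eval w q' e' \<Longrightarrow> eval w (tTk q) e \<le> eval w (tTk q') e'"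
  unfolding eval_tTk by (intro card_mono) auto

lemma eval_tSt:
  assumes "eval w j e < length vs"
  shows "eval w (tSt j) e = tstart vs (eval w j e)"
proof -
  have le: "tstart vs (eval w j e) \<le> length ps"
    using tok_at(2)[OF assms, of 0] by (simp add: ps_def)
  have "{q. q < length ps \<and> eval w (tTk (TVar 0)) (q # e) < eval w j e} = {..<tstart vs (eval w j e)}"
  proof (intro set_eqI iffI)
    fix q assume "q \<in> {q. q < length ps \<and> eval w (tTk (TVar 0)) (q # e) < eval w j e}"
    then have "tcount (take q ps) < eval w j e" using tTk_ps[of "TVar 0" "q # e"] by simp
    then show "q \<in> {..<tstart vs (eval w j e)}"
      using tok_from[OF assms, of q] by (auto simp: ps_def not_less[symmetric])
  next
    fix q assume q: "q \<in> {..<tstart vs (eval w j e)}"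
    then have "tcount (take q ps) < eval w j e" using tok_before[OF assms] by (simp add: ps_def)
    then show "q \<in> {q. q < length ps \<and> eval w (tTk (TVar 0)) (q # e) < eval w j e}"
      using tTk_ps[of "TVar 0" "q # e"] le q by simp
  qed
  then show ?thesis by (simp add: tSt_def len_x)
qed

lemma eval_tBit:
  assumes "eval w j e < length vs"
  shows "eval w (tBit j k) e = of_bool (odd (vs ! eval w j e div 2 ^ eval w k e))"
proof -
  let ?j = "eval w j e" and ?k = "eval w k e"
  let ?l = "length (bits (vs ! ?j))"
  note at = tok_at[OF assms, folded ps_def]
  show ?thesis
  proof (cases "?k \<le> ?l")
    case True
    have tk: "eval w (tTk (TAdd (tSt j) k)) e = ?j"
      using tTk_ps[of "TAdd (tSt j) k" e] at(1,2)[OF True] eval_tSt[OF assms] by simp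
    have "eval w (tBit j k) e = of_bool (?k < ?l \<and> bits (vs ! ?j) ! ?k)"
      using tk at(3)[OF True] w_ps[OF at(2)[OF True]] eval_tSt[OF assms] by (auto simp: tBit_def)
    then show ?thesis using bits_nth[of ?k "vs ! ?j"] by (auto split: if_splits)
  next
    \<comment> \<open>Past the end pair, at least \<open>?j + 1\<close> end pairs precede, so the
      conjunct on membership fails. Monotonicity of the count extends this to positions beyond the
      whole instance.\<close>
    case False
    have l: "tstart vs ?j + ?l < length ps" using at(2)[of ?l] by simp
    have "take (Suc (tstart vs ?j + ?l)) ps = take (tstart vs ?j + ?l) ps @ [(False, False)]"
      using at(3)[of ?l] l by (simp add: take_Suc_conv_app_nth)
    then have "tcount (take (Suc (tstart vs ?j + ?l)) ps) = Suc ?j"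
      using at(1)[of ?l] by (simp add: tcount_def)
    then have "eval w (tTk (TNum (Suc (tstart vs ?j + ?l)))) e = Suc ?j"
      using tTk_ps[of "TNum (Suc (tstart vs ?j + ?l))" e] l by simp
    moreover have "eval w (tTk (TNum (Suc (tstart vs ?j + ?l)))) e \<le> eval w (tTk (TAdd (tSt j) k)) e"
      using False eval_tSt[OF assms] by (intro tTk_mono) simp
    ultimately have "eval w (tTk (TAdd (tSt j) k)) e \<noteq> ?j" by simp
    then have "eval w (tBit j k) e = 0" by (simp add: tBit_def)
    then show ?thesis using bits_nth[of ?k "vs ! ?j"] False by auto
  qed
qed

lemma tok_bound:
  assumes "j < length vs" shows "vs ! j < 2 ^ length ps"
proof -
  have "length (bits (vs ! j)) \<le> length ps" using tok_at(2)[OF assms order_refl] by (simp add: ps_def)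
  then show ?thesis using bits_bound[of "vs ! j"] power_increasing[of "length (bits (vs ! j))" "length ps" "2::nat"]
    by linarith
qed

lemma eval_tCap:
  assumes "eval w j e < length vs"
  shows "eval w (tCap j) e = min (Suc (length x)) (vs ! eval w j e)"
proof -
  have "eval w (tBit (lift (lift j 0) 0) (TSub (TSub tH (TNum 1)) (TVar 1))) (a # i # e) =
      of_bool (odd (vs ! eval w j e div 2 ^ (length ps - Suc 0 - i)))" for a i
    using eval_tBit[of "lift (lift j 0) 0" "a # i # e"] assms by (simp add: len_x)
  then show ?thesis
    using horner[OF tok_bound[OF assms] order_refl, of "Suc (length x)"] by (simp add: tCap_def len_x)
qed

lemma eval_tN: "eval w tN e = (length vs - 2) div 2"
  using tTk_ps[of tH e] by (simp add: tN_def len_x) (simp add: ps_def)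

lemma eval_tHead:
  "0 < eval w tHead [] \<longleftrightarrow> (\<exists>p cs ls. x = enc_inst p cs ls \<and> 0 < p \<and> length ls = length cs)"
proof
  assume a: "0 < eval w tHead []"
  define n where "n = (length vs - 2) div 2"
  have "eval w (tTk tH) [] = length vs" using tTk_ps[of tH "[]"] by (simp add: len_x) (simp add: ps_def)
  then have l: "length vs = 2 * n + 2" using a by (simp add: tHead_def eval_tN n_def)
  then obtain p m vs' where vs: "vs = p # m # vs'" by (cases vs; cases "tl vs") auto
  have "0 < p" "min (Suc (length x)) m = n"
    using a l eval_tCap[of "TNum 0" "[]"] eval_tCap[of "TNum 1" "[]"]
    by (auto simp: tHead_def eval_tN n_def[symmetric] vs)
  moreover have "n \<le> length x"
  proof -
    have "length vs \<le> length ps" using tcount_concat[of vs] length_filter_le[of _ ps] by (metis ps_def tcount_def)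
    then show ?thesis using l len_x by linarith
  qed
  ultimately have "m = n" by (simp add: min_def split: if_splits)
  then have "x = enc_inst p (take n vs') (drop n vs')"
    using l vs by (simp add: x enc_inst_def map_append[symmetric] concat_append[symmetric] del: map_append concat_append)
  then show "\<exists>p cs ls. x = enc_inst p cs ls \<and> 0 < p \<and> length ls = length cs"
    using l vs \<open>0 < p\<close> by (intro exI[of _ p] exI[of _ "take n vs'"] exI[of _ "drop n vs'"]) auto
next
  assume "\<exists>p cs ls. x = enc_inst p cs ls \<and> 0 < p \<and> length ls = length cs"
  then obtain p cs ls where p: "x = enc_inst p cs ls" "0 < p" "length ls = length cs" by blast
  interpret E: enc_word x y "p # length cs # cs @ ls"
    by unfold_locales (simp add: p enc_inst_def)
  have "length cs \<le> length x"
  proof -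
    have "length (p # length cs # cs @ ls) \<le> length E.ps"
      using tcount_concat[of "p # length cs # cs @ ls"] length_filter_le[of _ E.ps] by (metis E.ps_def tcount_def)
    then show ?thesis using E.len_x by simp
  qed
  moreover have "eval w (tTk tH) [] = 2 * length cs + 2"
    using E.tTk_ps[of tH "[]"] p(3) tcount_concat[of "p # length cs # cs @ ls", folded E.ps_def] by (simp add: E.len_x)
  moreover have "eval w tN [] = length cs" using E.eval_tN[of "[]"] p(3) by simp
  ultimately show "0 < eval w tHead []"
    using E.eval_tCap[of "TNum 0" "[]"] E.eval_tCap[of "TNum 1" "[]"] p by (simp add: tHead_def)
qed

end

locale inst_word =
  fixes x y :: "bool list" and p :: nat and cs ls :: "nat list"
  assumes x: "x = enc_inst p cs ls" and p: "0 < p" and len: "length ls = length cs"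

sublocale inst_word \<subseteq> enc_word x y "p # length cs # cs @ ls"
  by unfold_locales (simp add: x enc_inst_def)

context inst_word
begin

abbreviation "n \<equiv> length cs"
abbreviation "vs \<equiv> p # n # cs @ ls"

definition "ra \<sigma> = yrow n y (2 * \<sigma>)"
definition "rb \<sigma> = yrow n y (2 * \<sigma> + 1)"

lemma N [simp]: "eval w tN e = n"
  using eval_tN[of e] len by simp

lemma n_le: "n \<le> length ps"
proof -
  have "length vs \<le> length ps"
    using tcount_concat[of vs] length_filter_le[of _ ps] by (metis ps_def tcount_def)
  then show ?thesis by simp
qed

lemma eval_tRow: "eval w (tRow r) e = yrow n y (eval w r e)"
proof -
  have "wsym w (Suc (length x + k)) = 2 \<longleftrightarrow> k < length y \<and> y ! k" for k
    by (rule wsym_vword)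
  then show ?thesis by (simp add: tRow_def yrow_def)
qed

lemma eval_tA [simp]: "eval w (tA s) e = ra (eval w s e)"
  by (simp add: tA_def eval_tRow ra_def)

lemma eval_tB [simp]: "eval w (tB s) e = rb (eval w s e)"
  by (simp add: tB_def eval_tRow rb_def)

abbreviation "R \<equiv> rt ra rb"

lemma ra_le: "ra \<sigma> \<le> n" and rb_le: "rb \<sigma> \<le> n"
  by (simp_all add: ra_def rb_def yrow_le)

lemma R_le: "i \<le> n \<Longrightarrow> R s i \<le> n"
  by (induction s) (auto simp: ra_le)

lemma eval_tR [simp]: "eval w i e \<le> n \<Longrightarrow> eval w (tR s i) e = R (eval w s e) (eval w i e)"
proof -
  assume i: "eval w i e \<le> n"
  have "rec_nat (eval w i e) (\<lambda>k a. min n (if a = rb k then ra k else a)) m = R m (eval w i e)" for m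
    using R_le[OF i] by (induction m) (auto simp: min_absorb2 ra_le)
  then show ?thesis by (simp add: tR_def cong: if_cong)
qed

abbreviation "V s c \<equiv> cls n (R s) c"
abbreviation "G s c \<equiv> gs_count cs (V s c)"

lemma finite_V [simp]: "finite (V s c)"
  by (simp add: cls_def)

lemma cs_nth: "i < n \<Longrightarrow> vs ! (2 + i) = cs ! i" and ls_nth: "i < n \<Longrightarrow> vs ! (2 + n + i) = ls ! i"
  by (simp_all add: nth_append)

lemma eval_cs_bit: "eval w j e < n \<Longrightarrow> eval w (tBit (TAdd (TNum 2) j) k) e = of_bool (odd (cs ! eval w j e div 2 ^ eval w k e))"
  using eval_tBit[of "TAdd (TNum 2) j" e k] cs_nth[of "eval w j e"] by simp

lemma eval_ls_bit: "eval w j e < n \<Longrightarrow>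
    eval w (tBit (TAdd (TAdd (TNum 2) tN) j) k) e = of_bool (odd (ls ! eval w j e div 2 ^ eval w k e))"
  using eval_tBit[of "TAdd (TAdd (TNum 2) tN) j" e k] ls_nth[of "eval w j e"] len by simp

lemma eval_tCol [simp]:
  "eval w (tCol s c k) e = card {i \<in> V (eval w s e) (eval w c e). odd (cs ! i div 2 ^ eval w k e)}"
proof -
  have "{i. i < n \<and> 0 < eval w (TAnd (TEq (tR (lift s 0) (TVar 0)) (lift c 0))
      (tBit (TAdd (TNum 2) (TVar 0)) (lift k 0))) (i # e)}
    = {i \<in> V (eval w s e) (eval w c e). odd (cs ! i div 2 ^ eval w k e)}"
    by (auto simp: cls_def eval_cs_bit)
  then show ?thesis by (simp only: tCol_def eval_TCount N)
qed

lemma eval_tCar [simp]: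
  "eval w (tCar s c j) e = carry ((!) cs) (V (eval w s e) (eval w c e)) (eval w j e)"
proof -
  let ?V = "V (eval w s e) (eval w c e)"
  have "card ?V \<le> card {..<n}" by (rule card_mono) (auto simp: cls_def)
  then have le: "carry ((!) cs) ?V m \<le> n" for m
    using carry_le[of ?V "(!) cs" m] by simp
  have "rec_nat 0 (\<lambda>i a. min n ((a + card {i' \<in> ?V. odd (cs ! i' div 2 ^ i)}) div 2)) m
     = carry ((!) cs) ?V m" for m
  proof (induction m)
    case (Suc m)
    then show ?case using le[of "Suc m"] carry_Suc[of ?V "(!) cs" m] by simp
  qed simp
  then show ?thesis by (simp add: tCar_def)
qed

lemma eval_tSb [simp]: "eval w (tSb s c j) e = of_bool (bit (G (eval w s e) (eval w c e)) (eval w j e))"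
  using carry_odd[of "V (eval w s e) (eval w c e)" "(!) cs" "eval w j e"]
  by (simp add: tSb_def gs_count_def odd_bit[symmetric] mod_2_eq_odd)

lemma G_bound: "G s c < 2 ^ (n + length ps)"
proof -
  have "cs ! i \<le> 2 ^ length ps" if "i \<in> V s c" for i
    using tok_bound[of "2 + i"] cs_nth[of i] that by (simp add: cls_def)
  then have "G s c \<le> card (V s c) * 2 ^ length ps"
    unfolding gs_count_def using sum_bounded_above[of "V s c" "(!) cs"] by simp
  also have "card (V s c) \<le> card {..<n}" by (rule card_mono) (auto simp: cls_def)
  then have "card (V s c) * 2 ^ length ps \<le> n * 2 ^ length ps" by simp
  also have "\<dots> < 2 ^ n * 2 ^ length ps" by (simp add: less_exp)
  finally show ?thesis by (simp add: power_add)
qed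

lemma eval_tJ [simp]: "eval w tJ e = n + length ps"
  by (simp add: tJ_def len_x)

lemma eval_tGt [simp]: "eval w (tGt s c d) e =
    of_bool (G (eval w s e) (eval w d e) < G (eval w s e) (eval w c e))"
  unfolding bits_gt[OF G_bound G_bound] by (simp add: tGt_def)

lemma eval_tEqv [simp]: "eval w (tEqv s c d) e =
    of_bool (G (eval w s e) (eval w c e) = G (eval w s e) (eval w d e))"
  unfolding bits_eq[OF G_bound G_bound] by (simp add: tEqv_def)

lemma eval_tBef [simp]: "eval w (tBef s c d) e = of_bool (bef cs (R (eval w s e)) (eval w c e) (eval w d e))"
  by (simp add: tBef_def bef_def)

lemma eval_tRk [simp]: "eval w (tRk s d) e = rk cs (R (eval w s e)) (eval w d e)"
proof -
  have "{i. i < n \<and> 0 < eval w (TAnd (TEq (tR (lift s 0) (TVar 0)) (TVar 0)) (tBef (lift s 0) (TVar 0) (lift d 0))) (i # e)}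
    = {c. c < n \<and> R (eval w s e) c = c \<and> bef cs (R (eval w s e)) c (eval w d e)}"
    by auto
  then show ?thesis by (simp only: tRk_def eval_TCount N rk_def)
qed

lemma eval_tLab [simp]:
  assumes "eval w i e < n" "eval w j e < n"
  shows "eval w (tLab i j) e = of_bool (ls ! eval w i e = ls ! eval w j e)"
proof -
  have b: "ls ! k < 2 ^ length ps" if "k < n" for k
    using tok_bound[of "2 + n + k"] ls_nth[OF that] that len by simp
  show ?thesis
    unfolding bits_eq[OF b[OF assms(1)] b[OF assms(2)]]
    using assms by (simp add: tLab_def eval_ls_bit len_x odd_bit)
qed

lemma rk_less: "d < n \<Longrightarrow> rk cs r d < n"
proof -
  assume d: "d < n"
  have "{c. c < n \<and> r c = c \<and> bef cs r c d} \<subset> {..<n}"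
    using d by (auto simp: bef_def)
  then have "rk cs r d < card {..<n}" unfolding rk_def by (intro psubset_card_mono) auto
  then show ?thesis by simp
qed

text \<open>Ranks are below \<open>n \<le> length x\<close>; under a page size above
  \<open>length x\<close> all of them are on page 0, capped or not.\<close>

lemma page_cap:
  assumes "a < n" "b < n"
  shows "a div min (Suc (length x)) p = b div min (Suc (length x)) p \<longleftrightarrow> a div p = b div p"
proof -
  have "n \<le> length x" using n_le len_x by linarith
  then show ?thesis using assms by (cases "p \<le> Suc (length x)") (auto simp: min_def)
qed

lemma eval_tIn [simp]: "eval w i e \<le> n \<Longrightarrow> eval w (tIn s a b i) e =
   of_bool (R (eval w s e) (eval w i e) = eval w a e \<or> R (eval w s e) (eval w i e) = eval w b e)"
  by (simp add: tIn_def)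

lemma eval_tLegal: "eval w (tLegal s a b) e = of_bool (legal p cs ls (R (eval w s e)) (eval w a e) (eval w b e))"
proof (cases "eval w a e < eval w b e \<and> eval w b e < n")
  case False
  then show ?thesis by (auto simp: tLegal_def legal_def)
next
  case True
  let ?s = "eval w s e" and ?a = "eval w a e" and ?b = "eval w b e"
  have ab: "?a < n" "?b < n" "?a \<le> n" "?b \<le> n" using True by auto
  have cap: "eval w (tCap (TNum 0)) e = min (Suc (length x)) p"
    using eval_tCap[of "TNum 0" e] by simp
  have pg: "rk cs (R ?s) ?a div min (Suc (length x)) p = rk cs (R ?s) ?b div min (Suc (length x)) p
      \<longleftrightarrow> rk cs (R ?s) ?a div p = rk cs (R ?s) ?b div p"
    by (rule page_cap) (use ab rk_less in auto)
  have lab: "0 < eval w (TAll tN (TAll tN (TImp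
     (TAnd (tIn (lift (lift s 0) 0) (lift (lift a 0) 0) (lift (lift b 0) 0) (TVar 1))
       (tIn (lift (lift s 0) 0) (lift (lift a 0) 0) (lift (lift b 0) 0) (TVar 0)))
     (tLab (TVar 1) (TVar 0))))) e \<longleftrightarrow>
    (\<forall>i<n. \<forall>j<n. (R ?s i = ?a \<or> R ?s i = ?b) \<and> (R ?s j = ?a \<or> R ?s j = ?b) \<longrightarrow> ls ! i = ls ! j)"
    by simp blast
  have "0 < eval w (tLegal s a b) e \<longleftrightarrow> legal p cs ls (R ?s) ?a ?b"
    unfolding tLegal_def legal_def eval_TAnd lab zero_less_of_bool_iff
    using ab True p cap pg by simp
  moreover have "eval w (tLegal s a b) e \<in> {0, 1}" by (auto simp: tLegal_def)
  ultimately show ?thesis by auto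
qed

lemma eval_tValid: "0 < eval w tValid [] \<longleftrightarrow> valid p cs ls ra rb"
  by (simp add: tValid_def valid_def eval_tLegal) blast

end

text \<open>Row \<open>2 * \<sigma>\<close> consists of \<open>a \<sigma>\<close> ones followed by
  zeros, the next row of \<open>b \<sigma>\<close> ones followed by zeros.\<close>

lemma ex_rows:
  assumes "\<And>\<sigma>. a \<sigma> \<le> n \<and> b \<sigma> \<le> n"
  shows "\<exists>y. length y = 2 * n * n \<and> (\<forall>\<sigma><n. yrow n y (2 * \<sigma>) = a \<sigma> \<and> yrow n y (2 * \<sigma> + 1) = b \<sigma>)"
proof -
  define g where "g r = (if even r then a (r div 2) else b (r div 2))" for r
  define y where "y = map (\<lambda>i. i mod n < g (i div n)) [0..<2 * n * n]"
  have "yrow n y r = g r" if r: "r < 2 * n" for r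
  proof -
    have "r * n + i < 2 * n * n" if "i < n" for i
    proof -
      have "r * n + i < Suc r * n" using that by simp
      also have "\<dots> \<le> 2 * n * n" using r by (intro mult_le_mono1) simp
      finally show ?thesis .
    qed
    then have "{i. i < n \<and> r * n + i < length y \<and> y ! (r * n + i)} = {i. i < n \<and> i < g r}"
      by (auto simp: y_def)
    also have "\<dots> = {..<g r}" using assms by (auto simp: g_def intro: less_le_trans)
    finally show ?thesis by (simp add: yrow_def)
  qed
  moreover have "g (2 * \<sigma>) = a \<sigma>" "g (2 * \<sigma> + 1) = b \<sigma>" for \<sigma> by (simp_all add: g_def)
  ultimately show ?thesis by (intro exI[of _ y]) (auto simp: y_def)
qed

lemma valid_cong:
  assumes "\<And>\<sigma>. \<sigma> < length cs \<Longrightarrow> a \<sigma> = a' \<sigma> \<and> b \<sigma> = b' \<sigma>"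
  shows "valid p cs ls a b \<longleftrightarrow> valid p cs ls a' b'"
proof -
  have "rt a b \<tau> = rt a' b' \<tau>" if "\<tau> \<le> length cs" for \<tau>
    by (rule ext, rule rt_cong) (use assms that in auto)
  then show ?thesis unfolding valid_def using assms by simp
qed

lemma enc_inst_inj_len: "length cs \<le> length (enc_inst p cs ls)"
proof -
  have "length cs \<le> length (concat (map enc_nat cs))" by (induction cs) (auto simp: enc_nat_def)
  then show ?thesis by (simp add: enc_inst_def)
qed

theorem GSMP_in_NP: "in_NP GSMP"
proof -
  obtain Q G \<delta> where \<delta>: "tm_wf Q G \<delta>" "poly_time_tm \<delta>" "\<And>w. wordb w \<Longrightarrow> tm_accepts \<delta> w \<longleftrightarrow> 0 < eval w tVer []"
    using trm_decider[of tVer] by blast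
  have wb: "wordb (vword x y)" for x y
    by (auto simp: wordb_def vword_def sym_def)
  have ver: "0 < eval (vword x y) tVer [] \<longleftrightarrow>
     (\<exists>p cs ls. x = enc_inst p cs ls \<and> 0 < p \<and> length ls = length cs \<and> 
        valid p cs ls (\<lambda>\<sigma>. yrow (length cs) y (2 * \<sigma>)) (\<lambda>\<sigma>. yrow (length cs) y (2 * \<sigma> + 1)))" for x y
  proof
    assume a: "0 < eval (vword x y) tVer []"
    then obtain vs where "x = concat (map enc_nat vs)" using eval_tEnc[of x y] by (auto simp: tVer_def)
    then interpret enc_word x y vs by unfold_locales
    obtain p cs ls where pc: "x = enc_inst p cs ls" "0 < p" "length ls = length cs"
      using a eval_tHead by (auto simp: tVer_def)
    then interpret I: inst_word x y p cs ls by unfold_locales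
    have "valid p cs ls I.ra I.rb" using a I.eval_tValid by (auto simp: tVer_def)
    then show "\<exists>p cs ls. x = enc_inst p cs ls \<and> 0 < p \<and> length ls = length cs \<and> 
        valid p cs ls (\<lambda>\<sigma>. yrow (length cs) y (2 * \<sigma>)) (\<lambda>\<sigma>. yrow (length cs) y (2 * \<sigma> + 1))"
      using pc unfolding I.ra_def[abs_def] I.rb_def[abs_def] by blast
  next
    assume "\<exists>p cs ls. x = enc_inst p cs ls \<and> 0 < p \<and> length ls = length cs \<and> 
        valid p cs ls (\<lambda>\<sigma>. yrow (length cs) y (2 * \<sigma>)) (\<lambda>\<sigma>. yrow (length cs) y (2 * \<sigma> + 1))"
    then obtain p cs ls where pc: "x = enc_inst p cs ls" "0 < p" "length ls = length cs" and
        v: "valid p cs ls (\<lambda>\<sigma>. yrow (length cs) y (2 * \<sigma>)) (\<lambda>\<sigma>. yrow (length cs) y (2 * \<sigma> + 1))" by blast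
    then interpret I: inst_word x y p cs ls by unfold_locales
    have "0 < eval (vword x y) tValid []" using v I.eval_tValid unfolding I.ra_def[abs_def] I.rb_def[abs_def] by blast
    moreover have "0 < eval (vword x y) tEnc []" using eval_tEnc I.enc_word_axioms unfolding enc_word_def by blast
    moreover have "0 < eval (vword x y) tHead []" using I.eval_tHead pc by blast
    ultimately show "0 < eval (vword x y) tVer []" by (simp add: tVer_def)
  qed
  have "x \<in> GSMP \<longleftrightarrow> (\<exists>y. length y \<le> 2 * (length x + 1) ^ 2 \<and> tm_accepts \<delta> (map sym x @ [3] @ map sym y))" for x
  proof
    assume "x \<in> GSMP"
    then obtain p cs ls where pc: "x = enc_inst p cs ls" "0 < p" "length ls = length cs" "gs_yes p cs ls"
      unfolding GSMP_def by blast
    obtain a b where ab: "\<And>\<sigma>. a \<sigma> \<le> length cs \<and> b \<sigma> \<le> length cs" "valid p cs ls a b"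
      using pc(4) unfolding gs_yes_iff_valid by blast
    obtain y where y: "length y = 2 * length cs * length cs"
      "\<forall>\<sigma><length cs. yrow (length cs) y (2 * \<sigma>) = a \<sigma> \<and> yrow (length cs) y (2 * \<sigma> + 1) = b \<sigma>"
      using ex_rows[of a "length cs" b] ab(1) by blast
    have "valid p cs ls (\<lambda>\<sigma>. yrow (length cs) y (2 * \<sigma>)) (\<lambda>\<sigma>. yrow (length cs) y (2 * \<sigma> + 1))"
      using ab(2) by (subst valid_cong[of cs _ a _ b]) (use y(2) in auto)
    then have "0 < eval (vword x y) tVer []" unfolding ver using pc by blast
    moreover have "length y \<le> 2 * (length x + 1) ^ 2"
    proof -
      have "length cs * length cs \<le> (length x + 1) * (length x + 1)"
        using enc_inst_inj_len[of cs p ls] pc(1) by (intro mult_le_mono) auto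
      then show ?thesis by (simp add: y(1) power2_eq_square)
    qed
    ultimately show "\<exists>y. length y \<le> 2 * (length x + 1) ^ 2 \<and> tm_accepts \<delta> (map sym x @ [3] @ map sym y)"
      using \<delta>(3)[OF wb] unfolding vword_def by blast
  next
    assume "\<exists>y. length y \<le> 2 * (length x + 1) ^ 2 \<and> tm_accepts \<delta> (map sym x @ [3] @ map sym y)"
    then obtain y where "0 < eval (vword x y) tVer []" using \<delta>(3)[OF wb] unfolding vword_def by blast
    then obtain p cs ls where pc: "x = enc_inst p cs ls" "0 < p" "length ls = length cs"
      and v: "valid p cs ls (\<lambda>\<sigma>. yrow (length cs) y (2 * \<sigma>)) (\<lambda>\<sigma>. yrow (length cs) y (2 * \<sigma> + 1))"
      unfolding ver by blast
    have "gs_yes p cs ls" unfolding gs_yes_iff_valid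
      by (rule exI, rule exI, rule conjI[OF _ v]) (simp add: yrow_le)
    then show "x \<in> GSMP" unfolding GSMP_def using pc by blast
  qed
  then show ?thesis unfolding in_NP_def using \<delta>(1,2)
    by (intro exI[of _ Q] exI[of _ G] exI[of _ \<delta>] exI[of _ 2]) simp
qed

section \<open>From subset sums to merging\<close>

locale gadget =
  fixes p m T :: nat and c l :: "nat \<Rightarrow> nat"
  assumes mp: "m < p" and m1: "1 \<le> m" and T2: "2 \<le> T"
    and c_hi: "\<And>i. i < p - 1 \<Longrightarrow> c i = Suc T"
    and c_mid: "\<And>i. p - 1 \<le> i \<Longrightarrow> i \<le> p \<Longrightarrow> c i = T"
    and c_item: "\<And>i. p < i \<Longrightarrow> i \<le> p + m \<Longrightarrow> 0 < c i \<and> c i < T"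
    and c_lo: "\<And>i. p + m < i \<Longrightarrow> c i = T"
    and l_def: "\<And>i. l i = (if p \<le> i \<and> i \<le> p + m then 0 else Suc i)"
begin

definition "N = 2 * p + m"
definition "cs = map c [0..<N]"
definition "ls = map l [0..<N]"
definition "X = {p..p + m}"
definition "F = {..<N} - X"

text \<open>Fillers have labels of their own and therefore stay singletons throughout.\<close>

definition inv :: "nat set set \<Rightarrow> bool" where
  "inv S \<longleftrightarrow> finite S \<and> (\<forall>V\<in>S. \<forall>W\<in>S. V \<noteq> W \<longrightarrow> V \<inter> W = {}) \<and> (\<forall>i\<in>F. {i} \<in> S) \<and>
     (\<forall>V\<in>S. (\<exists>i\<in>F. V = {i}) \<or> V \<noteq> {} \<and> V \<subseteq> X)"

abbreviation "step \<equiv> gs_merge_step p cs ls"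

lemma inv_disj: "inv S \<Longrightarrow> A \<in> S \<Longrightarrow> B \<in> S \<Longrightarrow> A \<noteq> B \<Longrightarrow> A \<inter> B = {}"
  unfolding inv_def by blast

lemma inv_F: "inv S \<Longrightarrow> i \<in> F \<Longrightarrow> {i} \<in> S"
  unfolding inv_def by blast

lemma XN: "X \<subseteq> {..<N}"
  using mp by (auto simp: X_def N_def)

lemma count: "V \<subseteq> {..<N} \<Longrightarrow> gs_count cs V = sum c V"
  unfolding gs_count_def by (intro sum.cong) (auto simp: cs_def)

lemma count_X: "V \<subseteq> X \<Longrightarrow> gs_count cs V = sum c V"
  using count XN by blast

lemma count_F: "i \<in> F \<Longrightarrow> gs_count cs {i} = c i"
  by (simp add: count F_def)

lemma label: "i < N \<Longrightarrow> ls ! i = l i"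
  by (simp add: ls_def)

lemma F_cases: "i \<in> F \<longleftrightarrow> i < p \<or> (p + m < i \<and> i < N)"
  by (auto simp: F_def X_def N_def)

text \<open>Disjoint nonempty subsets of \<open>X\<close> have distinct minima.\<close>

lemma card_Xsets:
  assumes "inv S" shows "card {V \<in> S. V \<subseteq> X} \<le> Suc m"
proof -
  let ?A = "{V \<in> S. V \<subseteq> X}"
  have ne: "V \<noteq> {}" if "V \<in> ?A" for V using assms that unfolding inv_def by blast
  have mem: "Min V \<in> V" if "V \<in> ?A" for V
    using ne[OF that] that finite_subset[of V X] by (intro Min_in) (auto simp: X_def)
  have "inj_on Min ?A"
  proof (rule inj_onI)
    fix V W assume VW: "V \<in> ?A" "W \<in> ?A" "Min V = Min W"
    then have "Min V \<in> V \<inter> W" using mem[OF VW(1)] mem[OF VW(2)] by simp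
    then show "V = W" using VW assms unfolding inv_def by blast
  qed
  moreover have "Min ` ?A \<subseteq> X" using mem by blast
  ultimately have "card ?A \<le> card X" by (intro card_inj_on_le[of Min]) (auto simp: X_def)
  then show ?thesis by (simp add: X_def)
qed

lemma before_F:
  assumes "V \<subseteq> X" "V \<noteq> {}" "i \<in> F"
  shows "gs_before cs {i} V \<longleftrightarrow> sum c V < c i \<or> (sum c V = c i \<and> i < Min V)"
  using assms by (auto simp: gs_before_def count_X count_F)

lemma Min_X:
  assumes "V \<subseteq> X" "V \<noteq> {}" shows "p \<le> Min V" "Min V \<le> p + m"
proof -
  have "Min V \<in> V" using assms finite_subset[of V X] by (intro Min_in) (auto simp: X_def)
  then show "p \<le> Min V" "Min V \<le> p + m" using assms by (auto simp: X_def)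
qed

lemma not_before_self: "\<not> gs_before cs V V"
  by (simp add: gs_before_def)

lemma page:
  assumes S: "inv S" and V: "V \<in> S" "V \<subseteq> X"
  shows "Suc T < sum c V \<Longrightarrow> gs_rank cs S V div p = 0"
    and "sum c V = T \<Longrightarrow> gs_rank cs S V div p = 1"
    and "sum c V < T \<Longrightarrow> U \<in> S \<Longrightarrow> U \<subseteq> X \<Longrightarrow> T \<le> sum c U \<Longrightarrow> gs_rank cs S V div p = 2"
proof -
  let ?B = "{W \<in> S. gs_before cs W V}"
  let ?XS = "{V \<in> S. V \<subseteq> X}"
  have fin: "finite S" using S unfolding inv_def by blast
  have ne: "V \<noteq> {}" using S V unfolding inv_def F_def by blast
  have Fin: "{i} \<in> S" if "i \<in> F" for i using S that unfolding inv_def by blast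
  have cases: "(\<exists>i\<in>F. W = {i}) \<or> W \<in> ?XS" if "W \<in> S" for W using S that unfolding inv_def by blast
  have cXS: "card (?XS - {V}) \<le> m"
    using card_Xsets[OF S] V fin by (simp add: card_Diff_singleton)
  have fXS: "finite (?XS - {V})" using fin by simp
  { assume g: "Suc T < sum c V"
    have "c i \<le> Suc T" if "i \<in> F" for i
      using that c_hi[of i] c_mid[of i] c_lo[of i] unfolding F_cases by (cases "i < p - 1"; cases "i < p") auto
    then have "?B \<subseteq> ?XS - {V}"
      using cases before_F[OF V(2) ne] not_before_self g by fastforce
    then have "card ?B \<le> m" using card_mono[OF fXS] cXS by (meson order_trans)
    then show "gs_rank cs S V div p = 0" using mp by (simp add: gs_rank_def)
  }
  { assume g: "sum c V = T"
    have sub: "(\<lambda>i. {i}) ` {..<p} \<subseteq> ?B"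
    proof
      fix W assume "W \<in> (\<lambda>i. {i}) ` {..<p}"
      then obtain i where i: "W = {i}" "i < p" by auto
      then have "i \<in> F" by (simp add: F_cases)
      moreover have "c i = Suc T \<or> c i = T" using c_hi[of i] c_mid[of i] i by (cases "i < p - 1") auto
      ultimately show "W \<in> ?B"
        using before_F[OF V(2) ne] g i Min_X(1)[OF V(2) ne] Fin by auto
    qed
    have "card ((\<lambda>i. {i}) ` {..<p}) = p" by (subst card_image) auto
    then have 1: "p \<le> card ?B" using card_mono[OF _ sub] fin by simp
    have "?B \<subseteq> (\<lambda>i. {i}) ` {..<p} \<union> (?XS - {V})"
    proof
      fix W assume W: "W \<in> ?B"
      show "W \<in> (\<lambda>i. {i}) ` {..<p} \<union> (?XS - {V})"
      proof (cases "W \<in> ?XS")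
        case True then show ?thesis using W not_before_self by auto
      next
        case False
        then obtain i where i: "i \<in> F" "W = {i}" using cases W by blast
        then have "T < c i \<or> (T = c i \<and> i < Min V)" using W before_F[OF V(2) ne i(1)] g by auto
        then have "i < p" using c_lo[of i] i(1) Min_X(2)[OF V(2) ne] unfolding F_cases by auto
        then show ?thesis using i by blast
      qed
    qed
    then have "card ?B \<le> card ((\<lambda>i. {i}) ` {..<p} \<union> (?XS - {V}))" using fXS by (intro card_mono) auto
    also have "\<dots> \<le> card ((\<lambda>i. {i}) ` {..<p}) + card (?XS - {V})" by (rule card_Un_le)
    also have "\<dots> \<le> p + m" using cXS card_image_le[of "{..<p}" "\<lambda>i. {i}"] by simp
    finally have "card ?B < 2 * p" using mp by simp
    then show "gs_rank cs S V div p = 1"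
      using 1 unfolding gs_rank_def by (intro div_nat_eqI) auto
  }
  { assume g: "sum c V < T" and U: "U \<in> S" "U \<subseteq> X" "T \<le> sum c U"
    have "T \<le> c i" if "i \<in> F" for i
      using that c_hi[of i] c_mid[of i] c_lo[of i] unfolding F_cases by (cases "i < p - 1"; cases "i < p") auto
    then have sub: "insert U ((\<lambda>i. {i}) ` F) \<subseteq> ?B"
      using before_F[OF V(2) ne] g Fin U count_X[OF V(2)] count_X[OF U(2)]
      by (force simp: gs_before_def[of cs U])
    have FE: "F = {..<p} \<union> {p + m<..<N}" unfolding set_eq_iff F_cases by simp
    have cF: "card F = 2 * p - 1"
      unfolding FE by (subst card_Un_disjoint) (use mp in \<open>auto simp: N_def\<close>)
    have "U \<notin> (\<lambda>i. {i}) ` F" using U(2) by (auto simp: F_def)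
    then have "card (insert U ((\<lambda>i. {i}) ` F)) = Suc (card F)"
      by (subst card_insert_disjoint) (auto simp: F_def card_image)
    then have 1: "2 * p \<le> card ?B" using card_mono[OF _ sub] fin cF mp by simp
    have "?B \<subseteq> (\<lambda>i. {i}) ` F \<union> (?XS - {V})" using cases not_before_self by blast
    then have "card ?B \<le> card ((\<lambda>i. {i}) ` F \<union> (?XS - {V}))" using fXS by (intro card_mono) (auto simp: F_def)
    also have "\<dots> \<le> card ((\<lambda>i. {i}) ` F) + card (?XS - {V})" by (rule card_Un_le)
    also have "\<dots> \<le> (2 * p - 1) + m" using cXS card_image_le[of F "\<lambda>i. {i}"] cF by (simp add: F_def)
    finally have 2: "card ?B < 3 * p" using mp by simp
    have "card ?B div p = 2" using 1 2 mp by (intro div_nat_eqI) auto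
    then show "gs_rank cs S V div p = 2" by (simp add: gs_rank_def)
  }
qed

lemma step_inv:
  assumes S: "inv S" and st: "step S S'"
  shows "\<exists>V W. V \<in> S \<and> W \<in> S \<and> V \<noteq> W \<and> V \<subseteq> X \<and> W \<subseteq> X \<and> gs_rank cs S V div p = gs_rank cs S W div p \<and>
    S' = insert (V \<union> W) (S - {V, W})"
proof -
  obtain V W where VW: "V \<in> S" "W \<in> S" "V \<noteq> W" "gs_rank cs S V div p = gs_rank cs S W div p"
    "\<forall>i\<in>V \<union> W. \<forall>j\<in>V \<union> W. ls ! i = ls ! j" "S' = insert (V \<union> W) (S - {V, W})"
    using st unfolding gs_merge_step_def by blast
  have cases: "(\<exists>i\<in>F. U = {i}) \<or> U \<noteq> {} \<and> U \<subseteq> X" if "U \<in> S" for U using S that unfolding inv_def by blast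
  have sub: "U \<subseteq> {..<N}" "U \<noteq> {}" if "U \<in> S" for U using cases[OF that] XN by (auto simp: F_def)
  have no: "U \<subseteq> X" if U: "U \<in> S" "U' \<in> S" "U \<noteq> U'" "\<forall>i\<in>U \<union> U'. \<forall>j\<in>U \<union> U'. ls ! i = ls ! j" for U U'
  proof (rule ccontr)
    assume "\<not> U \<subseteq> X"
    then obtain i where i: "i \<in> F" "U = {i}" using cases[OF U(1)] by blast
    obtain j where j: "j \<in> U'" using sub(2)[OF U(2)] by blast
    then have jN: "j < N" using sub(1)[OF U(2)] by blast
    have "ls ! i = ls ! j" using U(4) i j by blast
    then have "l i = l j" using label i(1) jN by (simp add: F_def)
    then have "i = j" using i(1) unfolding l_def by (auto simp: F_def X_def split: if_splits)
    then have "U \<inter> U' \<noteq> {}" using i j by blast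
    then show False using inv_disj[OF S U(1-3)] by blast
  qed
  have "V \<subseteq> X" using no[OF VW(1-3,5)] .
  moreover have "W \<subseteq> X"
    by (rule no[OF VW(2,1) VW(3)[symmetric]]) (use VW(5) in blast)
  ultimately show ?thesis using VW(1-4,6) by blast
qed

lemma merge_inv:
  assumes "inv S" "V \<in> S" "W \<in> S" "V \<subseteq> X" "W \<subseteq> X"
  shows "inv (insert (V \<union> W) (S - {V, W}))"
proof -
  let ?S = "insert (V \<union> W) (S - {V, W})"
  have fin: "finite S" and disj: "\<And>A B. A \<in> S \<Longrightarrow> B \<in> S \<Longrightarrow> A \<noteq> B \<Longrightarrow> A \<inter> B = {}"
    and FS: "\<And>i. i \<in> F \<Longrightarrow> {i} \<in> S"
    and cases: "\<And>A. A \<in> S \<Longrightarrow> (\<exists>i\<in>F. A = {i}) \<or> A \<noteq> {} \<and> A \<subseteq> X"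
    using assms(1) unfolding inv_def by blast+
  have F: "{i} \<noteq> V" "{i} \<noteq> W" if "i \<in> F" for i using assms(4,5) that by (auto simp: F_def)
  have ne: "V \<union> W \<noteq> {}" using cases[OF assms(2)] by blast
  have d: "A \<inter> (V \<union> W) = {}" if "A \<in> S - {V, W}" for A
    using disj[of A V] disj[of A W] that assms(2,3) by blast
  have 1: "A \<inter> B = {}" if "A \<in> ?S" "B \<in> ?S" "A \<noteq> B" for A B
  proof (cases "A = V \<union> W \<or> B = V \<union> W")
    case True
    then show ?thesis using d[of A] d[of B] that by blast
  next
    case False
    then show ?thesis using disj[of A B] that by blast
  qed
  have 2: "{i} \<in> ?S" if "i \<in> F" for i using FS F that by blast
  have 3: "(\<exists>i\<in>F. A = {i}) \<or> A \<noteq> {} \<and> A \<subseteq> X" if "A \<in> ?S" for A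
  proof (cases "A = V \<union> W")
    case True
    then show ?thesis using ne assms(4,5) by blast
  next
    case False
    then show ?thesis using that cases by blast
  qed
  show ?thesis unfolding inv_def
    by (intro conjI ballI impI) (fact 1 2 3 | simp only: finite_insert finite_Diff fin)+
qed

lemma merge_ok:
  assumes "inv S" "V \<in> S" "W \<in> S" "V \<noteq> W" "V \<subseteq> X" "W \<subseteq> X"
    "gs_rank cs S V div p = gs_rank cs S W div p"
  shows "step S (insert (V \<union> W) (S - {V, W}))"
proof -
  have "ls ! i = 0" if "i \<in> X" for i
    using that label[of i] XN by (auto simp: l_def X_def)
  then have "\<forall>i\<in>V \<union> W. \<forall>j\<in>V \<union> W. ls ! i = ls ! j" using assms(5,6) by (metis Un_iff subsetD)
  then show ?thesis unfolding gs_merge_step_def using assms(2-4,7) by blast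
qed

lemma init_inv: "inv (gs_init N)"
proof -
  have "X \<union> F = {..<N}" using XN by (auto simp: F_def)
  then show ?thesis unfolding inv_def gs_init_def F_def by auto
qed

text \<open>Invariantly, \<open>{p}\<close> is the only paper version on the second page: the others
  avoid the sums \<open>T\<close> and \<open>T + 1\<close>, so they lie on the third or the first
  page. Hence \<open>{p}\<close> is never merged.\<close>

lemma no_instance:
  assumes no: "\<And>J. J \<subseteq> {p<..p + m} \<Longrightarrow> sum c J \<noteq> T \<and> sum c J \<noteq> Suc T"
  shows "\<not> gs_yes p cs ls"
proof
  assume "gs_yes p cs ls"
  then obtain S where S: "step\<^sup>*\<^sup>* (gs_init N) S"
    "\<forall>i < N. \<forall>j < N. ls ! i = ls ! j \<longrightarrow> (\<exists>V\<in>S. i \<in> V \<and> j \<in> V)"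
    unfolding gs_yes_def by (auto simp: cs_def)
  have "inv S \<and> {p} \<in> S"
    using S(1)
  proof (induction rule: rtranclp_induct)
    case base
    show ?case using init_inv mp by (auto simp: gs_init_def N_def)
  next
    case (step S S')
    then have I: "inv S" and pS: "{p} \<in> S" by auto
    obtain V W where VW: "V \<in> S" "W \<in> S" "V \<noteq> W" "V \<subseteq> X" "W \<subseteq> X" "gs_rank cs S V div p = gs_rank cs S W div p"
      "S' = insert (V \<union> W) (S - {V, W})" using step_inv[OF I step(2)] by blast
    have pX: "{p} \<subseteq> X" by (simp add: X_def)
    have sp: "sum c {p} = T" using c_mid[of p] by simp
    have pg: "gs_rank cs S {p} div p = 1" using page(2)[OF I pS pX sp] .
    have ne: "gs_rank cs S U div p \<noteq> 1" if U: "U \<in> S" "U \<subseteq> X" "U \<noteq> {p}" for U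
    proof -
      have "U \<inter> {p} = {}" using inv_disj[OF I U(1) pS U(3)] .
      moreover have "X \<subseteq> insert p {p<..p + m}" by (auto simp: X_def)
      ultimately have "U \<subseteq> {p<..p + m}" using U(2) by blast
      then have "sum c U < T \<or> Suc T < sum c U" using no[of U] by linarith
      then show ?thesis using page(1)[OF I U(1,2)] page(3)[OF I U(1,2) _ pS pX] sp
        by (cases "sum c U < T") simp_all
    qed
    have "V \<noteq> {p}"
    proof
      assume "V = {p}"
      then show False using ne[OF VW(2,5)] VW(3,6) pg by argo
    qed
    moreover have "W \<noteq> {p}"
    proof
      assume "W = {p}"
      then show False using ne[OF VW(1,4)] VW(3,6) pg by argo
    qed
    ultimately have "{p} \<in> S'" unfolding VW(7) using pS by blast
    then show ?case unfolding VW(7) using merge_inv[OF I VW(1,2,4,5)] by blast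
  qed
  moreover have "ls ! p = ls ! Suc p" "p < N" "Suc p < N"
    using label[of p] label[of "Suc p"] mp m1 by (auto simp: l_def N_def)
  ultimately obtain V where V: "V \<in> S" "p \<in> V" "Suc p \<in> V" "inv S" "{p} \<in> S" using S(2) by blast
  then have "V \<inter> {p} \<noteq> {}" "V \<noteq> {p}" by auto
  then show False using inv_disj[OF V(4,1,5)] by blast
qed

text \<open>As long as the sum stays below \<open>T\<close>, the growing version and the next item
  share the third page. \<open>U\<close> completes the first two pages and, being larger than any
  item, is not consumed.\<close>

lemma gather:
  assumes "finite J" "J \<noteq> {}" "inv S" "J \<subseteq> {p<..p + m}" "\<forall>i\<in>J. {i} \<in> S" "sum c J < T"
    "U \<in> S" "U \<subseteq> X" "T \<le> sum c U"
  shows "step\<^sup>*\<^sup>* S (insert J (S - (\<lambda>i. {i}) ` J)) \<and> inv (insert J (S - (\<lambda>i. {i}) ` J))"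
  using assms(1,2,4-6)
proof (induction rule: finite_ne_induct)
  case (singleton j)
  then have "insert {j} (S - (\<lambda>i. {i}) ` {j}) = S" by auto
  then show ?case using assms(3) by simp
next
  case (insert j J)
  let ?S = "insert J (S - (\<lambda>i. {i}) ` J)"
  have lt: "sum c J < T" "c j < T" using insert.prems(3) insert.hyps by auto
  then have IH: "step\<^sup>*\<^sup>* S ?S" "inv ?S" using insert by auto
  have J: "J \<subseteq> X" "{j} \<subseteq> X" "{j} \<noteq> J" using insert.prems(1) insert.hyps by (auto simp: X_def)
  have U: "U \<in> ?S"
  proof -
    have "U \<noteq> {i}" if "i \<in> J" for i
    proof
      assume "U = {i}"
      then have "T \<le> c i" using assms(9) by simp
      then show False using c_item[of i] insert.prems(1) that by auto
    qed
    then show ?thesis using assms(7) by auto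
  qed
  have jS: "{j} \<in> ?S" using insert.prems(2) insert.hyps by auto
  have "gs_rank cs ?S J div p = 2" using page(3)[OF IH(2) _ J(1) lt(1) U assms(8,9)] by simp
  moreover have "gs_rank cs ?S {j} div p = 2" using page(3)[OF IH(2) jS J(2) _ U assms(8,9)] lt by simp
  ultimately have "step ?S (insert ({j} \<union> J) (?S - {{j}, J}))"
    using merge_ok[OF IH(2) jS _ J(3) J(2) J(1)] by simp
  moreover have I: "inv (insert ({j} \<union> J) (?S - {{j}, J}))"
    using merge_inv[OF IH(2) jS _ J(2) J(1)] by simp
  moreover have "?S - {{j}, J} = S - (\<lambda>i. {i}) ` insert j J"
  proof -
    have "J \<notin> S - (\<lambda>i. {i}) ` J"
    proof
      assume a: "J \<in> S - (\<lambda>i. {i}) ` J"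
      obtain i where i: "i \<in> J" using insert.hyps by blast
      then have "{i} \<in> S" "{i} \<inter> J \<noteq> {}" "{i} \<noteq> J" using insert.prems(2) a by auto
      then show False using inv_disj[OF assms(3), of "{i}" J] a by blast
    qed
    then show ?thesis by auto
  qed
  ultimately show ?case using IH(1) by simp
qed

lemma all_merged:
  assumes "step\<^sup>*\<^sup>* (gs_init N) S" "inv S" "X \<in> S"
  shows "gs_yes p cs ls"
proof -
  have "\<exists>V\<in>S. i \<in> V \<and> j \<in> V" if ij: "i < N" "j < N" "ls ! i = ls ! j" for i j
  proof (cases "i \<in> X \<and> j \<in> X")
    case True
    then show ?thesis using assms(3) by blast
  next
    case False
    have "l i = l j" using ij label by simp
    then have "i = j" using False unfolding l_def X_def by (auto split: if_splits)
    then have "i \<in> F" using False ij by (simp add: F_def)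
    then have "{i} \<in> S" by (rule inv_F[OF assms(2)])
    then show ?thesis using \<open>i = j\<close> by blast
  qed
  moreover have "length cs = N" by (simp add: cs_def)
  ultimately show ?thesis unfolding gs_yes_def using assms(1) by metis
qed

lemma yes_instance:
  assumes J: "J \<subseteq> {p<..p + m}" "sum c J = T" and b: "b \<in> {p<..p + m} - J"
    "sum c ({p<..p + m} - J - {b}) < T" "Suc T < sum c ({p<..p + m} - J)"
  shows "gs_yes p cs ls"
proof -
  let ?I = "{p<..p + m}" and ?S0 = "gs_init N"
  let ?K = "?I - J" and ?Kb = "?I - J - {b}"
  have fJ: "finite J" using J(1) finite_subset by blast
  obtain a where a: "a \<in> J" using J(2) T2 by fastforce
  \<comment> \<open>\<open>gather\<close> must stay below \<open>T\<close>, so one item is kept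
    back. The merge that reaches \<open>T\<close> is judged by the ranks before it, when both parts
    are still on the third page.\<close>
  let ?Ja = "J - {a}"
  have item: "0 < c i \<and> c i < T" if "i \<in> ?I" for i using c_item that by auto
  have pX: "{p} \<subseteq> X" by (simp add: X_def)
  have IX: "?I \<subseteq> X" by (auto simp: X_def)
  have single: "{i} \<in> ?S0" if "i < N" for i using that by (auto simp: gs_init_def)
  have pS: "{p} \<in> ?S0" using mp by (intro single) (simp add: N_def)
  have sp: "sum c {p} = T" using c_mid[of p] by simp
  have sJ: "sum c J = c a + sum c ?Ja" using a fJ by (simp add: sum.remove)
  have aI: "c a < T" "0 < c a" using item J(1) a by auto
  have ltJ0: "sum c ?Ja < T" using aI sJ J(2) by linarith
  have neJ0: "?Ja \<noteq> {}"
  proof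
    assume "?Ja = {}"
    then have "sum c ?Ja = 0" by (simp only: sum.empty)
    then show False using aI sJ J(2) by linarith
  qed
  let ?S1 = "insert ?Ja (?S0 - (\<lambda>i. {i}) ` ?Ja)"
  have IN: "i < N" if "i \<in> ?I" for i using that mp by (auto simp: N_def)
  have 1: "step\<^sup>*\<^sup>* ?S0 ?S1" "inv ?S1"
  proof -
    have "finite ?Ja" "?Ja \<subseteq> {p<..p + m}" using fJ J(1) by blast+
    moreover have "\<forall>i\<in>?Ja. {i} \<in> ?S0" using single IN J(1) by blast
    ultimately have "step\<^sup>*\<^sup>* ?S0 ?S1 \<and> inv ?S1"
      using gather[OF _ neJ0 init_inv _ _ ltJ0 pS pX] sp by blast
    then show "step\<^sup>*\<^sup>* ?S0 ?S1" "inv ?S1" by blast+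
  qed
  have aS: "{a} \<in> ?S1" and pS1: "{p} \<in> ?S1" using single[of a] IN[of a] pS a J(1) by auto
  have aX: "{a} \<subseteq> X" "?Ja \<subseteq> X" "{a} \<noteq> ?Ja" using a J(1) IX by auto
  let ?S2 = "insert ({a} \<union> ?Ja) (?S1 - {{a}, ?Ja})"
  have "gs_rank cs ?S1 ?Ja div p = 2" using page(3)[OF 1(2) _ aX(2) ltJ0 pS1 pX] sp by simp
  moreover have "gs_rank cs ?S1 {a} div p = 2" using page(3)[OF 1(2) aS aX(1) _ pS1 pX] aI sp by simp
  ultimately have 2: "step ?S1 ?S2" "inv ?S2"
    using merge_ok[OF 1(2) aS _ aX(3,1,2)] merge_inv[OF 1(2) aS _ aX(1,2)] by auto
  have Ja: "{a} \<union> ?Ja = J" using a by auto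
  have JS: "J \<in> ?S2" unfolding Ja by simp
  have pJ: "p \<notin> J" using J(1) by auto
  have pS2: "{p} \<in> ?S2" using pS1 a J(1) pJ by auto
  have JX: "J \<subseteq> X" "{p} \<noteq> J" using J(1) IX pJ by auto
  let ?S3 = "insert ({p} \<union> J) (?S2 - {{p}, J})"
  have "gs_rank cs ?S2 J div p = 1" using page(2)[OF 2(2) JS JX(1) J(2)] .
  moreover have "gs_rank cs ?S2 {p} div p = 1" using page(2)[OF 2(2) pS2 pX sp] .
  ultimately have 3: "step ?S2 ?S3" "inv ?S3"
    using merge_ok[OF 2(2) pS2 JS JX(2) pX JX(1)] merge_inv[OF 2(2) pS2 JS pX JX(1)] by auto
  \<comment> \<open>From here on \<open>?Z\<close>, of count \<open>2 * T\<close>, replaces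
    \<open>{p}\<close> as the large version \<open>U\<close>.\<close>
  let ?Z = "{p} \<union> J"
  have Z: "?Z \<in> ?S3" "?Z \<subseteq> X" "sum c ?Z = 2 * T"
    using JX pX fJ pJ sp J(2) by auto
  have keep: "{i} \<in> ?S3" if "i \<in> ?K" for i
    using that single[of i] IN[of i] a pJ by auto
  have cb: "c b < T" using item b(1) by auto
  have sK: "sum c ?K = c b + sum c ?Kb"
    by (rule sum.remove[OF _ b(1)]) simp
  have neK0: "?Kb \<noteq> {}"
  proof
    assume "?Kb = {}"
    then have "sum c ?Kb = 0" by (simp only: sum.empty)
    then show False using sK b(3) cb by linarith
  qed
  let ?S4 = "insert ?Kb (?S3 - (\<lambda>i. {i}) ` ?Kb)"
  have 4: "step\<^sup>*\<^sup>* ?S3 ?S4" "inv ?S4"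
  proof -
    have "finite ?Kb" "?Kb \<subseteq> {p<..p + m}" by auto
    moreover have "\<forall>i\<in>?Kb. {i} \<in> ?S3" using keep by blast
    moreover have "T \<le> sum c ?Z" using Z(3) by simp
    ultimately have "step\<^sup>*\<^sup>* ?S3 ?S4 \<and> inv ?S4"
      using gather[OF _ neK0 3(2) _ _ b(2) Z(1,2)] by blast
    then show "step\<^sup>*\<^sup>* ?S3 ?S4" "inv ?S4" by blast+
  qed
  have ZS4: "?Z \<in> ?S4" using Z(1) a pJ by auto
  have bS: "{b} \<in> ?S4" using keep[OF b(1)] by auto
  have bX: "{b} \<subseteq> X" "?Kb \<subseteq> X" "{b} \<noteq> ?Kb" using b(1) IX by auto
  let ?S5 = "insert ({b} \<union> ?Kb) (?S4 - {{b}, ?Kb})"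
  have "gs_rank cs ?S4 ?Kb div p = 2" using page(3)[OF 4(2) _ bX(2) b(2) ZS4 Z(2)] Z(3) by simp
  moreover have "gs_rank cs ?S4 {b} div p = 2" using page(3)[OF 4(2) bS bX(1) _ ZS4 Z(2)] cb Z(3) by simp
  ultimately have 5: "step ?S4 ?S5" "inv ?S5"
    using merge_ok[OF 4(2) bS _ bX(3,1,2)] merge_inv[OF 4(2) bS _ bX(1,2)] by auto
  have Kb: "{b} \<union> ?Kb = ?K" using b(1) by auto
  have KS: "?K \<in> ?S5" unfolding Kb by simp
  have pb: "p \<notin> {b}" "p \<notin> ?Kb" using b(1) by auto
  have ZS5: "?Z \<in> ?S5" using ZS4 pb by blast
  have KX: "?K \<subseteq> X" "?Z \<noteq> ?K" using IX by auto
  let ?S6 = "insert (?Z \<union> ?K) (?S5 - {?Z, ?K})"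
  have "gs_rank cs ?S5 ?K div p = 0" using page(1)[OF 5(2) KS KX(1) b(3)] .
  \<comment> \<open>\<open>2 \<le> T\<close> makes \<open>2 * T\<close> exceed
    \<open>T + 1\<close>.\<close>
  moreover have "gs_rank cs ?S5 ?Z div p = 0" using page(1)[OF 5(2) ZS5 Z(2)] Z(3) T2 by simp
  ultimately have 6: "step ?S5 ?S6" "inv ?S6"
    using merge_ok[OF 5(2) ZS5 KS KX(2) Z(2) KX(1)] merge_inv[OF 5(2) ZS5 KS Z(2) KX(1)] by auto
  have ZK: "?Z \<union> ?K = X" using J(1) by (auto simp: X_def)
  have run: "step\<^sup>*\<^sup>* ?S0 ?S6"
    using 1(1) 2(1) 3(1) 4(1) 5(1) 6(1) by (meson rtranclp.rtrancl_into_rtrancl rtranclp_trans)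
  moreover have "X \<in> ?S6" unfolding ZK by (rule insertI1)
  ultimately show ?thesis by (rule all_merged[OF _ 6(2)])
qed

end

section \<open>From tilings to subset sums\<close>

definition val :: "nat \<Rightarrow> nat \<Rightarrow> (nat \<Rightarrow> nat) \<Rightarrow> nat" where
  "val B H d = (\<Sum>h<H. d h * B ^ h)"

lemma val_Suc: "val B (Suc H) d = d 0 + B * val B H (\<lambda>h. d (Suc h))"
  unfolding val_def sum.lessThan_Suc_shift by (simp add: sum_distrib_left algebra_simps)

lemma val_less: "(\<And>h. h < H \<Longrightarrow> d h < B) \<Longrightarrow> val B H d < B ^ H"
proof (induction H arbitrary: d)
  case (Suc H)
  have "d 0 < B" using Suc.prems by simp
  moreover have "val B H (\<lambda>h. d (Suc h)) + 1 \<le> B ^ H" using Suc.IH[of "\<lambda>h. d (Suc h)"] Suc.prems by simp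
  then have "B * (val B H (\<lambda>h. d (Suc h)) + 1) \<le> B * B ^ H" by (rule mult_le_mono2)
  ultimately show ?case by (simp add: val_Suc)
qed (simp add: val_def)

lemma val_inj:
  "(\<And>h. h < H \<Longrightarrow> d h < B \<and> d' h < B) \<Longrightarrow> val B H d = val B H d' \<Longrightarrow> h < H \<Longrightarrow> d h = d' h"
proof (induction H arbitrary: d d' h)
  case (Suc H)
  have 0: "d 0 < B" "d' 0 < B" using Suc.prems by auto
  then have B: "0 < B" by simp
  have e: "d 0 + B * val B H (\<lambda>h. d (Suc h)) = d' 0 + B * val B H (\<lambda>h. d' (Suc h))"
    using Suc.prems(2) by (simp add: val_Suc)
  have e0: "d 0 = d' 0" using arg_cong[OF e, of "\<lambda>x. x mod B"] 0 by simp
  then have e1: "val B H (\<lambda>h. d (Suc h)) = val B H (\<lambda>h. d' (Suc h))" using e B by simp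
  show ?case
  proof (cases h)
    case 0 then show ?thesis using e0 by simp
  next
    case (Suc k)
    then show ?thesis using Suc.IH[of "\<lambda>h. d (Suc h)" "\<lambda>h. d' (Suc h)" k] Suc.prems e1 by simp
  qed
qed simp

lemma val_cong: "(\<And>h. h < H \<Longrightarrow> d h = d' h) \<Longrightarrow> val B H d = val B H d'"
  by (simp add: val_def)

lemma sum_val: "(\<Sum>j\<in>J. val B H (d j)) = val B H (\<lambda>h. \<Sum>j\<in>J. d j h)"
  unfolding val_def by (simp add: sum_distrib_right) (rule sum.swap)

lemma val_extend: "H \<le> H' \<Longrightarrow> (\<And>h. H \<le> h \<Longrightarrow> h < H' \<Longrightarrow> d h = 0) \<Longrightarrow> val B H' d = val B H d"
  unfolding val_def by (intro sum.mono_neutral_right) auto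

lemma val_ge: "h < H \<Longrightarrow> d h * B ^ h \<le> val B H d"
  unfolding val_def by (intro member_le_sum) auto

lemma dvd_val: "d 0 = 0 \<Longrightarrow> B dvd val B H d"
  by (cases H) (auto simp: val_Suc, simp add: val_def)

section \<open>Tilings of a line as subset sums\<close>

locale tiling =
  fixes M W K C \<beta> :: nat and allowed :: "nat \<Rightarrow> nat \<Rightarrow> bool" and f1 g1 f2 g2 :: "nat \<Rightarrow> nat"
  assumes M: "1 \<le> M" and W: "1 \<le> W" and K: "1 \<le> K"
    and fg: "\<And>t. t < K \<Longrightarrow> f1 t \<le> C \<and> g1 t \<le> C \<and> f2 t \<le> C \<and> g2 t \<le> C"
    and base: "(2 * K + 3) * (C + 2) < 2 ^ \<beta>"
begin

definition "B = (2::nat) ^ \<beta>"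
definition "H = 3 * M + 3"

text \<open>Digit \<open>k\<close> belongs to the constraint between cells \<open>k\<close> and
  \<open>k + w\<close>: the former contributes \<open>f\<close>, the latter \<open>C - g\<close>.
  Constraints reaching beyond the line are left out, and \<open>goal\<close> is 0 there.\<close>

definition fam :: "nat \<Rightarrow> (nat \<Rightarrow> nat) \<Rightarrow> (nat \<Rightarrow> nat) \<Rightarrow> nat \<Rightarrow> nat \<Rightarrow> nat \<Rightarrow> nat" where
  "fam w f g n t k = (if k = n \<and> n + w < M then f t else if k + w = n then C - g t else 0)"

text \<open>Digit 0 vanishes in all items and in \<open>T\<close>, so that no sum of items is \<open>T + 1\<close>. A forbidden tile has
  2 instead of 1 at the digit of its cell, where the target has 1.\<close>

definition tile :: "nat \<Rightarrow> nat \<Rightarrow> nat \<Rightarrow> nat" where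
  "tile n t h = (if h = 0 then 0 else if h \<le> M then fam 1 f1 g1 n t (h - 1)
     else if h \<le> 2 * M then fam W f2 g2 n t (h - 1 - M)
     else if h = 2 * M + 1 + n then (if allowed n t then 1 else 2) else 0)"

text \<open>Three items are added to the tiles: two copies of the leading power of \<open>T\<close>, of which a solution
  uses exactly one, and a number that no solution uses. They make the unused items exceed \<open>T\<close> in
  sum, but only once the second copy is merged.\<close>

definition dig :: "nat \<Rightarrow> nat \<Rightarrow> nat" where
  "dig j h = (if j < M * K then tile (j div K) (j mod K) h
     else of_bool (h = (if j = M * K then 3 * M + 1 else 3 * M + 2)))"

definition goal :: "nat \<Rightarrow> nat" where
  "goal h = (if h = 0 then 0 else if h \<le> M then (if h - 1 + 1 < M then C else 0)
     else if h \<le> 2 * M then (if h - 1 - M + W < M then C else 0)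
     else if h \<le> 3 * M then 1 else of_bool (h = 3 * M + 2))"

definition "T = val B H goal"
definition "m = M * K + 3"
text \<open>The smallest page size with \<open>m < p\<close>.\<close>

definition "p = M * K + 4"

text \<open>Fillers are given by digits as well, so that one program can emit all counts;
  \<open>T + 1\<close> arises by setting digit 0, which is 0 in \<open>goal\<close>.\<close>

definition cdig :: "nat \<Rightarrow> nat \<Rightarrow> nat" where
  "cdig i h = (if p < i \<and> i \<le> p + m then dig (i - p - 1) h
     else if i < p - 1 \<and> h = 0 then 1 else goal h)"

definition tiled :: "(nat \<Rightarrow> nat) \<Rightarrow> bool" where
  "tiled \<sigma> \<longleftrightarrow> (\<forall>n<M. \<sigma> n < K \<and> allowed n (\<sigma> n)) \<and>
     (\<forall>n. n + 1 < M \<longrightarrow> f1 (\<sigma> n) = g1 (\<sigma> (n + 1))) \<and>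
     (\<forall>n. n + W < M \<longrightarrow> f2 (\<sigma> n) = g2 (\<sigma> (n + W)))"

lemma base': "(2 * K + 3) * (C + 2) < B"
  using base by (simp add: B_def)

lemma B_ge: "10 \<le> B"
proof -
  have "5 * 2 \<le> (2 * K + 3) * (C + 2)" using K by (intro mult_le_mono) auto
  then show ?thesis using base' by linarith
qed

lemma C2: "C + 2 < B"
proof -
  have "1 * (C + 2) \<le> (2 * K + 3) * (C + 2)" by (intro mult_le_mono1) simp
  then show ?thesis using base' unfolding mult_1 by (rule le_less_trans)
qed

lemma goal_le: "goal h < B"
  using C2 by (auto simp: goal_def)

lemma fam_le: "t < K \<Longrightarrow> f t \<le> C \<Longrightarrow> fam w f g n t k \<le> C"
  by (auto simp: fam_def)

lemma tile_le: "t < K \<Longrightarrow> tile n t h \<le> C + 2"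
  using fam_le[of t f1 1 g1 n "h - 1"] fam_le[of t f2 W g2 n "h - 1 - M"] fg[of t]
  by (auto simp: tile_def)

lemma modK: "j mod K < K"
  using K by simp

lemma dig_le: "dig j h \<le> C + 2"
  using tile_le[OF modK] by (auto simp: dig_def)

lemma dig_support: "\<exists>a b. \<forall>j<m. dig j h \<noteq> 0 \<longrightarrow> j div K = a \<or> j div K = b \<or> j \<in> {M * K, M * K + 1, M * K + 2}"
proof -
  consider "h = 0" | "h \<noteq> 0" "h \<le> M" | "M < h" "h \<le> 2 * M" | "2 * M < h" by linarith
  then show ?thesis
  proof cases
    case 1 then show ?thesis by (auto simp: dig_def tile_def m_def)
  next
    case 2
    then show ?thesis
      by (intro exI[of _ "h - 1"] exI[of _ h]) (auto simp: dig_def tile_def fam_def m_def split: if_splits)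
  next
    case 3
    have "\<forall>j<m. dig j h \<noteq> 0 \<longrightarrow> j div K = h - 1 - M \<or> j div K = h - 1 - M + W \<or> j \<in> {M * K, M * K + 1, M * K + 2}"
      using 3 by (auto simp: dig_def tile_def fam_def m_def split: if_splits)
    then show ?thesis by blast
  next
    case 4
    have "\<forall>j<m. dig j h \<noteq> 0 \<longrightarrow> j div K = h - 1 - 2 * M \<or> j div K = h - 1 - 2 * M \<or> j \<in> {M * K, M * K + 1, M * K + 2}"
      using 4 by (auto simp: dig_def tile_def m_def split: if_splits)
    then show ?thesis by blast
  qed
qed

text \<open>Origin of the bound in \<open>base\<close>: at any digit only the \<open>K\<close> tiles
  of two cells and the three extra items can be nonzero, each at most \<open>C + 2\<close>.\<close>

lemma digit_sum_less:
  assumes "J \<subseteq> {..<m}" shows "(\<Sum>j\<in>J. dig j h) < B"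
proof -
  obtain a b where ab: "\<forall>j<m. dig j h \<noteq> 0 \<longrightarrow> j div K = a \<or> j div K = b \<or> j \<in> {M * K, M * K + 1, M * K + 2}"
    using dig_support[of h] by blast
  let ?A = "{a * K..<a * K + K} \<union> {b * K..<b * K + K} \<union> {M * K, M * K + 1, M * K + 2}"
  have fJ: "finite J" using assms finite_subset by blast
  have div: "j \<in> {a * K..<a * K + K}" if "j div K = a" for j a
    using that K div_mult_mod_eq[of j K] modK[of j] by auto
  have "(\<Sum>j\<in>J. dig j h) \<le> (\<Sum>j\<in>?A. dig j h)"
  proof -
    have "(\<Sum>j\<in>J. dig j h) = (\<Sum>j\<in>J \<inter> ?A. dig j h)"
      using ab assms div fJ by (intro sum.mono_neutral_right) (auto simp del: atLeastLessThan_iff)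
    also have "\<dots> \<le> (\<Sum>j\<in>?A. dig j h)" by (intro sum_mono2) auto
    finally show ?thesis .
  qed
  also have "\<dots> \<le> card ?A * (C + 2)" using sum_bounded_above[of ?A "\<lambda>j. dig j h" "C + 2"] dig_le by simp
  also have "card ?A \<le> (card {a * K..<a * K + K} + card {b * K..<b * K + K}) + card {M * K, M * K + 1, M * K + 2}"
    by (rule order_trans[OF card_Un_le add_right_mono[OF card_Un_le]])
  then have "card ?A * (C + 2) \<le> (2 * K + 3) * (C + 2)" by (intro mult_le_mono1) simp
  also note base'
  finally show ?thesis .
qed

lemma sum_tiles: "(\<Sum>j<M * K. F j) = (\<Sum>n<M. \<Sum>t<K. F (n * K + t))"
proof -
  have "(\<Sum>n<M. sum F {n * K..<n * K + K}) = sum F {..<M * K}" by (rule sum.nat_group)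
  moreover have "sum F {n * K..<n * K + K} = (\<Sum>t<K. F (n * K + t))" for n
    using sum.shift_bounds_nat_ivl[of F 0 "n * K" K] by (simp add: lessThan_atLeast0 add.commute)
  ultimately show ?thesis by simp
qed

lemma digit_sum:
  assumes "J \<subseteq> {..<m}"
  shows "(\<Sum>j\<in>J. dig j h) = (\<Sum>n<M. \<Sum>t<K. of_bool (n * K + t \<in> J) * tile n t h)
     + of_bool (M * K \<in> J) * of_bool (h = 3 * M + 1)
     + (of_bool (M * K + 1 \<in> J) + of_bool (M * K + 2 \<in> J)) * of_bool (h = 3 * M + 2)"
proof -
  have "(\<Sum>j\<in>J. dig j h) = (\<Sum>j\<in>{..<m}. of_bool (j \<in> J) * dig j h)"
    using assms by (intro sum.mono_neutral_cong_left) auto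
  also have "\<dots> = (\<Sum>j<M * K. of_bool (j \<in> J) * dig j h) + of_bool (M * K \<in> J) * dig (M * K) h
     + of_bool (M * K + 1 \<in> J) * dig (M * K + 1) h + of_bool (M * K + 2 \<in> J) * dig (M * K + 2) h"
    by (simp add: m_def numeral_3_eq_3)
  also have "(\<Sum>j<M * K. of_bool (j \<in> J) * dig j h) = (\<Sum>n<M. \<Sum>t<K. of_bool (n * K + t \<in> J) * tile n t h)"
    unfolding sum_tiles
  proof (intro sum.cong refl)
    fix n t assume nt: "n \<in> {..<M}" "t \<in> {..<K}"
    have "n * K + t < Suc n * K" using nt by simp
    also have "\<dots> \<le> M * K" using nt by (intro mult_le_mono1) simp
    finally show "of_bool (n * K + t \<in> J) * dig (n * K + t) h = of_bool (n * K + t \<in> J) * tile n t h"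
      using nt by (simp add: dig_def)
  qed
  finally show ?thesis by (simp add: dig_def algebra_simps)
qed

text \<open>No digit sum reaches \<open>B\<close>, so there are no carries and digits can be
  compared one by one.\<close>

lemma sum_digits_iff:
  assumes "J \<subseteq> {..<m}"
  shows "(\<Sum>j\<in>J. val B H (dig j)) = T \<longleftrightarrow> (\<forall>h<H. (\<Sum>j\<in>J. dig j h) = goal h)"
proof
  assume a: "(\<Sum>j\<in>J. val B H (dig j)) = T"
  then have "val B H (\<lambda>h. \<Sum>j\<in>J. dig j h) = val B H goal" by (simp add: sum_val T_def)
  then show "\<forall>h<H. (\<Sum>j\<in>J. dig j h) = goal h"
    using val_inj[of H "\<lambda>h. \<Sum>j\<in>J. dig j h" B goal] digit_sum_less[OF assms] goal_le by blast
next
  assume "\<forall>h<H. (\<Sum>j\<in>J. dig j h) = goal h"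
  then show "(\<Sum>j\<in>J. val B H (dig j)) = T" unfolding sum_val T_def by (intro val_cong) simp
qed

lemma fam_sum:
  assumes "\<And>n. n < M \<Longrightarrow> \<sigma> n < K" "\<And>n t. n < M \<Longrightarrow> t < K \<Longrightarrow> n * K + t \<in> J \<longleftrightarrow> t = \<sigma> n"
    "k < M" "1 \<le> w"
  shows "(\<Sum>n<M. \<Sum>t<K. of_bool (n * K + t \<in> J) * fam w f g n t k) =
    (if k + w < M then f (\<sigma> k) + (C - g (\<sigma> (k + w))) else 0)"
proof -
  have "(\<Sum>t<K. of_bool (n * K + t \<in> J) * F t) = F (\<sigma> n)" if "n < M" for n and F :: "nat \<Rightarrow> nat"
  proof -
    have "(\<Sum>t<K. of_bool (n * K + t \<in> J) * F t) = (\<Sum>t<K. if \<sigma> n = t then F t else 0)"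
      using assms(2)[OF that] by (intro sum.cong) auto
    then show ?thesis using assms(1)[OF that] by simp
  qed
  then have "(\<Sum>n<M. \<Sum>t<K. of_bool (n * K + t \<in> J) * fam w f g n t k) = (\<Sum>n<M. fam w f g n (\<sigma> n) k)"
    by simp
  also have "\<dots> = (\<Sum>n<M. (if k = n then (if k + w < M then f (\<sigma> n) else 0) else 0) + (if k + w = n then C - g (\<sigma> n) else 0))"
    using assms(4) by (intro sum.cong) (auto simp: fam_def)
  also have "\<dots> = (if k + w < M then f (\<sigma> k) + (C - g (\<sigma> (k + w))) else 0)"
    using assms(3) by (simp add: sum.distrib)
  finally show ?thesis .
qed

lemma D_sum:
  assumes "k < M"
  shows "(\<Sum>n<M. \<Sum>t<K. of_bool (n * K + t \<in> J) * tile n t (2 * M + 1 + k)) =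
    (\<Sum>t<K. of_bool (k * K + t \<in> J) * (if allowed k t then 1 else 2))"
proof -
  have "(\<Sum>n<M. \<Sum>t<K. of_bool (n * K + t \<in> J) * tile n t (2 * M + 1 + k)) =
     (\<Sum>n<M. if k = n then (\<Sum>t<K. of_bool (n * K + t \<in> J) * (if allowed n t then 1 else 2)) else 0)"
    by (intro sum.cong refl) (auto simp: tile_def)
  then show ?thesis using assms by simp
qed

lemma tile_fam1: "k < M \<Longrightarrow> tile n t (Suc k) = fam 1 f1 g1 n t k"
  by (simp add: tile_def)

lemma tile_fam2: "k < M \<Longrightarrow> tile n t (Suc (M + k)) = fam W f2 g2 n t k"
  by (simp add: tile_def)

lemma goal_fam1: "k < M \<Longrightarrow> goal (Suc k) = (if k + 1 < M then C else 0)"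
  and goal_fam2: "k < M \<Longrightarrow> goal (Suc (M + k)) = (if k + W < M then C else 0)"
  and goal_D: "k < M \<Longrightarrow> goal (2 * M + 1 + k) = 1"
  by (auto simp: goal_def)

lemma digits_cases:
  assumes "h < H"
  obtains "h = 0" | k where "k < M" "h = Suc k" | k where "k < M" "h = Suc (M + k)"
    | k where "k < M" "h = 2 * M + 1 + k" | "h = 3 * M + 1" | "h = 3 * M + 2"
proof -
  consider "h = 0" | "0 < h" "h \<le> M" | "M < h" "h \<le> 2 * M" | "2 * M < h" "h \<le> 3 * M"
    | "h = 3 * M + 1" | "h = 3 * M + 2" using assms unfolding H_def by linarith
  then show thesis
  proof cases
    case 2 then show thesis using that(2)[of "h - 1"] by simp
  next
    case 3 then show thesis using that(3)[of "h - 1 - M"] by simp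
  next
    case 4 then show thesis using that(4)[of "h - 1 - 2 * M"] by simp
  qed (use that in auto)
qed

lemma tile_high: "3 * M < h \<Longrightarrow> n < M \<Longrightarrow> tile n t h = 0"
  by (simp add: tile_def)

lemma goal_high: "goal (3 * M + 1) = 0" "goal (3 * M + 2) = 1"
  by (auto simp: goal_def)

lemma subset_imp_tiled:
  assumes J: "J \<subseteq> {..<m}" and s: "(\<Sum>j\<in>J. val B H (dig j)) = T"
  shows "\<exists>\<sigma>. tiled \<sigma>"
proof -
  have eq: "(\<Sum>j\<in>J. dig j h) = goal h" if "h < H" for h
    using s that unfolding sum_digits_iff[OF J] by blast
  \<comment> \<open>The digit of cell \<open>k\<close> is 1. A sum of zeros, ones and twos equal to
    1 has a single nonzero term, and that term comes from an allowed tile.\<close>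
  have "\<exists>s<K. allowed k s \<and> (\<forall>t<K. k * K + t \<in> J \<longleftrightarrow> t = s)" if k: "k < M" for k
  proof -
    have "(\<Sum>t<K. of_bool (k * K + t \<in> J) * (if allowed k t then 1 else 2)) = (1::nat)"
      using eq[of "2 * M + 1 + k"] k D_sum[OF k, of J] goal_D[OF k]
      unfolding digit_sum[OF J] by (simp add: H_def)
    then obtain s where s: "s \<in> {..<K}" "of_bool (k * K + s \<in> J) * (if allowed k s then 1 else 2) = (1::nat)"
      "\<forall>t\<in>{..<K}. s \<noteq> t \<longrightarrow> of_bool (k * K + t \<in> J) * (if allowed k t then 1 else 2) = (0::nat)"
      by (subst (asm) sum_eq_1_iff) auto
    have sJ: "k * K + s \<in> J \<and> allowed k s"
      using s(2) by (cases "k * K + s \<in> J"; cases "allowed k s") simp_all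
    have "k * K + t \<in> J \<longleftrightarrow> t = s" if "t < K" for t
    proof (cases "t = s")
      case True then show ?thesis using sJ by simp
    next
      case False
      then show ?thesis using s(3) that by (auto split: if_splits)
    qed
    then show ?thesis using s(1) sJ by blast
  qed
  then obtain \<sigma> where \<sigma>: "\<And>k. k < M \<Longrightarrow> \<sigma> k < K \<and> allowed k (\<sigma> k) \<and> (\<forall>t<K. k * K + t \<in> J \<longleftrightarrow> t = \<sigma> k)"
    by metis
  have 1: "f1 (\<sigma> k) = g1 (\<sigma> (k + 1))" if k: "k + 1 < M" for k
  proof -
    have "f1 (\<sigma> k) + (C - g1 (\<sigma> (k + 1))) = C"
      using eq[of "Suc k"] fam_sum[of \<sigma> J k 1 f1 g1] \<sigma> k goal_fam1[of k] tile_fam1[of k]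
      unfolding digit_sum[OF J] by (simp add: H_def)
    \<comment> \<open>The subtraction is exact since \<open>g1\<close> is bounded by
      \<open>C\<close>; hence the colours are equal.\<close>
    then show ?thesis using fg[of "\<sigma> (k + 1)"] \<sigma>[of "k + 1"] k by auto
  qed
  have 2: "f2 (\<sigma> k) = g2 (\<sigma> (k + W))" if k: "k + W < M" for k
  proof -
    have "f2 (\<sigma> k) + (C - g2 (\<sigma> (k + W))) = C"
      using eq[of "Suc (M + k)"] fam_sum[of \<sigma> J k W f2 g2] \<sigma> k goal_fam2[of k] tile_fam2[of k] W
      unfolding digit_sum[OF J] by (simp add: H_def)
    then show ?thesis using fg[of "\<sigma> (k + W)"] \<sigma>[of "k + W"] k by auto
  qed
  show ?thesis using \<sigma> 1 2 unfolding tiled_def by blast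
qed

lemma tiled_imp_subset:
  assumes "tiled \<sigma>"
  defines "J \<equiv> (\<lambda>n. n * K + \<sigma> n) ` {..<M} \<union> {M * K + 1}"
  shows "J \<subseteq> {..<m}" "(\<Sum>j\<in>J. val B H (dig j)) = T" "M * K \<notin> J" "M * K + 2 \<notin> J"
proof -
  have \<sigma>: "\<sigma> n < K" "allowed n (\<sigma> n)" if "n < M" for n using assms(1) that by (auto simp: tiled_def)
  have lt: "n * K + \<sigma> n < M * K" if "n < M" for n
  proof -
    have "n * K + \<sigma> n < Suc n * K" using \<sigma>[OF that] by simp
    also have "\<dots> \<le> M * K" using that by (intro mult_le_mono1) simp
    finally show ?thesis .
  qed
  show J: "J \<subseteq> {..<m}" unfolding J_def m_def using lt by force
  show e: "M * K \<notin> J" "M * K + 2 \<notin> J" unfolding J_def using lt by force+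
  have mem: "n * K + t \<in> J \<longleftrightarrow> t = \<sigma> n" if nt: "n < M" "t < K" for n t
  proof
    assume "n * K + t \<in> J"
    moreover have "n * K + t < M * K"
    proof -
      have "n * K + t < Suc n * K" using nt by simp
      also have "\<dots> \<le> M * K" using nt by (intro mult_le_mono1) simp
      finally show ?thesis .
    qed
    ultimately obtain n' where n': "n' < M" "n * K + t = n' * K + \<sigma> n'" unfolding J_def by auto
    have "(n * K + t) div K = n" "(n' * K + \<sigma> n') div K = n'" using nt \<sigma>[OF n'(1)] by auto
    then have "n = n'" using n'(2) by simp
    then show "t = \<sigma> n" using n'(2) by simp
  qed (use nt in \<open>auto simp: J_def\<close>)
  have "(\<Sum>j\<in>J. dig j h) = goal h" if h: "h < H" for h
    using h
  proof (cases rule: digits_cases)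
    case 1
    then show ?thesis unfolding digit_sum[OF J] by (simp add: tile_def goal_def)
  next
    case (2 k)
    have "(\<Sum>n<M. \<Sum>t<K. of_bool (n * K + t \<in> J) * tile n t h) = (if k + 1 < M then f1 (\<sigma> k) + (C - g1 (\<sigma> (k + 1))) else 0)"
      using fam_sum[of \<sigma> J k 1 f1 g1] mem \<sigma> 2 tile_fam1[of k] by simp
    also have "\<dots> = goal h"
      using assms(1) fg[of "\<sigma> (k + 1)"] \<sigma>[of "k + 1"] 2 goal_fam1[of k] by (auto simp: tiled_def)
    finally show ?thesis unfolding digit_sum[OF J] using 2 by simp
  next
    case (3 k)
    have "(\<Sum>n<M. \<Sum>t<K. of_bool (n * K + t \<in> J) * tile n t h) = (if k + W < M then f2 (\<sigma> k) + (C - g2 (\<sigma> (k + W))) else 0)"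
      using fam_sum[of \<sigma> J k W f2 g2] mem \<sigma> 3 tile_fam2[of k] W by simp
    also have "\<dots> = goal h"
      using assms(1) fg[of "\<sigma> (k + W)"] \<sigma>[of "k + W"] 3 goal_fam2[of k] by (auto simp: tiled_def)
    finally show ?thesis unfolding digit_sum[OF J] using 3 by simp
  next
    case (4 k)
    have "(\<Sum>t<K. of_bool (k * K + t \<in> J) * (if allowed k t then 1 else 2)) = (\<Sum>t<K. if \<sigma> k = t then (if allowed k t then 1 else 2) else (0::nat))"
      using mem[OF 4(1)] by (intro sum.cong) auto
    also have "\<dots> = 1" using \<sigma>[OF 4(1)] by simp
    finally show ?thesis unfolding digit_sum[OF J] using 4 D_sum[OF 4(1), of J] goal_D[OF 4(1)] by simp
  next
    case 5
    then show ?thesis unfolding digit_sum[OF J] using e by (simp add: tile_high goal_def)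
  next
    case 6
    have "M * K + 1 \<in> J" by (simp add: J_def)
    then show ?thesis unfolding digit_sum[OF J] using e 6 by (simp add: tile_high goal_def)
  qed
  then show "(\<Sum>j\<in>J. val B H (dig j)) = T" using sum_digits_iff[OF J] by blast
qed

text \<open>\<open>0 < t\<close> puts the copies of the leading power below \<open>T\<close>;
  \<open>t < B ^ (3 * M + 1)\<close> lets item \<open>M * K\<close> together with one copy exceed
  \<open>T\<close>.\<close>

lemma T_split: "\<exists>t. T = B ^ (3 * M + 2) + t \<and> 0 < t \<and> t < B ^ (3 * M + 1)"
proof -
  have HS: "H = Suc (Suc (3 * M + 1))" by (simp add: H_def)
  have "T = B ^ (3 * M + 2) + val B (3 * M + 1) goal"
    unfolding T_def HS val_def by (simp add: goal_high[simplified])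
  moreover have "val B (3 * M + 1) goal < B ^ (3 * M + 1)" using goal_le by (rule val_less)
  moreover have "0 < val B (3 * M + 1) goal"
  proof -
    have "goal (2 * M + 1) * B ^ (2 * M + 1) \<le> val B (3 * M + 1) goal" using M by (intro val_ge) simp
    moreover have "goal (2 * M + 1) = 1" using goal_D[of 0] M by simp
    moreover have "0 < B ^ (2 * M + 1)" using B_ge by simp
    ultimately show ?thesis by (metis less_le_trans mult_1)
  qed
  ultimately show ?thesis by blast
qed

lemma B_dvd_dig: "B dvd val B H (dig j)"
  by (rule dvd_val) (auto simp: dig_def tile_def)

lemma B_dvd_T: "B dvd T"
  unfolding T_def by (rule dvd_val) (simp add: goal_def)

lemma tile_val: "j < M * K \<Longrightarrow> 0 < val B H (dig j) \<and> val B H (dig j) < B ^ (3 * M + 1)"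
proof -
  assume j: "j < M * K"
  let ?n = "j div K"
  have n: "?n < M" using j by (simp add: less_mult_imp_div_less)
  have "val B H (dig j) = val B (3 * M + 1) (dig j)"
    using j n by (intro val_extend) (auto simp: H_def dig_def tile_high)
  moreover have "dig j h < B" for h using dig_le[of j h] C2 by linarith
  then have "val B (3 * M + 1) (dig j) < B ^ (3 * M + 1)" by (intro val_less)
  moreover have "dig j (2 * M + 1 + ?n) * B ^ (2 * M + 1 + ?n) \<le> val B H (dig j)"
    using n by (intro val_ge) (simp add: H_def)
  moreover have "0 < dig j (2 * M + 1 + ?n) * B ^ (2 * M + 1 + ?n)"
    using j B_ge by (auto simp: dig_def tile_def)
  ultimately show ?thesis by linarith
qed

lemma extra_val: "val B H (dig (M * K)) = B ^ (3 * M + 1)"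
    "val B H (dig (M * K + 1)) = B ^ (3 * M + 2)" "val B H (dig (M * K + 2)) = B ^ (3 * M + 2)"
proof -
  have *: "val B H (\<lambda>h. of_bool (h = k)) = B ^ k" if "k < H" for k
  proof -
    have "val B H (\<lambda>h. of_bool (h = k)) = (\<Sum>h<H. if k = h then B ^ h else 0)"
      unfolding val_def by (intro sum.cong) auto
    then show ?thesis using that by simp
  qed
  have "dig (M * K) = (\<lambda>h. of_bool (h = 3 * M + 1))" "dig (M * K + 1) = (\<lambda>h. of_bool (h = 3 * M + 2))"
    "dig (M * K + 2) = (\<lambda>h. of_bool (h = 3 * M + 2))"
    by (auto simp: dig_def fun_eq_iff)
  then show "val B H (dig (M * K)) = B ^ (3 * M + 1)"
    "val B H (dig (M * K + 1)) = B ^ (3 * M + 2)" "val B H (dig (M * K + 2)) = B ^ (3 * M + 2)"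
    using *[of "3 * M + 1"] *[of "3 * M + 2"] by (simp_all add: H_def)
qed

lemma item_val: "j < m \<Longrightarrow> 0 < val B H (dig j) \<and> val B H (dig j) < T"
proof -
  assume j: "j < m"
  obtain t where t: "T = B ^ (3 * M + 2) + t" "0 < t" using T_split by blast
  have "0 < B ^ (3 * M + 1)" "B ^ (3 * M + 1) \<le> B ^ (3 * M + 2)"
    using B_ge by (auto intro: power_increasing)
  then have pw: "B ^ (3 * M + 1) \<le> B ^ (3 * M + 2)" "0 < B ^ (3 * M + 1)" "0 < B ^ (3 * M + 2)"
      "B ^ (3 * M + 1) < B ^ (3 * M + 2) + t" "B ^ (3 * M + 2) < B ^ (3 * M + 2) + t"
    using t(2) by linarith+
  consider "j < M * K" | "j = M * K" | "j = M * K + 1" | "j = M * K + 2" using j unfolding m_def by linarith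
  then show ?thesis
  proof cases
    case 1 then show ?thesis using tile_val[of j] t pw by linarith
  next
    case 2 then show ?thesis using t pw by (simp only: extra_val)
  next
    case 3 then show ?thesis using t pw by (simp only: extra_val)
  next
    case 4 then show ?thesis using t pw by (simp only: extra_val)
  qed
qed

section \<open>The merge instance of a tiling problem\<close>

definition cnt :: "nat \<Rightarrow> nat" where "cnt i = val B H (cdig i)"
definition lab :: "nat \<Rightarrow> nat" where "lab i = (if p \<le> i \<and> i \<le> p + m then 0 else Suc i)"

lemma cnt_simps:
  "i < p - 1 \<Longrightarrow> cnt i = Suc T"
  "p - 1 \<le> i \<Longrightarrow> i \<le> p \<Longrightarrow> cnt i = T"
  "p < i \<Longrightarrow> i \<le> p + m \<Longrightarrow> cnt i = val B H (dig (i - p - 1))"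
  "p + m < i \<Longrightarrow> cnt i = T"
proof -
  assume i: "i < p - 1"
  have HS: "H = Suc (3 * M + 2)" by (simp add: H_def)
  have "cdig i = (\<lambda>h. if h = 0 then 1 else goal h)" using i by (auto simp: cdig_def fun_eq_iff)
  then show "cnt i = Suc T" unfolding cnt_def T_def HS val_Suc by (simp add: goal_def)
next
  assume "p + m < i"
  then have "cdig i = goal" by (auto simp: cdig_def fun_eq_iff)
  then show "cnt i = T" by (simp add: cnt_def T_def)
qed (auto simp: cnt_def T_def cdig_def intro: val_cong)

lemma gadget: "gadget p m T cnt lab"
proof
  show "m < p" "1 \<le> m" by (auto simp: m_def p_def)
  have "10 \<le> T" using B_dvd_T B_ge T_split dvd_imp_le[of B T] by fastforce
  then show "2 \<le> T" by simp
  show "0 < cnt i \<and> cnt i < T" if "p < i" "i \<le> p + m" for i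
    using cnt_simps(3)[OF that] item_val[of "i - p - 1"] that by simp
qed (auto simp: cnt_simps lab_def)

interpretation G: gadget p m T cnt lab by (rule gadget)

lemma item_sum: "J \<subseteq> {p<..p + m} \<Longrightarrow> sum cnt J = (\<Sum>j\<in>(\<lambda>i. i - p - 1) ` J. val B H (dig j))"
proof -
  assume J: "J \<subseteq> {p<..p + m}"
  have "inj_on (\<lambda>i. i - p - 1) J"
  proof (rule inj_onI)
    fix x y assume "x \<in> J" "y \<in> J" and e: "x - p - 1 = y - p - 1"
    then have "p < x" "p < y" using J by auto
    then show "x = y" using e by linarith
  qed
  then have "(\<Sum>j\<in>(\<lambda>i. i - p - 1) ` J. val B H (dig j)) = (\<Sum>i\<in>J. val B H (dig (i - p - 1)))"
    by (simp add: sum.reindex)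
  also have "\<dots> = sum cnt J" using J cnt_simps(3) by (intro sum.cong) force+
  finally show ?thesis by simp
qed

theorem gs_yes_iff_tiled:
  "gs_yes p (map cnt [0..<2 * p + m]) (map lab [0..<2 * p + m]) \<longleftrightarrow> (\<exists>\<sigma>. tiled \<sigma>)"
  unfolding G.cs_def[unfolded G.N_def, symmetric] G.ls_def[unfolded G.N_def, symmetric]
proof
  assume "\<exists>\<sigma>. tiled \<sigma>"
  then obtain \<sigma> where s: "tiled \<sigma>" by blast
  define J where "J = (\<lambda>n. n * K + \<sigma> n) ` {..<M} \<union> {M * K + 1}"
  note J = tiled_imp_subset[OF s, folded J_def]
  let ?sh = "\<lambda>j. j + p + 1"
  have sh: "(\<lambda>i. i - p - 1) ` ?sh ` A = A" for A by (force simp: image_iff)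
  have sub: "?sh ` A \<subseteq> {p<..p + m}" if "A \<subseteq> {..<m}" for A using that by auto
  have su: "sum cnt (?sh ` A) = (\<Sum>j\<in>A. val B H (dig j))" if "A \<subseteq> {..<m}" for A
    using item_sum[OF sub[OF that]] unfolding sh .
  have rest: "{p<..p + m} - ?sh ` J = ?sh ` ({..<m} - J)"
  proof -
    have "{p<..p + m} = ?sh ` {..<m}"
    proof
      show "{p<..p + m} \<subseteq> ?sh ` {..<m}"
      proof
        fix i assume "i \<in> {p<..p + m}"
        then have "i = ?sh (i - p - 1)" "i - p - 1 \<in> {..<m}" by auto
        then show "i \<in> ?sh ` {..<m}" by blast
      qed
    qed auto
    then show ?thesis by (simp add: image_set_diff inj_def)
  qed
  let ?b = "M * K + 2"
  have rest2: "?sh ` ({..<m} - J) - {?sh ?b} = ?sh ` ({..<m} - J - {?b})" by auto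
  have bR: "?b \<in> {..<m} - J" and eR: "M * K \<in> {..<m} - J - {?b}" using J(3,4) by (auto simp: m_def)
  obtain t where t: "T = B ^ (3 * M + 2) + t" "t < B ^ (3 * M + 1)" using T_split by blast
  \<comment> \<open>Without \<open>?b\<close> neither copy of the leading power is left, so the sum
    stays below that power.\<close>
  have low: "(\<Sum>j\<in>{..<m} - J - {?b}. val B H (dig j)) < T"
  proof -
    let ?R = "{..<m} - J - {?b}"
    have R: "?R \<subseteq> {..<m}" "M * K + 1 \<notin> ?R" "?b \<notin> ?R" by (auto simp: J_def)
    have "(\<Sum>j\<in>?R. dig j (3 * M + 2)) = 0"
      unfolding digit_sum[OF R(1)] using R(2,3) by (simp add: tile_high)
    then have "val B H (\<lambda>h. \<Sum>j\<in>?R. dig j h) = val B (3 * M + 2) (\<lambda>h. \<Sum>j\<in>?R. dig j h)"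
      by (intro val_extend) (auto simp: H_def less_Suc_eq numeral_3_eq_3 le_less_Suc_eq)
    also have "\<dots> < B ^ (3 * M + 2)" using digit_sum_less[OF R(1)] by (rule val_less)
    finally show ?thesis using t by (simp add: sum_val)
  qed
  have R2: "(\<Sum>j\<in>{..<m} - J. val B H (dig j)) = val B H (dig ?b) + (\<Sum>j\<in>{..<m} - J - {?b}. val B H (dig j))"
    by (rule sum.remove[OF _ bR]) simp
  have "val B H (dig (M * K)) \<le> (\<Sum>j\<in>{..<m} - J - {?b}. val B H (dig j))"
    using eR by (intro member_le_sum) auto
  \<comment> \<open>\<open>?b\<close> matches the leading power of \<open>T\<close>, and item
    \<open>M * K\<close> outweighs the remainder \<open>t\<close>.\<close>
  then have gt: "T < (\<Sum>j\<in>{..<m} - J. val B H (dig j))"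
    unfolding R2 extra_val using t by linarith
  \<comment> \<open>The difference is positive and a multiple of \<open>B\<close>, which improves
    \<open>T <\<close> to \<open>Suc T <\<close>.\<close>
  have "B dvd (\<Sum>j\<in>{..<m} - J. val B H (dig j)) - T"
    by (intro dvd_diff_nat dvd_sum B_dvd_dig B_dvd_T)
  then have "B \<le> (\<Sum>j\<in>{..<m} - J. val B H (dig j)) - T" using gt by (intro dvd_imp_le) auto
  then have high: "Suc T < (\<Sum>j\<in>{..<m} - J. val B H (dig j))" using B_ge by linarith
  show "gs_yes p G.cs G.ls"
  proof (rule G.yes_instance[of "?sh ` J" "?sh ?b"])
    show "?sh ` J \<subseteq> {p<..p + m}" by (rule sub[OF J(1)])
    show "sum cnt (?sh ` J) = T" using su[OF J(1)] J(2) by simp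
    show "?sh ?b \<in> {p<..p + m} - ?sh ` J" unfolding rest using bR by blast
    show "sum cnt ({p<..p + m} - ?sh ` J - {?sh ?b}) < T"
      unfolding rest rest2 using low by (subst su) blast+
    show "Suc T < sum cnt ({p<..p + m} - ?sh ` J)"
      unfolding rest using high by (subst su) blast+
  qed
next
  assume yes: "gs_yes p G.cs G.ls"
  show "\<exists>\<sigma>. tiled \<sigma>"
  proof (rule ccontr)
    assume no: "\<not> (\<exists>\<sigma>. tiled \<sigma>)"
    have "\<not> gs_yes p G.cs G.ls"
    proof (rule G.no_instance)
      fix J assume J: "J \<subseteq> {p<..p + m}"
      let ?J = "(\<lambda>i. i - p - 1) ` J"
      have J': "?J \<subseteq> {..<m}" using J by (force simp: m_def)
      have "sum cnt J \<noteq> T" unfolding item_sum[OF J] using subset_imp_tiled[OF J'] no by blast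
      \<comment> \<open>Item sums and \<open>T\<close> are multiples of \<open>B\<close>, and
        consecutive numbers cannot both be.\<close>
      moreover have "sum cnt J \<noteq> Suc T"
      proof
        assume "sum cnt J = Suc T"
        moreover have "B dvd sum cnt J" unfolding item_sum[OF J] by (intro dvd_sum B_dvd_dig)
        ultimately have "B dvd Suc T - T" using B_dvd_T by (metis dvd_diff_nat)
        then show False using B_ge by auto
      qed
      ultimately show "sum cnt J \<noteq> T \<and> sum cnt J \<noteq> Suc T" by blast
    qed
    then show False using yes by blast
  qed
qed

end

section \<open>From computations to tilings\<close>

text \<open>A cell of the tableau is coded as \<open>s + G * a\<close>, where \<open>s\<close> is the symbol, \<open>a = 0\<close> if the head
  is elsewhere and \<open>a = q + 1\<close> if it is here in state \<open>q\<close>.\<close>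

definition move :: "tm \<Rightarrow> nat \<Rightarrow> nat \<Rightarrow> nat \<times> nat \<times> int" where
  "move \<delta> q s = (if q = 1 \<or> q = 2 then (q, s, 0) else \<delta> q s)"

text \<open>A head on the middle cell stays or leaves; otherwise one may arrive by a right move from
  the left or by a left move from the right. The neighbours matter only if they carry a
  head.\<close>

definition nextc :: "tm \<Rightarrow> nat \<Rightarrow> nat \<Rightarrow> nat \<Rightarrow> nat \<Rightarrow> nat" where
  "nextc \<delta> G u v r =
    (if 0 < v div G then (case move \<delta> (v div G - 1) (v mod G) of (q, s, d) \<Rightarrow> s + G * (if d = 0 then q + 1 else 0))
     else if 0 < u div G \<and> snd (snd (move \<delta> (u div G - 1) (u mod G))) = 1
       then v mod G + G * (fst (move \<delta> (u div G - 1) (u mod G)) + 1)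
     else if 0 < r div G \<and> snd (snd (move \<delta> (r div G - 1) (r mod G))) = -1
       then v mod G + G * (fst (move \<delta> (r div G - 1) (r mod G)) + 1)
     else v)"

definition cont :: "nat \<Rightarrow> config \<Rightarrow> int \<Rightarrow> nat" where
  "cont G c i = (case c of (q, tp, h) \<Rightarrow> tp i + G * (if i = h then q + 1 else 0))"

lemma tm_step_move: "tm_step \<delta> (q, tp, h) = (case move \<delta> q (tp h) of (q', s, d) \<Rightarrow> (q', tp(h := s), h + d))"
  by (auto simp: tm_step_def move_def split: prod.split)

lemma nextc_no_left: "u div G = 0 \<Longrightarrow> u' div G = 0 \<Longrightarrow> nextc \<delta> G u v r = nextc \<delta> G u' v r"
  and nextc_no_right: "r div G = 0 \<Longrightarrow> r' div G = 0 \<Longrightarrow> nextc \<delta> G u v r = nextc \<delta> G u v r'"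
  by (auto simp: nextc_def)

lemma move_bounds:
  assumes "tm_wf Q G \<delta>" "q < Q" "s < G"
  shows "fst (move \<delta> q s) < Q" "fst (snd (move \<delta> q s)) < G" "snd (snd (move \<delta> q s)) \<in> {-1, 0, 1}"
  using assms by (auto simp: move_def tm_wf_def)

lemma nextc_cont:
  assumes wf: "tm_wf Q G \<delta>" and "q < Q" "\<And>i. tp i < G"
  shows "cont G (tm_step \<delta> (q, tp, h)) i =
    nextc \<delta> G (cont G (q, tp, h) (i - 1)) (cont G (q, tp, h) i) (cont G (q, tp, h) (i + 1))"
proof -
  obtain q' s d where m: "move \<delta> q (tp h) = (q', s, d)" by (metis prod_cases3)
  have d: "d = -1 \<or> d = 0 \<or> d = 1" using move_bounds(3)[OF wf assms(2,3), of h] m by auto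
  have G: "0 < G" using wf by (simp add: tm_wf_def)
  have c: "(tp j + G * a) div G = a" "(tp j + G * a) mod G = tp j" for j a
    using assms(3)[of j] G by auto
  have l: "cont G (q, tp, h) j = tp j + G * (if j = h then q + 1 else 0)" for j
    by (simp add: cont_def)
  have st: "tm_step \<delta> (q, tp, h) = (q', tp(h := s), h + d)" by (simp add: tm_step_move m)
  show ?thesis
    unfolding nextc_def l c st
    using m d by (cases "i = h"; cases "i - 1 = h"; cases "i + 1 = h") (auto simp: cont_def)
qed

lemma run_bounds:
  assumes "tm_wf Q G \<delta>" "\<And>i. i < length w \<Longrightarrow> w ! i < G"
  shows "fst (tm_run \<delta> t w) < Q \<and> (\<forall>i. fst (snd (tm_run \<delta> t w)) i < G) \<and> \<bar>snd (snd (tm_run \<delta> t w))\<bar> \<le> int t"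
proof (induction t)
  case 0
  then show ?case using assms by (auto simp: tm_run_def tm_init_def tm_wf_def)
next
  case (Suc t)
  obtain q tp h where r: "tm_run \<delta> t w = (q, tp, h)" by (metis prod_cases3)
  have b: "q < Q" "\<And>i. tp i < G" "\<bar>h\<bar> \<le> int t" using Suc r by auto
  obtain q' s d where m: "move \<delta> q (tp h) = (q', s, d)" by (metis prod_cases3)
  have "tm_run \<delta> (Suc t) w = (q', tp(h := s), h + d)"
    using r m by (simp add: tm_run_def tm_step_move)
  then show ?case using move_bounds[OF assms(1) b(1) b(2)[of h]] m b by auto
qed

section \<open>The tableau of a verifier run as a tiling of a line\<close>

locale tableau =
  fixes Q G :: nat and \<delta> :: tm and x :: "bool list" and Yb Tm :: nat
  assumes wf: "tm_wf Q G \<delta>"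
    and halts: "\<And>y. length y \<le> Yb \<Longrightarrow> fst (tm_run \<delta> Tm (vword x y)) \<in> {1, 2}"
begin

text \<open>Column \<open>i\<close> is tape position \<open>i - off\<close>. The offset exceeds both
  the running time and the length of the word, so neither head nor word reaches the border
  columns.\<close>

definition "off = Tm + length x + Yb + 2"
definition "W = 2 * off + 1"
definition "M = Suc Tm * W"
definition "\<Gamma> = G * Suc Q"
text \<open>A tile is a window of three adjacent cells. \<open>f1\<close> and \<open>g1\<close>
  force neighbouring windows to agree on the two cells they share; \<open>f2\<close> computes from a
  window the cell of the next row.\<close>

definition "lft t = t div (\<Gamma> * \<Gamma>)"
definition "mid t = t div \<Gamma> mod \<Gamma>"
definition "rgt t = t mod \<Gamma>"
definition "f1 t = t mod (\<Gamma> * \<Gamma>)"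
definition "g1 t = t div \<Gamma>"
definition "f2 t = nextc \<delta> G (lft t) (mid t) (rgt t)"
definition "K = \<Gamma> * \<Gamma> * \<Gamma>"
text \<open>A generous exponent: with it \<open>base\<close> is an instance of
  \<open>n < 2 ^ n\<close>.\<close>

definition "\<beta> = (2 * K + 3) * (\<Gamma> * \<Gamma> + 2)"

text \<open>The witness is left open: up to \<open>Yb\<close> bits, a blank forcing a blank to its
  right, so that the nonblank part is a word. The summand \<open>G\<close> is the head in state 0 at
  tape position 0, which is the separator if \<open>x\<close> is empty.\<close>

definition initok :: "nat \<Rightarrow> nat \<Rightarrow> nat \<Rightarrow> bool" where
  "initok n v r \<longleftrightarrow> (if n < off then v = 0
     else if n < off + length x then v = (if x ! (n - off) then 2 else 1) + (if n = off then G else 0)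
     else if n = off + length x then v = 3 + (if n = off then G else 0)
     else if n \<le> off + length x + Yb then v < 3 \<and> (v = 0 \<longrightarrow> r = 0)
     else v = 0)"

text \<open>In the last row a head may only be in state 1, coded as 2. The left entry of the very
  first window has no neighbour to control it and is pinned to 0.\<close>

definition allowed :: "nat \<Rightarrow> nat \<Rightarrow> bool" where
  "allowed n t \<longleftrightarrow> (n = 0 \<longrightarrow> lft t = 0) \<and> (n < W \<longrightarrow> initok n (mid t) (rgt t)) \<and>
     (Tm * W \<le> n \<longrightarrow> mid t div G = 0 \<or> mid t div G = 2)"

lemma G4: "4 \<le> G" and Q3: "3 \<le> Q"
  using wf by (auto simp: tm_wf_def)

lemma GG: "4 * 4 \<le> \<Gamma>"
  unfolding \<Gamma>_def using G4 Q3 by (intro mult_le_mono) auto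

lemma mid_less: "mid t < \<Gamma>" and rgt_less: "rgt t < \<Gamma>"
  using GG by (auto simp: mid_def rgt_def)

lemma lft_less: "t < K \<Longrightarrow> lft t < \<Gamma>"
  by (simp add: K_def lft_def less_mult_imp_div_less mult.commute mult.left_commute)

lemma f1_eq: "f1 t = mid t * \<Gamma> + rgt t"
  by (simp add: f1_def mid_def rgt_def mod_mult2_eq mult.commute)

lemma g1_eq: "t < K \<Longrightarrow> g1 t = lft t * \<Gamma> + mid t"
  unfolding g1_def lft_def mid_def div_mult2_eq by (rule div_mult_mod_eq[symmetric])

lemma pair_less: "a < \<Gamma> \<Longrightarrow> b < \<Gamma> \<Longrightarrow> a * \<Gamma> + b < \<Gamma> * \<Gamma>"
proof -
  assume a: "a < \<Gamma>" "b < \<Gamma>"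
  then have "a * \<Gamma> + b < Suc a * \<Gamma>" by simp
  also have "\<dots> \<le> \<Gamma> * \<Gamma>" using a by (intro mult_le_mono1) simp
  finally show ?thesis .
qed

lemma nextc_less:
  assumes "u < \<Gamma>" "v < \<Gamma>" "r < \<Gamma>"
  shows "nextc \<delta> G u v r < \<Gamma>"
proof -
  have G: "0 < G" using G4 by simp
  have *: "a mod G < G" "a div G - 1 < Q" if "a < \<Gamma>" for a
  proof -
    have "a div G < Suc Q" using that G by (simp add: \<Gamma>_def less_mult_imp_div_less mult.commute)
    then show "a div G - 1 < Q" using Q3 by linarith
  qed (use G in simp)
  have code: "s + G * a < \<Gamma>" if "s < G" "a \<le> Q" for s a
  proof -
    have "s + G * a < G * Suc a" using that by simp
    also have "\<dots> \<le> \<Gamma>" unfolding \<Gamma>_def using that by (intro mult_le_mono2) simp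
    finally show ?thesis .
  qed
  have mv: "fst (move \<delta> (a div G - 1) (a mod G)) < Q" "fst (snd (move \<delta> (a div G - 1) (a mod G))) < G" if "a < \<Gamma>" for a
    using move_bounds[OF wf *(2)[OF that] *(1)[OF that]] by auto
  obtain q s d where m: "move \<delta> (v div G - 1) (v mod G) = (q, s, d)" by (metis prod_cases3)
  have 1: "s + G * (if d = 0 then q + 1 else 0) < \<Gamma>"
    by (rule code) (use mv[OF assms(2)] m in auto)
  have 2: "v mod G + G * (fst (move \<delta> (a div G - 1) (a mod G)) + 1) < \<Gamma>" if "a < \<Gamma>" for a
    by (rule code) (use mv(1)[OF that] *(1)[OF assms(2)] in auto)
  note if_less = if_split[of "\<lambda>z. z < \<Gamma>"]
  show ?thesis
    unfolding nextc_def m prod.case if_less using 1 2[OF assms(1)] 2[OF assms(3)] assms(2) by blast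
qed

sublocale tiling M W K "\<Gamma> * \<Gamma>" \<beta> allowed f1 g1 f2 mid
proof
  show "1 \<le> M" "1 \<le> W" by (simp_all add: M_def W_def)
  show "1 \<le> K" using GG by (simp add: K_def)
  show "f1 t \<le> \<Gamma> * \<Gamma> \<and> g1 t \<le> \<Gamma> * \<Gamma> \<and> f2 t \<le> \<Gamma> * \<Gamma> \<and> mid t \<le> \<Gamma> * \<Gamma>" if t: "t < K" for t
  proof -
    have "\<Gamma> * 1 \<le> \<Gamma> * \<Gamma>" using GG by (intro mult_le_mono2) simp
    moreover have "f2 t < \<Gamma>" unfolding f2_def by (rule nextc_less[OF lft_less[OF t] mid_less rgt_less])
    moreover have "f1 t < \<Gamma> * \<Gamma>" unfolding f1_eq by (rule pair_less[OF mid_less rgt_less])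
    moreover have "g1 t < \<Gamma> * \<Gamma>" unfolding g1_eq[OF t] by (rule pair_less[OF lft_less[OF t] mid_less])
    ultimately show ?thesis using mid_less[of t] by linarith
  qed
  show "(2 * K + 3) * (\<Gamma> * \<Gamma> + 2) < 2 ^ \<beta>" unfolding \<beta>_def by (rule less_exp)
qed

definition "C y t = tm_run \<delta> t (vword x y)"

lemma C_bounds:
  "fst (C y t) < Q" "fst (snd (C y t)) i < G" "\<bar>snd (snd (C y t))\<bar> \<le> int t"
proof -
  have "vword x y ! i < G" if "i < length (vword x y)" for i
  proof -
    have "vword x y ! i \<in> {1, 2, 3}" using nth_mem[OF that] by (auto simp: vword_def sym_def)
    then show ?thesis using G4 by auto
  qed
  then show "fst (C y t) < Q" "fst (snd (C y t)) i < G" "\<bar>snd (snd (C y t))\<bar> \<le> int t"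
    using run_bounds[OF wf, of "vword x y" t] unfolding C_def by blast+
qed

definition "vv y t i = cont G (C y t) (int i - int off)"

lemma cont_less: "cont G (C y t) i < \<Gamma>"
proof -
  obtain q tp h where c: "C y t = (q, tp, h)" by (metis prod_cases3)
  have b: "q < Q" "tp i < G" using C_bounds(1)[of y t] C_bounds(2)[of y t i] c by auto
  have "cont G (C y t) i \<le> tp i + G * Suc q" by (simp add: cont_def c)
  also have "\<dots> < G * Suc (Suc q)" using b by simp
  also have "\<dots> \<le> \<Gamma>" unfolding \<Gamma>_def using b by (intro mult_le_mono2) simp
  finally show ?thesis .
qed

lemma cont_no_head: "\<bar>i\<bar> > int t \<Longrightarrow> cont G (C y t) i div G = 0"
  using C_bounds(2)[of y t i] C_bounds(3)[of y t] by (auto simp: cont_def split: prod.split)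

lemma cont_Suc: "cont G (C y (Suc t)) i = nextc \<delta> G (cont G (C y t) (i - 1)) (cont G (C y t) i) (cont G (C y t) (i + 1))"
proof -
  obtain q tp h where c: "C y t = (q, tp, h)" by (metis prod_cases3)
  have "C y (Suc t) = tm_step \<delta> (q, tp, h)" using c by (simp add: C_def tm_run_def)
  then show ?thesis using nextc_cont[OF wf, of q tp h i] C_bounds(1)[of y t] C_bounds(2)[of y t] c by simp
qed

text \<open>The row-wrapping neighbours of border cells are harmless, because the head never gets there.\<close>

lemma vv_Suc:
  assumes "t \<le> Tm" "i < W"
    "0 < i \<Longrightarrow> u = vv y t (i - 1)" "i = 0 \<Longrightarrow> u div G = 0"
    "Suc i < W \<Longrightarrow> r = vv y t (Suc i)" "Suc i = W \<Longrightarrow> r div G = 0"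
  shows "nextc \<delta> G u (vv y t i) r = vv y (Suc t) i"
proof -
  let ?c = "cont G (C y t)" and ?i = "int i - int off"
  have "nextc \<delta> G u (?c ?i) r = nextc \<delta> G (?c (?i - 1)) (?c ?i) r"
  proof (cases "i = 0")
    case True
    then show ?thesis using assms(1,4) by (intro nextc_no_left cont_no_head) (auto simp: off_def)
  next
    case False
    then have e: "int (i - 1) - int off = ?i - 1" by simp
    have "u = ?c (int (i - 1) - int off)" using assms(3) False by (simp add: vv_def)
    then show ?thesis unfolding e by (simp only:)
  qed
  also have "\<dots> = nextc \<delta> G (?c (?i - 1)) (?c ?i) (?c (?i + 1))"
  proof (cases "Suc i = W")
    case True
    then show ?thesis using assms(1,6) by (intro nextc_no_right cont_no_head) (auto simp: off_def W_def)
  next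
    case False
    have e: "int (Suc i) - int off = ?i + 1" by simp
    have "r = ?c (int (Suc i) - int off)" using assms(2,5) False by (simp add: vv_def)
    then show ?thesis unfolding e by (simp only:)
  qed
  finally show ?thesis by (simp add: vv_def cont_Suc)
qed

lemma vv_border: "t \<le> Tm \<Longrightarrow> i = 0 \<or> Suc i = W \<Longrightarrow> vv y t i div G = 0"
  unfolding vv_def by (rule cont_no_head) (auto simp: off_def W_def)

lemma vv_0: "vv y 0 n = (if n < off then 0
   else wsym (vword x y) (n - off) + (if n = off then G else 0))"
proof -
  have "wsym w k = (if k < length w then w ! k else 0)" for w k by (simp add: wsym_def)
  then show ?thesis
    by (auto simp: vv_def C_def tm_run_def tm_init_def cont_def wsym_def nat_diff_distrib)
qed

lemma wsym_y: "wsym (vword x y) (Suc (length x + k)) = (if k < length y then sym (y ! k) else 0)"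
  by (auto simp: wsym_def vword_def nth_append)

lemma vv_0_y: "vv y 0 (Suc (off + length x + k)) = (if k < length y then sym (y ! k) else 0)"
  using wsym_y[of y k] by (simp add: vv_0)

lemma zones:
  obtains "n < off" | "off \<le> n" "n < off + length x" | "n = off + length x"
    | k where "n = Suc (off + length x + k)" "k < Yb" | k where "n = Suc (off + length x + k)" "Yb \<le> k"
proof -
  consider "n < off" | "off \<le> n" "n < off + length x" | "n = off + length x" | "off + length x < n" by linarith
  then show thesis
  proof cases
    case 4
    then obtain k where "n = Suc (off + length x + k)" using less_iff_Suc_add by auto
    then show thesis using that(4,5)[of k] by (cases "k < Yb") auto
  qed (use that in auto)
qed

lemma initok_vv:
  assumes "length y \<le> Yb" shows "initok n (vv y 0 n) (vv y 0 (Suc n))"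
proof (cases n rule: zones)
  case 1 then show ?thesis by (simp add: initok_def vv_0)
next
  case 2
  then have "wsym (vword x y) (n - off) = sym (x ! (n - off))" by (intro wsym_vword(1)) auto
  then show ?thesis using 2 by (simp add: initok_def vv_0 sym_def)
next
  case 3
  then show ?thesis using wsym_vword(2)[of x y] by (simp add: initok_def vv_0)
next
  case (4 k)
  then show ?thesis using vv_0_y[of y k] vv_0_y[of y "Suc k"]
    by (auto simp: initok_def sym_def split: if_splits)
next
  case (5 k)
  then show ?thesis using vv_0_y[of y k] assms by (simp add: initok_def)
qed

lemma W3: "3 \<le> W" by (simp add: W_def off_def)

definition "mk u v r = (u * \<Gamma> + v) * \<Gamma> + r"

lemma mk_simps:
  assumes "u < \<Gamma>" "v < \<Gamma>" "r < \<Gamma>"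
  shows "mk u v r < K" "lft (mk u v r) = u" "mid (mk u v r) = v" "rgt (mk u v r) = r"
proof -
  have d: "mk u v r div \<Gamma> = u * \<Gamma> + v" using assms by (simp add: mk_def)
  have "mk u v r < Suc (u * \<Gamma> + v) * \<Gamma>" using assms by (simp add: mk_def)
  also have "\<dots> \<le> \<Gamma> * \<Gamma> * \<Gamma>" using pair_less[OF assms(1,2)] by (intro mult_le_mono1) simp
  finally show "mk u v r < K" by (simp add: K_def)
  show "lft (mk u v r) = u" using assms by (simp add: lft_def div_mult2_eq d)
  show "mid (mk u v r) = v" using assms by (simp add: mid_def d)
  show "rgt (mk u v r) = r" using assms by (simp add: rgt_def mk_def)
qed

lemma accept_imp_tiled:
  assumes y: "length y \<le> Yb" and acc: "fst (C y Tm) = 1"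
  shows "\<exists>\<sigma>. tiled \<sigma>"
proof -
  define V where "V n = vv y (n div W) (n mod W)" for n
  \<comment> \<open>\<open>V\<close> continues past \<open>M\<close> into the next row of the run,
    which provides the right entry of the last window.\<close>
  define \<sigma> where "\<sigma> n = mk (if n = 0 then 0 else V (n - 1)) (V n) (V (Suc n))" for n
  have V: "V n < \<Gamma>" for n by (simp add: V_def vv_def cont_less)
  have G0: "0 < \<Gamma>" using GG by simp
  have s: "\<sigma> n < K" "lft (\<sigma> n) = (if n = 0 then 0 else V (n - 1))" "mid (\<sigma> n) = V n" "rgt (\<sigma> n) = V (Suc n)" for n
    using mk_simps[of "if n = 0 then 0 else V (n - 1)" "V n" "V (Suc n)"] V G0 unfolding \<sigma>_def by auto
  have 1: "f1 (\<sigma> n) = g1 (\<sigma> (n + 1))" for n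
    unfolding f1_eq g1_eq[OF s(1)] s by simp
  have Wp: "0 < W" using W3 by simp
  have nxt: "Suc n div W = n div W \<and> Suc n mod W = Suc (n mod W)" if "Suc (n mod W) < W" for n
    using that by (simp add: div_Suc mod_Suc)
  have wrap: "Suc n div W = Suc (n div W) \<and> Suc n mod W = 0" if "Suc (n mod W) = W" for n
    using that by (simp add: div_Suc mod_Suc)
  have 2: "f2 (\<sigma> n) = mid (\<sigma> (n + W))" if n: "n + W < M" for n
  proof -
    let ?t = "n div W" and ?i = "n mod W"
    have t: "Suc ?t \<le> Tm"
    proof -
      have "(n + W) div W < Suc Tm" using n unfolding M_def by (intro less_mult_imp_div_less)
      then show ?thesis using Wp by simp
    qed
    have "nextc \<delta> G (if n = 0 then 0 else V (n - 1)) (vv y ?t ?i) (V (Suc n)) = vv y (Suc ?t) ?i"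
    proof (rule vv_Suc)
      show "?t \<le> Tm" "?i < W" using t Wp by auto
      show "(if n = 0 then 0 else V (n - 1)) = vv y ?t (?i - 1)" if i: "0 < ?i"
      proof -
        obtain n' where n': "n = Suc n'" using i by (cases n) auto
        have "Suc (n' mod W) < W"
          using i wrap[of n'] Wp mod_less_divisor[OF Wp, of n'] unfolding n' by (metis Suc_lessI less_numeral_extra(3))
        then show ?thesis using nxt[of n'] by (simp add: n' V_def)
      qed
      show "(if n = 0 then 0 else V (n - 1)) div G = 0" if i: "?i = 0"
      proof (cases n)
        case (Suc n')
        have w: "Suc (n' mod W) = W"
          using i nxt[of n'] mod_less_divisor[OF Wp, of n'] unfolding Suc by (metis Suc_lessI nat.distinct(1))
        have "n' div W \<le> Tm" using wrap[OF w] t Suc by simp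
        then show ?thesis using w Suc by (simp add: V_def vv_border)
      qed simp
      show "V (Suc n) = vv y ?t (Suc ?i)" if "Suc ?i < W" using nxt[OF that] by (simp add: V_def)
      show "V (Suc n) div G = 0" if "Suc ?i = W" using wrap[OF that] t by (simp add: V_def vv_border)
    qed
    moreover have "V (n + W) = vv y (Suc ?t) ?i" using Wp by (simp add: V_def)
    ultimately show ?thesis unfolding f2_def s by (simp add: V_def)
  qed
  have 3: "allowed n (\<sigma> n)" if n: "n < M" for n
  proof -
    have "initok n (V n) (V (Suc n))" if "n < W"
    proof (cases "Suc n < W")
      case True
      then show ?thesis using initok_vv[OF y, of n] by (simp add: V_def)
    next
      case False
      then have "off + length x + Yb < n" "V n = vv y 0 n" using \<open>n < W\<close> by (auto simp: W_def off_def V_def)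
      then show ?thesis using initok_vv[OF y, of n] by (simp add: initok_def)
    qed
    moreover have "V n div G = 0 \<or> V n div G = 2" if "Tm * W \<le> n"
    proof -
      have "n div W = Tm"
        using that n Wp unfolding M_def by (intro div_nat_eqI) (auto simp: mult.commute)
      moreover obtain q tp h where c: "C y Tm = (q, tp, h)" by (metis prod_cases3)
      moreover have "q = 1" using acc c by simp
      moreover have "tp i < G" for i using C_bounds(2)[of y Tm i] c by simp
      ultimately show ?thesis using G4 by (auto simp: V_def vv_def cont_def)
    qed
    ultimately show ?thesis unfolding allowed_def s by simp
  qed
  have "tiled \<sigma>" unfolding tiled_def using s(1) 1 2 3 by blast
  then show ?thesis by blast
qed

lemma tiled_imp_accept:
  assumes "tiled \<sigma>"
  shows "\<exists>y. length y \<le> Yb \<and> fst (C y Tm) = 1"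
proof -
  define V where "V n = mid (\<sigma> n)" for n
  have K: "\<sigma> n < K" "allowed n (\<sigma> n)" if "n < M" for n using assms that by (auto simp: tiled_def)
  have adj: "lft (\<sigma> (Suc n)) = V n \<and> rgt (\<sigma> n) = V (Suc n)" if n: "Suc n < M" for n
  proof -
    have e: "V n * \<Gamma> + rgt (\<sigma> n) = lft (\<sigma> (Suc n)) * \<Gamma> + V (Suc n)"
      using assms n K(1)[OF n] unfolding tiled_def f1_eq V_def by (simp add: g1_eq)
    have "(a * \<Gamma> + b) div \<Gamma> = a \<and> (a * \<Gamma> + b) mod \<Gamma> = b" if "b < \<Gamma>" for a b using that by simp
    note dm = this
    have "V (Suc n) < \<Gamma>" unfolding V_def by (rule mid_less)
    from dm[OF rgt_less[of "\<sigma> n"], of "V n", unfolded e] dm[OF this, of "lft (\<sigma> (Suc n))"]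
    show ?thesis by metis
  qed
  have V_step: "V (n + W) = nextc \<delta> G (lft (\<sigma> n)) (V n) (V (Suc n))" if n: "n + W < M" for n
  proof -
    have "Suc n < M" using n W3 by linarith
    moreover have "f2 (\<sigma> n) = mid (\<sigma> (n + W))" using assms n unfolding tiled_def by blast
    ultimately show ?thesis using adj[of n] unfolding f2_def V_def by simp
  qed
  have WM: "W \<le> M" by (simp add: M_def)
  have W2: "off + length x + Yb + 2 \<le> W" by (simp add: W_def off_def)
  have init: "initok n (V n) (rgt (\<sigma> n))" if n: "n < W" for n
    using K(2)[of n] n WM unfolding allowed_def V_def by simp
  let ?z = "Suc (off + length x)"
  \<comment> \<open>The witness ends at the first blank of its zone, or after \<open>Yb\<close>
    symbols if there is none.\<close>
  define P where "P l \<longleftrightarrow> l = Yb \<or> V (?z + l) = 0" for l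
  define L where "L = (LEAST l. P l)"
  have PL: "P L" unfolding L_def by (rule LeastI[of P Yb]) (simp add: P_def)
  have nP: "\<not> P l" if "l < L" for l using not_less_Least[of l P] that by (simp add: L_def)
  have LY: "L \<le> Yb" unfolding L_def by (rule Least_le) (simp add: P_def)
  have zone: "V (?z + l) < 3 \<and> (V (?z + l) = 0 \<longrightarrow> V (Suc (?z + l)) = 0)" if "l < Yb" for l
  proof -
    have n: "?z + l < W" "Suc (?z + l) < M" using that W2 WM by auto
    have r: "rgt (\<sigma> (?z + l)) = V (Suc (?z + l))" using adj[OF n(2)] by simp
    have "\<not> ?z + l < off" "\<not> ?z + l < off + length x" "?z + l \<noteq> off + length x" "?z + l \<le> off + length x + Yb"
      using that by auto
    then show ?thesis using init[OF n(1)] unfolding initok_def r by simp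
  qed
  have blank: "l < Yb \<longrightarrow> V (?z + l) = 0" if "L \<le> l" for l
    using that
  proof (induction l rule: dec_induct)
    case base
    then show ?case using PL by (auto simp: P_def)
  next
    case (step l)
    then show ?case using zone[of l] by simp
  qed
  define y where "y = map (\<lambda>l. V (?z + l) = 2) [0..<L]"
  have ly: "length y = L" by (simp add: y_def)
  have row0: "V n = vv y 0 n" if n: "n < W" for n
  proof (cases n rule: zones)
    case 1 then show ?thesis using init[OF n] by (simp add: initok_def vv_0)
  next
    case 2
    then have "wsym (vword x y) (n - off) = sym (x ! (n - off))" by (intro wsym_vword(1)) auto
    then show ?thesis using 2 init[OF n] by (simp add: initok_def vv_0 sym_def)
  next
    case 3
    then show ?thesis using wsym_vword(2)[of x y] init[OF n] by (simp add: initok_def vv_0)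
  next
    case (4 k)
    show ?thesis
    proof (cases "k < L")
      case True
      then have "V (?z + k) \<noteq> 0" "V (?z + k) < 3" using nP[OF True] zone[OF 4(2)] 4(2) by (auto simp: P_def)
      then show ?thesis using True 4 vv_0_y[of y k] ly by (auto simp: y_def sym_def)
    next
      case False
      then show ?thesis using blank[of k] 4 vv_0_y[of y k] ly by simp
    qed
  next
    case (5 k)
    then show ?thesis using init[OF n] vv_0_y[of y k] ly LY by (simp add: initok_def)
  qed
  have rows: "\<forall>t'\<le>t. \<forall>i<W. V (t' * W + i) = vv y t' i" if "t \<le> Tm" for t
    using that
  proof (induction t)
    case 0
    then show ?case using row0 by simp
  next
    case (Suc t)
    then have IH: "\<And>t' i. t' \<le> t \<Longrightarrow> i < W \<Longrightarrow> V (t' * W + i) = vv y t' i" by auto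
    have nM: "t * W + i + W < M" if "i < W" for i
    proof -
      have "t * W + i + W < Suc (Suc t) * W" using that by simp
      also have "\<dots> \<le> M" unfolding M_def using Suc.prems by (intro mult_le_mono1) simp
      finally show ?thesis .
    qed
    have left: "i = 0 \<Longrightarrow> lft (\<sigma> (t * W + i)) div G = 0" "0 < i \<Longrightarrow> lft (\<sigma> (t * W + i)) = vv y t (i - 1)"
      if i: "i < W" for i
    proof -
      assume i0: "i = 0"
      show "lft (\<sigma> (t * W + i)) div G = 0"
      proof (cases t)
        case 0
        then show ?thesis using K(2)[of 0] M_def W3 i0 by (simp add: allowed_def)
      next
        case (Suc t')
        have e: "Suc (t' * W + (W - 1)) = t * W + i" using W3 Suc i0 by simp
        have "lft (\<sigma> (t * W + i)) = V (t' * W + (W - 1))"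
          using adj[of "t' * W + (W - 1)"] nM[OF i] unfolding e by simp
        also have "\<dots> = vv y t' (W - 1)" using IH[of t' "W - 1"] Suc W3 by simp
        finally show ?thesis using vv_border[of t' "W - 1" y] Suc Suc.prems W3 \<open>Suc t \<le> Tm\<close> by simp
      qed
    next
      assume i0: "0 < i"
      have e: "Suc (t * W + (i - 1)) = t * W + i" using i0 by simp
      have "lft (\<sigma> (t * W + i)) = V (t * W + (i - 1))"
        using adj[of "t * W + (i - 1)"] nM[OF i] unfolding e by simp
      then show "lft (\<sigma> (t * W + i)) = vv y t (i - 1)" using IH[of t "i - 1"] i by simp
    qed
    have right: "Suc i < W \<Longrightarrow> V (Suc (t * W + i)) = vv y t (Suc i)" for i
      using IH[of t "Suc i"] by simp
    have step: "V (Suc t * W + i) = vv y (Suc t) i" if i: "i < W" "Suc i = W \<Longrightarrow> V (Suc (t * W + i)) div G = 0" for i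
    proof -
      have "nextc \<delta> G (lft (\<sigma> (t * W + i))) (vv y t i) (V (Suc (t * W + i))) = vv y (Suc t) i"
        using left[OF i(1)] right[of i] i Suc.prems by (intro vv_Suc) auto
      moreover have "V (t * W + i + W) = nextc \<delta> G (lft (\<sigma> (t * W + i))) (V (t * W + i)) (V (Suc (t * W + i)))"
        by (rule V_step[OF nM[OF i(1)]])
      ultimately show ?thesis using IH[OF order_refl i(1)] by (simp add: algebra_simps)
    qed
    \<comment> \<open>The first cell of the new row is settled before the others: it is the right
      neighbour of the last cell of the old row and must be known to carry no head.\<close>
    have first: "V (Suc t * W) = vv y (Suc t) 0" using step[of 0] W3 by simp
    have last: "V (Suc (t * W + i)) div G = 0" if "Suc i = W" for i
    proof -
      have e: "Suc (t * W + i) = Suc t * W" using that by simp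
      show ?thesis unfolding e first using Suc.prems by (intro vv_border) auto
    qed
    have "V (Suc t * W + i) = vv y (Suc t) i" if "i < W" for i using step[OF that last] .
    then show ?case using IH by (auto simp: le_Suc_eq)
  qed
  obtain q tp h where c: "C y Tm = (q, tp, h)" by (metis prod_cases3)
  have h: "\<bar>h\<bar> \<le> int Tm" and tp: "tp h < G" using C_bounds(3)[of y Tm] C_bounds(2)[of y Tm h] c by auto
  \<comment> \<open>The column of the head at time \<open>Tm\<close>, inside the row because
    \<open>Tm < off\<close>; there the condition on the last row reveals the state.\<close>
  define i where "i = nat (h + int off)"
  have i: "i < W" "int i - int off = h" using h by (auto simp: i_def W_def off_def)
  have n: "Tm * W + i < M" using i(1) by (simp add: M_def)
  have "V (Tm * W + i) = tp h + G * Suc q"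
    using rows[OF order_refl] i by (simp add: vv_def cont_def c)
  then have "V (Tm * W + i) div G = Suc q" using tp G4 by (simp del: mult_Suc_right)
  moreover have "V (Tm * W + i) div G = 0 \<or> V (Tm * W + i) div G = 2"
    using K(2)[OF n] unfolding allowed_def V_def by simp
  ultimately have "q = 1" by simp
  then show ?thesis using c ly LY by (intro exI[of _ y]) simp
qed

theorem tiled_iff_accepts:
  "(\<exists>\<sigma>. tiled \<sigma>) \<longleftrightarrow> (\<exists>y. length y \<le> Yb \<and> tm_accepts \<delta> (map sym x @ [3] @ map sym y))"
proof -
  have "tm_accepts \<delta> (vword x y) \<longleftrightarrow> fst (C y Tm) = 1" if y: "length y \<le> Yb" for y
  proof
    assume "tm_accepts \<delta> (vword x y)"
    then obtain u where u: "fst (tm_run \<delta> u (vword x y)) = 1" unfolding tm_accepts_def by blast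
    define v where "v = max u Tm"
    have v: "u \<le> v" "Tm \<le> v" by (simp_all add: v_def)
    have "tm_run \<delta> v (vword x y) = tm_run \<delta> u (vword x y)"
      by (rule tm_run_halted[OF _ v(1)]) (simp add: u)
    moreover have "tm_run \<delta> v (vword x y) = tm_run \<delta> Tm (vword x y)"
      by (rule tm_run_halted[OF halts[OF y] v(2)])
    ultimately show "fst (C y Tm) = 1" using u by (simp add: C_def)
  next
    assume "fst (C y Tm) = 1"
    then show "tm_accepts \<delta> (vword x y)" unfolding tm_accepts_def C_def by blast
  qed
  then show ?thesis
    using tiled_imp_accept accept_imp_tiled unfolding vword_def[symmetric] by blast
qed

end

section \<open>Emitting the instance\<close>

definition cskip where "cskip = CFor (TNum 0) (Emit False)"

lemma out_cskip [simp]: "out w cskip e = []"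
  by (simp add: cskip_def)

text \<open>Bits are emitted as long as there is a set bit at or above the current position, which yields
  the canonical encoding.\<close>

definition emit_num :: "trm \<Rightarrow> trm \<Rightarrow> cmd" where
  "emit_num l b = CSeq (CFor l (CIf (TEx (lift l 0) (TAnd (TLe (TVar 1) (TVar 0)) (lift b 1)))
     (CSeq (Emit True) (CIf b (Emit True) (Emit False))) cskip)) (CSeq (Emit False) (Emit False))"

lemma eval_lift_1 [simp]: "eval w (lift t (Suc 0)) (y # x # e) = eval w t (y # e)"
  using eval_lift_append[of w t "[y]" x e] by simp

lemma bits_last: "0 < v \<Longrightarrow> bits v \<noteq> [] \<and> last (bits v)"
proof (induction v rule: less_induct)
  case (less v)
  show ?case
  proof (cases "v div 2 = 0")
    case True
    then have "v = 1" using less.prems by simp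
    then show ?thesis by (simp add: bits_pos)
  next
    case False
    then show ?thesis using less by (simp add: bits_pos)
  qed
qed

lemma ex_bit_above:
  assumes "v < 2 ^ l" shows "(\<exists>i'<l. i \<le> i' \<and> odd (v div 2 ^ i')) \<longleftrightarrow> i < length (bits v)"
proof
  assume "\<exists>i'<l. i \<le> i' \<and> odd (v div 2 ^ i')"
  then obtain i' where "i \<le> i'" "odd (v div 2 ^ i')" by blast
  then show "i < length (bits v)" using bits_nth[of i' v] by (auto split: if_splits)
next
  assume i: "i < length (bits v)"
  let ?n = "length (bits v) - 1"
  have "0 < v" using i by (cases v) auto
  then have "bits v ! ?n" using bits_last[of v] last_conv_nth[of "bits v"] by metis
  then have o: "odd (v div 2 ^ ?n)" using bits_nth[of ?n v] i by (simp split: if_splits)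
  have "?n < l"
  proof (rule ccontr)
    assume "\<not> ?n < l"
    then have "\<not> bit v ?n" using bit_bound[OF assms] by simp
    then show False using o by (simp add: odd_bit)
  qed
  then show "\<exists>i'<l. i \<le> i' \<and> odd (v div 2 ^ i')" using o i by (intro exI[of _ ?n]) auto
qed

lemma bits_map: "bits v = map (\<lambda>i. odd (v div 2 ^ i)) [0..<length (bits v)]"
proof (rule nth_equalityI)
  fix i assume "i < length (bits v)"
  then show "bits v ! i = map (\<lambda>i. odd (v div 2 ^ i)) [0..<length (bits v)] ! i"
    using bits_nth[of i v] by simp
qed simp

lemma concat_upt_cut:
  "n \<le> l \<Longrightarrow> concat (map (\<lambda>i. if i < n then F i else []) [0..<l]) = concat (map F [0..<n])"
proof (induction l rule: dec_induct)
  case base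
  show ?case by (intro arg_cong[of _ _ concat] map_cong) auto
qed simp

lemma out_emit_num:
  assumes "v < 2 ^ eval w l e" "\<And>i. i < eval w l e \<Longrightarrow> 0 < eval w b (i # e) \<longleftrightarrow> odd (v div 2 ^ i)"
  shows "out w (emit_num l b) e = enc_nat v"
proof -
  let ?l = "eval w l e" and ?n = "length (bits v)"
  have "(\<exists>i'<?l. i \<le> i' \<and> 0 < eval w b (i' # e)) \<longleftrightarrow> i < ?n" for i
    using ex_bit_above[OF assms(1), of i] assms(2) by blast
  then have "out w (emit_num l b) e =
      concat (map (\<lambda>i. if i < ?n then [True, 0 < eval w b (i # e)] else []) [0..<?l]) @ [False, False]"
    by (simp add: emit_num_def cong: if_cong) (intro arg_cong[of _ _ concat] map_cong; simp)
  also have "concat (map (\<lambda>i. if i < ?n then [True, 0 < eval w b (i # e)] else []) [0..<?l]) =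
      concat (map (\<lambda>i. [True, 0 < eval w b (i # e)]) [0..<?n])"
  proof (rule concat_upt_cut)
    show "?n \<le> ?l" using ex_bit_above[OF assms(1), of "?n - 1"] by (cases ?n) auto
  qed
  also have "\<dots> = concat (map (\<lambda>b. [True, b]) (bits v))"
  proof -
    have "?n \<le> ?l" using ex_bit_above[OF assms(1), of "?n - 1"] by (cases ?n) auto
    then have "map (\<lambda>i. [True, 0 < eval w b (i # e)]) [0..<?n] = map (\<lambda>i. [True, odd (v div 2 ^ i)]) [0..<?n]"
      using assms(2) by (intro map_cong) auto
    also have "\<dots> = map (\<lambda>b. [True, b]) (map (\<lambda>i. odd (v div 2 ^ i)) [0..<?n])" by simp
    finally show ?thesis unfolding bits_map[of v, symmetric] by simp
  qed
  finally show ?thesis by (simp add: enc_nat_def)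
qed

text \<open>For numbers that are values of terms. The power of 2 is capped at one more than the
  number; any divisor that large gives quotient 0.\<close>

definition emit_nat :: "trm \<Rightarrow> cmd" where
  "emit_nat t = emit_num t (TMod (TDiv (lift t 0)
     (TLoop (TVar 0) (TAdd (lift t 0) (TNum 1)) (TNum 1) (TMul (TNum 2) (TVar 0)))) (TNum 2))"

lemma out_emit_nat: "out w (emit_nat t) e = enc_nat (eval w t e)"
  unfolding emit_nat_def
proof (rule out_emit_num)
  let ?v = "eval w t e"
  show "?v < 2 ^ ?v" by (rule less_exp)
  fix i
  have pw: "rec_nat 1 (\<lambda>_ x. min (?v + 1) (2 * x)) i = min (?v + 1) (2 ^ i)" for i
    by (induction i) (auto simp: min_def)
  have "?v div min (?v + 1) (2 ^ i) = ?v div 2 ^ i" by (simp add: min_def)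
  moreover have "0 < min (?v + 1) (2 ^ i :: nat)" by simp
  ultimately show "0 < eval w (TMod (TDiv (lift t 0)
     (TLoop (TVar 0) (TAdd (lift t 0) (TNum 1)) (TNum 1) (TMul (TNum 2) (TVar 0)))) (TNum 2)) (i # e) \<longleftrightarrow> odd (?v div 2 ^ i)"
    using pw[of i] by (simp add: odd_iff_mod_2_eq_one)
qed

section \<open>The reduction as an output program\<close>

lemma val_div:
  assumes "\<And>h. h < H \<Longrightarrow> d h < B" "h \<le> H"
  shows "val B H d div B ^ h = val B (H - h) (\<lambda>k. d (h + k))"
  using assms
proof (induction h arbitrary: H d)
  case (Suc h)
  then obtain H' where H: "H = Suc H'" by (cases H) auto
  have "d 0 < B" using Suc.prems H by simp
  then have "val B H d div B = val B H' (\<lambda>k. d (Suc k))" by (simp add: H val_Suc)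
  then have "val B H d div B ^ Suc h = val B H' (\<lambda>k. d (Suc k)) div B ^ h" by (simp add: div_mult2_eq)
  also have "\<dots> = val B (H' - h) (\<lambda>k. d (Suc (h + k)))"
    using Suc.IH[of H' "\<lambda>k. d (Suc k)"] Suc.prems H by simp
  finally show ?case using H by simp
qed simp

text \<open>With a base \<open>2 ^ \<beta>\<close>, the digits occupy disjoint blocks of
  \<open>\<beta>\<close> bits.\<close>

lemma val_bit:
  assumes "\<And>h. h < H \<Longrightarrow> d h < 2 ^ \<beta>" "j < \<beta> * H"
  shows "odd (val (2 ^ \<beta>) H d div 2 ^ j) \<longleftrightarrow> odd (d (j div \<beta>) div 2 ^ (j mod \<beta>))"
proof -
  have \<beta>: "0 < \<beta>" using assms(2) by (cases \<beta>) auto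
  let ?h = "j div \<beta>" and ?r = "j mod \<beta>"
  have h: "?h < H" using assms(2) by (intro less_mult_imp_div_less) (simp add: mult.commute)
  have "(2::nat) ^ j = (2 ^ \<beta>) ^ ?h * 2 ^ ?r"
    by (simp add: power_mult[symmetric] power_add[symmetric])
  then have "val (2 ^ \<beta>) H d div 2 ^ j = val (2 ^ \<beta>) H d div (2 ^ \<beta>) ^ ?h div 2 ^ ?r"
    by (simp add: div_mult2_eq)
  also have "\<dots> = val (2 ^ \<beta>) (H - ?h) (\<lambda>k. d (?h + k)) div 2 ^ ?r"
    using val_div[of H d "2 ^ \<beta>" ?h] assms(1) h by simp
  also have "val (2 ^ \<beta>) (H - ?h) (\<lambda>k. d (?h + k)) = d ?h + 2 ^ \<beta> * val (2 ^ \<beta>) (H - ?h - 1) (\<lambda>k. d (?h + Suc k))"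
  proof -
    have "H - ?h = Suc (H - ?h - 1)" using h by simp
    then show ?thesis using val_Suc[of "2 ^ \<beta>" "H - ?h - 1" "\<lambda>k. d (?h + k)"] by simp
  qed
  finally have e: "val (2 ^ \<beta>) H d div 2 ^ j = (d ?h + 2 ^ \<beta> * val (2 ^ \<beta>) (H - ?h - 1) (\<lambda>k. d (?h + Suc k))) div 2 ^ ?r" .
  have r: "?r < \<beta>" using \<beta> by simp
  \<comment> \<open>Since \<open>?r < \<beta>\<close>, what lies above digit \<open>?h\<close> is
    still even after the shift and does not affect the parity.\<close>
  then have "(2::nat) ^ \<beta> = 2 ^ ?r * (2 * 2 ^ (\<beta> - ?r - 1))"
    by (metis Suc_diff_Suc add_diff_inverse_nat diff_Suc_eq_diff_pred diff_commute less_imp_le not_less power_Suc power_add)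
  then have "(d ?h + 2 ^ \<beta> * z) div 2 ^ ?r = d ?h div 2 ^ ?r + 2 * (2 ^ (\<beta> - ?r - 1) * z)" for z
    by (simp add: mult.assoc)
  then show ?thesis unfolding e by simp
qed

text \<open>The program must not depend on \<open>x\<close>. Hence \<open>Yb\<close> and
  \<open>Tm\<close> enter through the terms \<open>tY\<close> and \<open>tT\<close>, whereas
  \<open>\<Gamma>\<close>, \<open>K\<close> and \<open>\<beta>\<close> are functions of
  \<open>Q\<close> and \<open>G\<close> and may become literals.\<close>

locale reduction = tableau +
  fixes tY tT :: trm
  assumes tY [simp]: "\<And>e. eval (map sym x) tY e = Yb" and tT [simp]: "\<And>e. eval (map sym x) tT e = Tm"
begin

abbreviation "w \<equiv> map sym x"

definition "rOff = TAdd (TAdd (TAdd tT TLen) tY) (TNum 2)"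
definition "rW = TAdd (TMul (TNum 2) rOff) (TNum 1)"
definition "rM = TMul (TAdd tT (TNum 1)) rW"
definition "rP = TAdd (TMul rM (TNum K)) (TNum 4)"
definition "rm = TAdd (TMul rM (TNum K)) (TNum 3)"
definition "rFam d f g n t k = TIf (TAnd (TEq k n) (TLess (TAdd n d) rM)) (TTab f K t)
  (TIf (TEq (TAdd k d) n) (TTab (\<lambda>t. \<Gamma> * \<Gamma> - g t) K t) (TNum 0))"
definition "rInit n v r = TIf (TLess n rOff) (TEq v (TNum 0))
  (TIf (TLess n (TAdd rOff TLen)) (TEq v (TAdd (TSym (TSub n rOff)) (TIf (TEq n rOff) (TNum G) (TNum 0))))
  (TIf (TEq n (TAdd rOff TLen)) (TEq v (TAdd (TNum 3) (TIf (TEq n rOff) (TNum G) (TNum 0))))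
  (TIf (TLe n (TAdd (TAdd rOff TLen) tY)) (TAnd (TLess v (TNum 3)) (TImp (TEq v (TNum 0)) (TEq r (TNum 0))))
    (TEq v (TNum 0)))))"
definition "rAllowed n t = TAnd (TImp (TEq n (TNum 0)) (TEq (TTab lft K t) (TNum 0)))
  (TAnd (TImp (TLess n rW) (rInit n (TTab mid K t) (TTab rgt K t)))
    (TImp (TLe (TMul tT rW) n) (TTab (\<lambda>t. of_bool (mid t div G = 0 \<or> mid t div G = 2)) K t)))"
definition "rTile n t h = TIf (TEq h (TNum 0)) (TNum 0)
  (TIf (TLe h rM) (rFam (TNum 1) f1 g1 n t (TSub h (TNum 1)))
  (TIf (TLe h (TMul (TNum 2) rM)) (rFam rW f2 mid n t (TSub (TSub h (TNum 1)) rM))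
  (TIf (TEq h (TAdd (TAdd (TMul (TNum 2) rM) (TNum 1)) n)) (TIf (rAllowed n t) (TNum 1) (TNum 2)) (TNum 0))))"
definition "rDig j h = TIf (TLess j (TMul rM (TNum K))) (rTile (TDiv j (TNum K)) (TMod j (TNum K)) h)
  (TEq h (TIf (TEq j (TMul rM (TNum K))) (TAdd (TMul (TNum 3) rM) (TNum 1)) (TAdd (TMul (TNum 3) rM) (TNum 2))))"
definition "rGoal h = TIf (TEq h (TNum 0)) (TNum 0)
  (TIf (TLe h rM) (TIf (TLess (TAdd (TSub h (TNum 1)) (TNum 1)) rM) (TNum (\<Gamma> * \<Gamma>)) (TNum 0))
  (TIf (TLe h (TMul (TNum 2) rM)) (TIf (TLess (TAdd (TSub (TSub h (TNum 1)) rM) rW) rM) (TNum (\<Gamma> * \<Gamma>)) (TNum 0))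
  (TIf (TLe h (TMul (TNum 3) rM)) (TNum 1) (TEq h (TAdd (TMul (TNum 3) rM) (TNum 2))))))"
definition "rCdig i h = TIf (TAnd (TLess rP i) (TLe i (TAdd rP rm))) (rDig (TSub (TSub i rP) (TNum 1)) h)
  (TIf (TAnd (TLess i (TSub rP (TNum 1))) (TEq h (TNum 0))) (TNum 1) (rGoal h))"
text \<open>Digit and bit position are packed into one number, so that a table of constant size
  \<open>2 ^ \<beta> * \<beta>\<close> returns the bit.\<close>

definition "rBit = TTab (\<lambda>a. of_bool (odd (a div \<beta> div 2 ^ (a mod \<beta>)))) (2 ^ \<beta> * \<beta>)
  (TAdd (TMul (rCdig (TVar 1) (TDiv (TVar 0) (TNum \<beta>))) (TNum \<beta>)) (TMod (TVar 0) (TNum \<beta>)))"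
definition "rCnt = emit_num (TMul (TNum \<beta>) (TAdd (TMul (TNum 3) rM) (TNum 3))) rBit"
definition "rLab = emit_nat (TIf (TAnd (TLe rP (TVar 0)) (TLe (TVar 0) (TAdd rP rm))) (TNum 0) (TAdd (TVar 0) (TNum 1)))"
definition "rN = TAdd (TMul (TNum 2) rP) rm"
definition "rCmd = CSeq (emit_nat rP) (CSeq (emit_nat rN) (CSeq (CFor rN rCnt) (CFor rN rLab)))"

lemma eval_rOff [simp]: "eval w rOff e = off"
  by (simp add: rOff_def off_def)

lemma eval_rW [simp]: "eval w rW e = W"
  by (simp add: rW_def W_def)

lemma eval_rM [simp]: "eval w rM e = M"
  by (simp add: rM_def M_def)

lemma eval_rP [simp]: "eval w rP e = p"
  by (simp add: rP_def p_def)

lemma eval_rm [simp]: "eval w rm e = m"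
  by (simp add: rm_def m_def)

lemma eval_rN [simp]: "eval w rN e = 2 * p + m"
  by (simp add: rN_def)

lemma eval_rFam [simp]: "eval w t e < K \<Longrightarrow> eval w (rFam d f g n t k) e =
    fam (eval w d e) f g (eval w n e) (eval w t e) (eval w k e)"
  by (simp add: rFam_def fam_def)

lemma eval_rInit [simp]: "eval w (rInit n v r) e = of_bool (initok (eval w n e) (eval w v e) (eval w r e))"
proof -
  have "wsym w j = (if x ! j then 2 else 1)" if "j < length x" for j
    using that by (simp add: wsym_def sym_def)
  then show ?thesis by (auto simp: rInit_def initok_def)
qed

lemma eval_rAllowed [simp]: "eval w t e < K \<Longrightarrow>
    eval w (rAllowed n t) e = of_bool (allowed (eval w n e) (eval w t e))"
  by (auto simp: rAllowed_def allowed_def)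

lemma eval_rTile [simp]: "eval w t e < K \<Longrightarrow> eval w (rTile n t h) e = tile (eval w n e) (eval w t e) (eval w h e)"
  by (simp add: rTile_def tile_def)

lemma K_pos: "0 < K"
  using GG by (simp add: K_def)

lemma eval_rDig [simp]: "eval w (rDig j h) e = dig (eval w j e) (eval w h e)"
  using K_pos by (simp add: rDig_def dig_def)

lemma eval_rGoal [simp]: "eval w (rGoal h) e = goal (eval w h e)"
  by (simp add: rGoal_def goal_def)

lemma eval_rCdig [simp]: "eval w (rCdig i h) e = cdig (eval w i e) (eval w h e)"
  by (simp add: rCdig_def cdig_def)

lemma \<beta>_pos: "0 < \<beta>"
  by (simp add: \<beta>_def)

lemma cdig_less: "cdig i h < 2 ^ \<beta>"
  using dig_le[of "i - p - 1" h] C2 goal_le[of h] B_ge by (auto simp: cdig_def B_def)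

lemma eval_rBit: "j < \<beta> * H \<Longrightarrow> 0 < eval w rBit (j # i # e) \<longleftrightarrow> odd (cnt i div 2 ^ j)"
proof -
  assume j: "j < \<beta> * H"
  let ?a = "cdig i (j div \<beta>) * \<beta> + j mod \<beta>"
  have "?a < Suc (cdig i (j div \<beta>)) * \<beta>" using \<beta>_pos by simp
  also have "\<dots> \<le> 2 ^ \<beta> * \<beta>" using cdig_less[of i "j div \<beta>"] by (intro mult_le_mono1) simp
  finally have a: "?a < 2 ^ \<beta> * \<beta>" .
  have "?a div \<beta> = cdig i (j div \<beta>)" "?a mod \<beta> = j mod \<beta>" using \<beta>_pos by auto
  then have "0 < eval w rBit (j # i # e) \<longleftrightarrow> odd (cdig i (j div \<beta>) div 2 ^ (j mod \<beta>))"
    using a \<beta>_pos by (simp add: rBit_def)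
  then show ?thesis unfolding cnt_def B_def by (simp add: val_bit[OF cdig_less j])
qed

lemma out_rCnt: "out w rCnt (i # e) = enc_nat (cnt i)"
  unfolding rCnt_def
proof (rule out_emit_num)
  have "cnt i < (2 ^ \<beta>) ^ H" unfolding cnt_def B_def by (rule val_less) (rule cdig_less)
  then show "cnt i < 2 ^ eval w (TMul (TNum \<beta>) (TAdd (TMul (TNum 3) rM) (TNum 3))) (i # e)"
    by (simp add: H_def power_mult)
  show "0 < eval w rBit (j # i # e) \<longleftrightarrow> odd (cnt i div 2 ^ j)"
    if "j < eval w (TMul (TNum \<beta>) (TAdd (TMul (TNum 3) rM) (TNum 3))) (i # e)" for j
    using that by (intro eval_rBit) (simp add: H_def)
qed

lemma out_rLab: "out w rLab (i # e) = enc_nat (lab i)"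
  by (simp add: rLab_def out_emit_nat lab_def)

lemma out_rCmd: "out w rCmd [] = enc_inst p (map cnt [0..<2 * p + m]) (map lab [0..<2 * p + m])"
  by (simp add: rCmd_def out_emit_nat out_rCnt out_rLab enc_inst_def comp_def)

end

lemma bits_inj: "bits u = bits v \<Longrightarrow> u = v"
  using bits_nth[of _ u] bits_nth[of _ v] by (intro bit_eqI) (metis odd_bit)

lemma enc_nat_append_inj: "enc_nat u @ xs = enc_nat v @ ys \<Longrightarrow> u = v \<and> xs = ys"
proof -
  have "concat (map (\<lambda>b. [True, b]) l) @ [False, False] @ xs = concat (map (\<lambda>b. [True, b]) l') @ [False, False] @ ys
    \<Longrightarrow> l = l' \<and> xs = ys" for l l'
  proof (induction l arbitrary: l')
    case Nil then show ?case by (cases l') auto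
  next
    case (Cons a l) then show ?case by (cases l') auto
  qed
  from this[of "bits u" "bits v"] show "enc_nat u @ xs = enc_nat v @ ys \<Longrightarrow> u = v \<and> xs = ys"
    unfolding enc_nat_def by (auto dest: bits_inj)
qed

lemma encs_append_inj:
  "length us = length vs \<Longrightarrow> concat (map enc_nat us) @ xs = concat (map enc_nat vs) @ ys \<Longrightarrow> us = vs \<and> xs = ys"
proof (induction us vs rule: list_induct2)
  case (Cons u us v vs)
  then show ?case using enc_nat_append_inj[of u "concat (map enc_nat us) @ xs" v "concat (map enc_nat vs) @ ys"] by auto
qed simp

text \<open>Numbers are self-delimiting, and the stored number of versions tells where the labels
  begin. Without this, a word for a no-instance might also encode a yes-instance.\<close>

lemma enc_inst_inj:
  assumes "enc_inst p cs ls = enc_inst p' cs' ls'" "length ls = length cs" "length ls' = length cs'"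
  shows "p = p' \<and> cs = cs' \<and> ls = ls'"
proof -
  have 1: "p = p'" "enc_nat (length cs) @ concat (map enc_nat cs) @ concat (map enc_nat ls) =
      enc_nat (length cs') @ concat (map enc_nat cs') @ concat (map enc_nat ls')"
    using enc_nat_append_inj assms(1) unfolding enc_inst_def by blast+
  then have 2: "length cs = length cs'" "concat (map enc_nat cs) @ concat (map enc_nat ls) = concat (map enc_nat cs') @ concat (map enc_nat ls')"
    using enc_nat_append_inj by blast+
  then have 3: "cs = cs'" "concat (map enc_nat ls) = concat (map enc_nat ls')"
    using encs_append_inj by blast+
  have "ls = ls'" using encs_append_inj[of ls ls' "[]" "[]"] 3(2) 2(1) assms(2,3) by simp
  then show ?thesis using 1 3 by blast
qed

lemma enc_inst_in_GSMP:
  "0 < p \<Longrightarrow> length ls = length cs \<Longrightarrow> enc_inst p cs ls \<in> GSMP \<longleftrightarrow> gs_yes p cs ls"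
  unfolding GSMP_def using enc_inst_inj by blast

theorem GSMP_NP_hard: "NP_hard GSMP"
  unfolding NP_hard_def
proof (intro allI impI)
  fix L assume "in_NP L"
  then obtain Q G \<delta> c k where wf: "tm_wf Q G \<delta>" "poly_time_tm \<delta>"
    and L: "\<And>x. x \<in> L \<longleftrightarrow> (\<exists>y. length y \<le> c * (length x + 1) ^ k \<and> tm_accepts \<delta> (map sym x @ [3] @ map sym y))"
    unfolding in_NP_def by blast
  obtain c' k' where poly: "\<And>w. set w \<subseteq> {1, 2, 3} \<Longrightarrow> fst (tm_run \<delta> (c' * (length w + 1) ^ k') w) \<in> {1, 2}"
    using wf(2) unfolding poly_time_tm_def by blast
  define Yb where "Yb = (\<lambda>x :: bool list. c * (length x + 1) ^ k)"
  \<comment> \<open>One time for all witnesses: \<open>length (vword x y) + 1\<close> is at most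
    \<open>length x + 2 + Yb x\<close>, and a halted run stays halted.\<close>
  define Tm where "Tm = (\<lambda>x. c' * (length x + 2 + Yb x) ^ k')"
  define tY where "tY = TMul (TNum c) (TPow (TAdd TLen (TNum 1)) k)"
  define tT where "tT = TMul (TNum c') (TPow (TAdd (TAdd TLen (TNum 2)) tY) k')"
  have tab: "reduction Q G \<delta> x (Yb x) (Tm x) tY tT" for x
  proof
    show "tm_wf Q G \<delta>" by (rule wf(1))
    show "fst (tm_run \<delta> (Tm x) (vword x y)) \<in> {1, 2}" if y: "length y \<le> Yb x" for y
    proof -
      have h: "fst (tm_run \<delta> (c' * (length (vword x y) + 1) ^ k') (vword x y)) \<in> {1, 2}"
        by (rule poly) (auto simp: vword_def sym_def)
      have "c' * (length (vword x y) + 1) ^ k' \<le> Tm x"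
        unfolding Tm_def using y by (intro mult_le_mono2 power_mono) (auto simp: vword_def)
      from tm_run_halted[OF h this] h show ?thesis by simp
    qed
    show "eval (map sym x) tY e = Yb x" for e by (simp add: tY_def Yb_def)
    then show "eval (map sym x) tT e = Tm x" for e by (simp add: tT_def Tm_def)
  qed
  \<comment> \<open>\<open>reduction.rCmd\<close> takes no argument \<open>x\<close>, so a single
    program serves all inputs.\<close>
  define cmd where "cmd = reduction.rCmd Q G \<delta> tY tT"
  have "x \<in> L \<longleftrightarrow> out (map sym x) cmd [] \<in> GSMP" for x
  proof -
    interpret reduction Q G \<delta> x "Yb x" "Tm x" tY tT by (rule tab)
    have "x \<in> L \<longleftrightarrow> (\<exists>y. length y \<le> Yb x \<and> tm_accepts \<delta> (map sym x @ [3] @ map sym y))"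
      unfolding Yb_def by (rule L)
    also have "\<dots> \<longleftrightarrow> (\<exists>\<sigma>. tiled \<sigma>)" by (rule tiled_iff_accepts[symmetric])
    also have "\<dots> \<longleftrightarrow> gs_yes p (map cnt [0..<2 * p + m]) (map lab [0..<2 * p + m])" by (rule gs_yes_iff_tiled[symmetric])
    also have "\<dots> \<longleftrightarrow> out (map sym x) cmd [] \<in> GSMP"
      unfolding cmd_def out_rCmd by (rule enc_inst_in_GSMP[symmetric]) (simp_all add: p_def)
    finally show ?thesis .
  qed
  then show "poly_reduces L GSMP"
    unfolding poly_reduces_def using cmd_poly_computable[of cmd] by blast
qed

theorem theorem1:
  shows "NP_complete GSMP"
  unfolding NP_complete_def using GSMP_in_NP GSMP_NP_hard by blast

end
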